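(* Let $s>0$ and let $\alpha\in L^1(\mathbb{R})$, with $A=\int_{\mathbb{R}}\alpha(y)\,dy$. Consider the Cauchy problem $$u_{tt}=\alpha*u^3-3u\,(\alpha*u^2)+3u^2\,(\alpha*u)-Au^3,\qquad u(x,0)=\varphi(x),\ u_t(x,0)=\psi(x),$$ where $(\alpha*v)(x)=\int_{\mathbb{R}}\alpha(y-x)v(y)\,dy$. If $\varphi,\psi\in H^s(\mathbb{R})\cap L^\infty(\mathbb{R})$, then there is some $T>0$ such that this Cauchy problem is well posed with solution in $C^2([0,T],H^s(\mathbb{R})\cap L^\infty(\mathbb{R}))$.
   Context: $H^s(\mathbb{R})$ is the $L^2$ Sobolev space with norm $\|u\|_{H^s}^2=\int_{\mathbb{R}}(1+\xi^2)^s|\hat u(\xi)|^2d\xi$; $H^s\cap L^\infty$ carries the norm $\|u\|_{H^s}+\|u\|_\infty$. (This equation is $u_{tt}=\int\alpha(y-x)(u(y,t)-u(x,t))^3dy$ written out.) "Well posed with solution in $C^2([0,T],X)$" means: there exists a unique solution $u\in C^2([0,T],X)$ of the Cauchy problem, and the solution depends continuously on the initial data $(\varphi,\psi)\in X\times X$ (in the norm of $C([0,T],X)$). *)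

theory Defs
  imports "HOL-Analysis.Analysis" "HOL-Probability.Essential_Supremum"
begin

definition sq_integrable :: "(real \<Rightarrow> 'b::{real_normed_vector, second_countable_topology}) \<Rightarrow> bool" where
  "sq_integrable f \<longleftrightarrow> f \<in> borel_measurable lborel \<and> integrable lborel (\<lambda>x. (norm (f x))^2)"

definition fourier_L1 :: "(real \<Rightarrow> complex) \<Rightarrow> real \<Rightarrow> complex" where
  "fourier_L1 \<phi> x = (LINT \<xi>|lborel. \<phi> \<xi> * cis (- (x * \<xi>)))"

text \<open>g is (a representative of) the L2 Fourier transform of u, characterised by the
  multiplication formula  int hat u phi = int u hat phi  for test functions phi.\<close>
definition is_L2_fourier :: "(real \<Rightarrow> real) \<Rightarrow> (real \<Rightarrow> complex) \<Rightarrow> bool" where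
  "is_L2_fourier u g \<longleftrightarrow> sq_integrable g \<and>
     (\<forall>\<phi>. integrable lborel \<phi> \<and> sq_integrable \<phi> \<and> sq_integrable (fourier_L1 \<phi>) \<longrightarrow>
        (LINT \<xi>|lborel. g \<xi> * \<phi> \<xi>) = (LINT x|lborel. complex_of_real (u x) * fourier_L1 \<phi> x))"

definition fourier_L2 :: "(real \<Rightarrow> real) \<Rightarrow> real \<Rightarrow> complex" where
  "fourier_L2 u = (SOME g. is_L2_fourier u g)"

definition in_Hs :: "real \<Rightarrow> (real \<Rightarrow> real) \<Rightarrow> bool" where
  "in_Hs s u \<longleftrightarrow> sq_integrable u \<and>
     (\<exists>g. is_L2_fourier u g \<and> integrable lborel (\<lambda>\<xi>. (1 + \<xi>^2) powr s * (cmod (g \<xi>))^2))"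

definition Hs_norm :: "real \<Rightarrow> (real \<Rightarrow> real) \<Rightarrow> real" where
  "Hs_norm s u = sqrt (LINT \<xi>|lborel. (1 + \<xi>^2) powr s * (cmod (fourier_L2 u \<xi>))^2)"

definition in_Linf :: "(real \<Rightarrow> real) \<Rightarrow> bool" where
  "in_Linf u \<longleftrightarrow> u \<in> borel_measurable lborel \<and> (\<exists>C. AE x in lborel. \<bar>u x\<bar> \<le> C)"

definition Linf_norm :: "(real \<Rightarrow> real) \<Rightarrow> real" where
  "Linf_norm u = real_of_ereal (esssup lborel (\<lambda>x. ereal \<bar>u x\<bar>))"

definition in_X :: "real \<Rightarrow> (real \<Rightarrow> real) \<Rightarrow> bool" where
  "in_X s u \<longleftrightarrow> in_Hs s u \<and> in_Linf u"

definition X_norm :: "real \<Rightarrow> (real \<Rightarrow> real) \<Rightarrow> real" where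
  "X_norm s u = Hs_norm s u + Linf_norm u"

definition X_cont :: "real \<Rightarrow> real \<Rightarrow> (real \<Rightarrow> real \<Rightarrow> real) \<Rightarrow> bool" where
  "X_cont s T u \<longleftrightarrow> (\<forall>t\<in>{0..T}. \<forall>\<epsilon>>0. \<exists>\<delta>>0. \<forall>t'\<in>{0..T}. \<bar>t' - t\<bar> < \<delta> \<longrightarrow>
      X_norm s (\<lambda>x. u t' x - u t x) < \<epsilon>)"

definition X_deriv :: "real \<Rightarrow> real \<Rightarrow> (real \<Rightarrow> real \<Rightarrow> real) \<Rightarrow> (real \<Rightarrow> real \<Rightarrow> real) \<Rightarrow> bool" where
  "X_deriv s T u u' \<longleftrightarrow> (\<forall>t\<in>{0..T}. \<forall>\<epsilon>>0. \<exists>\<delta>>0. \<forall>t'\<in>{0..T}. t' \<noteq> t \<and> \<bar>t' - t\<bar> < \<delta> \<longrightarrow>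
      X_norm s (\<lambda>x. (u t' x - u t x) / (t' - t) - u' t x) < \<epsilon>)"

definition conv :: "(real \<Rightarrow> real) \<Rightarrow> (real \<Rightarrow> real) \<Rightarrow> real \<Rightarrow> real" where
  "conv \<alpha> v x = (LINT y|lborel. \<alpha> (y - x) * v y)"

definition rhs :: "(real \<Rightarrow> real) \<Rightarrow> (real \<Rightarrow> real) \<Rightarrow> real \<Rightarrow> real" where
  "rhs \<alpha> v x = conv \<alpha> (\<lambda>y. (v y)^3) x - 3 * v x * conv \<alpha> (\<lambda>y. (v y)^2) x
       + 3 * (v x)^2 * conv \<alpha> v x - (LINT y|lborel. \<alpha> y) * (v x)^3"

definition is_C2_solution :: "real \<Rightarrow> (real \<Rightarrow> real) \<Rightarrow> real \<Rightarrow> (real \<Rightarrow> real) \<Rightarrow> (real \<Rightarrow> real)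
    \<Rightarrow> (real \<Rightarrow> real \<Rightarrow> real) \<Rightarrow> bool" where
  "is_C2_solution s \<alpha> T \<phi> \<psi> u \<longleftrightarrow> (\<exists>u1 u2.
     (\<forall>t\<in>{0..T}. in_X s (u t) \<and> in_X s (u1 t) \<and> in_X s (u2 t)) \<and>
     X_deriv s T u u1 \<and> X_deriv s T u1 u2 \<and> X_cont s T u2 \<and>
     (\<forall>t\<in>{0..T}. AE x in lborel. u2 t x = rhs \<alpha> (u t) x) \<and>
     (AE x in lborel. u 0 x = \<phi> x) \<and> (AE x in lborel. u1 0 x = \<psi> x))"

definition well_posed :: "real \<Rightarrow> (real \<Rightarrow> real) \<Rightarrow> real \<Rightarrow> (real \<Rightarrow> real) \<Rightarrow> (real \<Rightarrow> real) \<Rightarrow> bool" where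
  "well_posed s \<alpha> T \<phi> \<psi> \<longleftrightarrow>
     (\<exists>u. is_C2_solution s \<alpha> T \<phi> \<psi> u) \<and>
     (\<forall>u v. is_C2_solution s \<alpha> T \<phi> \<psi> u \<and> is_C2_solution s \<alpha> T \<phi> \<psi> v \<longrightarrow>
        (\<forall>t\<in>{0..T}. AE x in lborel. u t x = v t x)) \<and>
     (\<forall>u. is_C2_solution s \<alpha> T \<phi> \<psi> u \<longrightarrow>
        (\<forall>\<epsilon>>0. \<exists>\<delta>>0. \<forall>\<phi>' \<psi>'. in_X s \<phi>' \<and> in_X s \<psi>' \<and>
           X_norm s (\<lambda>x. \<phi>' x - \<phi> x) + X_norm s (\<lambda>x. \<psi>' x - \<psi> x) < \<delta> \<longrightarrow>
           (\<exists>v. is_C2_solution s \<alpha> T \<phi>' \<psi>' v) \<and>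
           (\<forall>v. is_C2_solution s \<alpha> T \<phi>' \<psi>' v \<longrightarrow>
              (\<forall>t\<in>{0..T}. X_norm s (\<lambda>x. v t x - u t x) < \<epsilon>))))"

end

theory Submission
  imports Defs "HOL-Probability.Levy" "HOL-Real_Asymp.Real_Asymp"
begin

text \<open>The space $X = H^s \cap L^\infty$ is a Banach algebra for every $s > 0$, convolution with $\alpha$
  is bounded on it, and so the equation is $u'' = N(u, u, u)$ with a bounded trilinear $N$.

  The algebra property rests on approximation by band limited functions: let $u_R$ be the convolution
  of $u$ with a kernel, of $L^1$ norm at most 2 uniformly in $R$, whose transform is 1 on $[-R, R]$ and 0
  outside $[-2R, 2R]$. The product $u_R v_R$ has its spectrum in $[-4R, 4R]$, so the part of the transform
  of $uv$ beyond $4R$ is controlled in $L^2$ by $uv - u_R v_R = (u - u_R) v + u_R (v - v_R)$, hence by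
  the tails of the transforms of $u$ and $v$ beyond $R$. Integrating the squares against
  $R^{2s-1} dR$ gives the $H^s$ estimate, without derivatives and without restriction on $s$.

  Existence is then a power series in time, $u(t) = \sum_n c_n t^n$ with $c_n \in X$, which avoids
  integrating $X$-valued functions; the recursion for $c_n$ gives a geometric bound that depends only
  on a bound for the data, so nearby data have solutions on the same time interval.
  Uniqueness and continuous dependence follow from a Gronwall inequality for the norm of the
  difference of two solutions and of its time derivative.\<close>

subsection \<open>Square integrable functions\<close>

text \<open>The norm of H^s is evaluated on a transform picked by \<open>SOME\<close> among the
  solutions of a multiplication formula, so existence and almost everywhere uniqueness of such a
  transform must be settled before any norm can be computed. The transform carries no normalising
  factor, hence the constant \<open>sqrt (2 * pi)\<close> in Plancherel; \<open>conv\<close> is a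
  correlation, with kernel at y - x, hence multipliers reflected to - \<xi>. For s <= 1/2 the space
  H^s alone is not an algebra. The product estimate is tame: each Sobolev norm is multiplied by a
  sup norm of the other factor. For the term with u_R this requires a sup bound uniform in R, which
  is what the \<open>L^1\<close> bound on the kernel provides; cutting the spectrum sharply would
  give a kernel that is not integrable. Elements of X are represented by functions on points, so
  most identities hold almost everywhere and measurability has to be carried along. In the Gronwall
  inequality the norm of a differentiable curve need not be differentiable, so only an upper bound
  for its growth to the right is assumed.\<close>

definition l2 :: "(real \<Rightarrow> 'b::{real_normed_vector, second_countable_topology}) \<Rightarrow> real" where
  "l2 f = sqrt (LINT x|lborel. (norm (f x))^2)"

lemma sq_integrable_measurable [measurable_dest]:
  "sq_integrable f \<Longrightarrow> f \<in> borel_measurable borel"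
  by (simp add: sq_integrable_def)

lemma sq_integrable_D: "sq_integrable f \<Longrightarrow> integrable lborel (\<lambda>x. (norm (f x))^2)"
  by (simp add: sq_integrable_def)

lemma l2_nonneg [simp]: "0 \<le> l2 f"
  by (simp add: l2_def)

lemma l2_power2: "(l2 f)^2 = (LINT x|lborel. (norm (f x))^2)"
  by (simp add: l2_def)

lemma nn_integral_norm_power2:
  "sq_integrable f \<Longrightarrow> (\<integral>\<^sup>+x. ennreal ((norm (f x))^2) \<partial>lborel) = ennreal ((l2 f)^2)"
  unfolding l2_power2 by (intro nn_integral_eq_integral sq_integrable_D) auto

text \<open>Entry point for estimates obtained by monotone convergence, Fatou or Tonelli: a bound on
  the nonnegative integral yields membership and norm together. The sign condition in the second
  part reflects that \<open>ennreal\<close> sends negative numbers to 0.\<close>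

lemma sq_integrableI_nn:
  assumes "f \<in> borel_measurable borel" and "(\<integral>\<^sup>+x. ennreal ((norm (f x))^2) \<partial>lborel) \<le> ennreal B"
  shows "sq_integrable f" and "B \<ge> 0 \<Longrightarrow> (l2 f)^2 \<le> B"
proof -
  have "(\<integral>\<^sup>+x. ennreal ((norm (f x))^2) \<partial>lborel) < \<infinity>"
    by (rule le_less_trans[OF assms(2)]) simp
  then show s: "sq_integrable f"
    unfolding sq_integrable_def using assms(1) by (auto simp: integrable_iff_bounded)
  show "(l2 f)^2 \<le> B" if "B \<ge> 0"
    using assms(2) nn_integral_norm_power2[OF s] that by simp
qed

lemma sq_integrable_bound:
  assumes "f \<in> borel_measurable borel" and "sq_integrable g"
    and "AE x in lborel. norm (f x) \<le> C * norm (g x)"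
  shows "sq_integrable f"
  unfolding sq_integrable_def
proof
  have "integrable lborel (\<lambda>x. C^2 * (norm (g x))^2)"
    using assms(2) by (intro integrable_mult_right sq_integrable_D)
  then show "integrable lborel (\<lambda>x. (norm (f x))\<^sup>2)"
    apply (rule Bochner_Integration.integrable_bound)
    using assms(1) apply measurable
    using assms(3) apply eventually_elim
    by (simp add: power_mono flip: power_mult_distrib)
qed (use assms in auto)

lemma l2_mono:
  assumes "f \<in> borel_measurable borel" and "sq_integrable g"
    and "AE x in lborel. norm (f x) \<le> C * norm (g x)" and "C \<ge> 0"
  shows "l2 f \<le> C * l2 g"
proof -
  have "(LINT x|lborel. (norm (f x))\<^sup>2) \<le> (LINT x|lborel. C^2 * (norm (g x))^2)"
    apply (rule integral_mono_AE)
    using sq_integrable_bound[OF assms(1-3)] assms(2) apply (auto simp: sq_integrable_def)[2]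
    using assms(3) apply eventually_elim
    by (simp add: power_mono flip: power_mult_distrib)
  then have "(l2 f)^2 \<le> (C * l2 g)^2"
    by (simp add: l2_power2 power_mult_distrib)
  then show ?thesis
    by (rule power2_le_imp_le) (simp add: assms)
qed

lemma l2_cong_AE:
  assumes "f \<in> borel_measurable borel" "g \<in> borel_measurable borel" "AE x in lborel. f x = g x"
  shows "l2 f = l2 g"
  unfolding l2_def using assms by (intro arg_cong[where f=sqrt] integral_cong_AE) auto

lemma sq_integrable_cong_AE:
  assumes "sq_integrable f" "g \<in> borel_measurable borel" "AE x in lborel. f x = g x"
  shows "sq_integrable g"
  by (rule sq_integrable_bound[where g=f and C=1]) (use assms in auto)

lemma sq_integrable_zero [simp]: "sq_integrable (\<lambda>x. 0)"
  by (simp add: sq_integrable_def)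

lemma sq_integrable_add:
  assumes "sq_integrable f" "sq_integrable g"
  shows "sq_integrable (\<lambda>x. f x + g x)"
  unfolding sq_integrable_def
proof
  have *: "(norm (f x + g x))^2 \<le> 2 * (norm (f x))^2 + 2 * (norm (g x))^2" for x
  proof -
    have "(norm (f x + g x))^2 \<le> (norm (f x) + norm (g x))^2"
      by (simp add: norm_triangle_ineq power_mono)
    also have "\<dots> \<le> 2 * (norm (f x))^2 + 2 * (norm (g x))^2"
      using sum_squares_bound[of "norm (f x)" "norm (g x)"] by (simp add: power2_sum)
    finally show ?thesis .
  qed
  have "integrable lborel (\<lambda>x. 2 * (norm (f x))^2 + 2 * (norm (g x))^2)"
    using assms by (auto simp: sq_integrable_def)
  then show "integrable lborel (\<lambda>x. (norm (f x + g x))\<^sup>2)"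
    apply (rule Bochner_Integration.integrable_bound)
    using assms apply measurable
    using * by (intro AE_I2) auto
qed (use assms in measurable)

lemma sq_integrable_cmult:
  fixes f :: "real \<Rightarrow> 'b::{real_normed_algebra, second_countable_topology}"
  shows "sq_integrable f \<Longrightarrow> sq_integrable (\<lambda>x. c * f x)"
  by (rule sq_integrable_bound[where g=f and C="norm c"]) (auto simp: norm_mult_ineq)

lemma l2_cmult:
  fixes f :: "real \<Rightarrow> 'b::{real_normed_div_algebra, second_countable_topology}"
  shows "l2 (\<lambda>x. c * f x) = norm c * l2 f"
  by (simp add: l2_def norm_mult power_mult_distrib real_sqrt_mult)

lemma sq_integrable_minus: "sq_integrable f \<Longrightarrow> sq_integrable (\<lambda>x. - f x)"
  by (simp add: sq_integrable_def)

lemma sq_integrable_diff: "sq_integrable f \<Longrightarrow> sq_integrable g \<Longrightarrow> sq_integrable (\<lambda>x. f x - g x)"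
  using sq_integrable_add[of f "\<lambda>x. - g x"] by (simp add: sq_integrable_minus)

lemma sq_integrable_sum:
  "(\<And>i. i \<in> I \<Longrightarrow> sq_integrable (f i)) \<Longrightarrow> sq_integrable (\<lambda>x. \<Sum>i\<in>I. f i x)"
  by (induction I rule: infinite_finite_induct) (auto intro: sq_integrable_add)

lemma sq_integrable_norm: "sq_integrable f \<Longrightarrow> sq_integrable (\<lambda>x. norm (f x))"
  by (auto simp: sq_integrable_def)

lemma l2_norm [simp]: "l2 (\<lambda>x. norm (f x)) = l2 f"
  by (simp add: l2_def)

lemma l2_minus [simp]: "l2 (\<lambda>x. - f x) = l2 f"
  by (simp add: l2_def)

lemma sq_integrable_bounded_mult:
  fixes f g :: "real \<Rightarrow> 'b::{real_normed_algebra, second_countable_topology}"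
  assumes "sq_integrable f" "g \<in> borel_measurable borel" "AE x in lborel. norm (g x) \<le> C"
  shows "sq_integrable (\<lambda>x. g x * f x)"
proof (rule sq_integrable_bound[where g=f and C=C])
  show "AE x in lborel. norm (g x * f x) \<le> C * norm (f x)"
    using assms(3) by eventually_elim (meson mult_right_mono norm_ge_zero norm_mult_ineq order_trans)
qed (use assms in measurable)

lemma l2_bounded_mult:
  fixes f g :: "real \<Rightarrow> 'b::{real_normed_algebra, second_countable_topology}"
  assumes "sq_integrable f" "g \<in> borel_measurable borel" "AE x in lborel. norm (g x) \<le> C" "C \<ge> 0"
  shows "l2 (\<lambda>x. g x * f x) \<le> C * l2 f"
proof (rule l2_mono)
  show "AE x in lborel. norm (g x * f x) \<le> C * norm (f x)"
    using assms(3) by eventually_elim (meson mult_right_mono norm_ge_zero norm_mult_ineq order_trans)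
qed (use assms in measurable)

section \<open>Cauchy-Schwarz and Minkowski inequalities\<close>

lemma ennreal_power2_le_imp_le:
  assumes "x\<^sup>2 \<le> (ennreal c)\<^sup>2" and "0 \<le> c"
  shows "x \<le> ennreal c"
proof -
  have "x\<^sup>2 < \<infinity>"
    using assms by (intro le_less_trans[OF assms(1)]) (simp add: ennreal_power)
  then have x: "x = ennreal (enn2real x)"
    by (cases x rule: ennreal_cases) (auto simp: ennreal_top_eq_mult_iff power2_eq_square)
  then have "ennreal ((enn2real x)\<^sup>2) \<le> ennreal (c\<^sup>2)"
    using assms by (metis enn2real_nonneg ennreal_power)
  then have "(enn2real x)\<^sup>2 \<le> c\<^sup>2"
    by (simp del: power2_eq_iff)
  then have "enn2real x \<le> c"
    using assms(2) by (rule power2_le_imp_le)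
  then have "ennreal (enn2real x) \<le> ennreal c"
    by (rule ennreal_leI)
  with x show ?thesis
    by metis
qed

lemma Cauchy_Schwarz_nn_L2:
  assumes "sq_integrable f" "sq_integrable g"
  shows "(\<integral>\<^sup>+x. ennreal (norm (f x) * norm (g x)) \<partial>lborel) \<le> ennreal (l2 f * l2 g)"
proof -
  have "(\<integral>\<^sup>+x. ennreal (norm (f x)) * ennreal (norm (g x)) \<partial>lborel)\<^sup>2
      \<le> (\<integral>\<^sup>+x. ennreal (norm (f x)) ^ 2 \<partial>lborel) * (\<integral>\<^sup>+x. ennreal (norm (g x)) ^ 2 \<partial>lborel)"
    by (intro Cauchy_Schwarz_nn_integral)
      (use sq_integrable_measurable[OF assms(1)] sq_integrable_measurable[OF assms(2)] in auto)
  also have "\<dots> = ennreal ((l2 f)^2) * ennreal ((l2 g)^2)"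
    using assms by (simp add: ennreal_power nn_integral_norm_power2)
  also have "\<dots> = ennreal (l2 f * l2 g) ^ 2"
    by (simp add: ennreal_power power_mult_distrib ennreal_mult)
  finally have "(\<integral>\<^sup>+x. ennreal (norm (f x)) * ennreal (norm (g x)) \<partial>lborel) \<le> ennreal (l2 f * l2 g)"
    by (rule ennreal_power2_le_imp_le) simp
  then show ?thesis
    by (simp add: ennreal_mult)
qed

lemma integrable_mult_L2:
  fixes f g :: "real \<Rightarrow> 'b::{real_normed_div_algebra, banach, second_countable_topology}"
  assumes "sq_integrable f" "sq_integrable g"
  shows "integrable lborel (\<lambda>x. f x * g x)"
proof -
  have "(\<integral>\<^sup>+x. ennreal (norm (f x * g x)) \<partial>lborel) < \<infinity>"
    unfolding norm_mult by (rule le_less_trans[OF Cauchy_Schwarz_nn_L2[OF assms]]) simp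
  then show ?thesis
    unfolding integrable_iff_bounded using assms by (auto intro!: borel_measurable_times sq_integrable_measurable)
qed

lemma Cauchy_Schwarz_norm_L2:
  fixes f g :: "real \<Rightarrow> 'b::{real_normed_div_algebra, banach, second_countable_topology}"
  assumes "sq_integrable f" "sq_integrable g"
  shows "(LINT x|lborel. norm (f x) * norm (g x)) \<le> l2 f * l2 g"
proof -
  have "integrable lborel (\<lambda>x. norm (f x) * norm (g x))"
    using integrable_mult_L2[OF sq_integrable_norm[OF assms(1)] sq_integrable_norm[OF assms(2)]] .
  then have "ennreal (LINT x|lborel. norm (f x) * norm (g x)) \<le> ennreal (l2 f * l2 g)"
    using Cauchy_Schwarz_nn_L2[OF assms] by (subst (asm) nn_integral_eq_integral) auto
  then show ?thesis by (simp add: ennreal_le_iff)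
qed

lemma Cauchy_Schwarz_L2:
  fixes f g :: "real \<Rightarrow> 'b::{real_normed_field, banach, second_countable_topology}"
  assumes "sq_integrable f" "sq_integrable g"
  shows "norm (LINT x|lborel. f x * g x) \<le> l2 f * l2 g"
proof -
  have "norm (LINT x|lborel. f x * g x) \<le> (LINT x|lborel. norm (f x * g x))"
    by (rule integral_norm_bound)
  also have "\<dots> = (LINT x|lborel. norm (f x) * norm (g x))"
    by (simp add: norm_mult)
  also have "\<dots> \<le> l2 f * l2 g"
    by (rule Cauchy_Schwarz_norm_L2[OF assms])
  finally show ?thesis .
qed

lemma l2_triangle:
  assumes f: "sq_integrable f" and g: "sq_integrable g"
  shows "l2 (\<lambda>x. f x + g x) \<le> l2 f + l2 g"
proof (rule power2_le_imp_le)
  note nf = sq_integrable_norm[OF f] and ng = sq_integrable_norm[OF g]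
  have fg: "integrable lborel (\<lambda>x. norm (f x) * norm (g x))"
    by (rule integrable_mult_L2[OF nf ng])
  have "(l2 (\<lambda>x. f x + g x))^2 \<le> (LINT x|lborel. (norm (f x))^2 + (norm (g x))^2 + 2 * (norm (f x) * norm (g x)))"
    unfolding l2_power2
  proof (rule integral_mono)
    show "(norm (f x + g x))\<^sup>2 \<le> (norm (f x))\<^sup>2 + (norm (g x))\<^sup>2 + 2 * (norm (f x) * norm (g x))" for x
      using power_mono[OF norm_triangle_ineq[of "f x" "g x"], of 2] by (simp add: power2_sum)
  qed (use sq_integrable_add[OF f g] f g fg in \<open>auto simp: sq_integrable_def\<close>)
  also have "\<dots> = (l2 f)^2 + (l2 g)^2 + 2 * (LINT x|lborel. norm (f x) * norm (g x))"
    using f g fg by (simp add: l2_power2 sq_integrable_def)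
  also have "\<dots> \<le> (l2 f)^2 + (l2 g)^2 + 2 * (l2 f * l2 g)"
    using Cauchy_Schwarz_norm_L2[OF nf ng] by simp
  also have "\<dots> = (l2 f + l2 g)^2"
    by (simp add: power2_sum)
  finally show "(l2 (\<lambda>x. f x + g x))\<^sup>2 \<le> (l2 f + l2 g)\<^sup>2" .
qed simp

lemma l2_triangle_diff:
  assumes "sq_integrable f" "sq_integrable g"
  shows "l2 (\<lambda>x. f x - g x) \<le> l2 f + l2 g"
  using l2_triangle[OF assms(1) sq_integrable_minus[OF assms(2)]] by simp

lemma l2_sum:
  "(\<And>i. i \<in> I \<Longrightarrow> sq_integrable (f i)) \<Longrightarrow> l2 (\<lambda>x. \<Sum>i\<in>I. f i x) \<le> (\<Sum>i\<in>I. l2 (f i))"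
proof (induction I rule: infinite_finite_induct)
  case (insert j I)
  then have "l2 (\<lambda>x. f j x + (\<Sum>i\<in>I. f i x)) \<le> l2 (f j) + l2 (\<lambda>x. \<Sum>i\<in>I. f i x)"
    by (intro l2_triangle sq_integrable_sum) auto
  with insert show ?case by fastforce
qed (simp_all add: l2_def)

text \<open>This is the completeness of L2 (Riesz-Fischer) in the form of series. By Minkowski the
  partial sums of the pointwise norms stay below B in L2, and monotone convergence for their squares
  makes the pointwise supremum finite almost everywhere.\<close>

lemma l2_suminf:
  fixes f :: "nat \<Rightarrow> real \<Rightarrow> 'b::{banach, second_countable_topology}"
  assumes f: "\<And>n. sq_integrable (f n)" and sum: "summable (\<lambda>n. l2 (f n))"
  shows "AE x in lborel. summable (\<lambda>n. norm (f n x))"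
    and "sq_integrable (\<lambda>x. \<Sum>n. f n x)"
    and "l2 (\<lambda>x. \<Sum>n. f n x) \<le> (\<Sum>n. l2 (f n))"
proof -
  note [measurable] = sq_integrable_measurable[OF f]
  define B where "B = (\<Sum>n. l2 (f n))"
  have B: "B \<ge> 0" unfolding B_def by (intro suminf_nonneg sum) simp
  define S where "S m x = (\<Sum>n<m. norm (f n x))" for m x
  have S: "sq_integrable (S m)" "l2 (S m) \<le> B" for m
  proof -
    show "sq_integrable (S m)"
      unfolding S_def by (intro sq_integrable_sum sq_integrable_norm f)
    have "l2 (S m) \<le> (\<Sum>n<m. l2 (\<lambda>x. norm (f n x)))"
      unfolding S_def by (intro l2_sum sq_integrable_norm f)
    also have "\<dots> \<le> B"
      unfolding B_def l2_norm by (intro sum_le_suminf sum) auto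
    finally show "l2 (S m) \<le> B" .
  qed
  have [measurable]: "S m \<in> borel_measurable borel" for m
    unfolding S_def by measurable
  \<comment> \<open>The supremum is taken in \<open>ennreal\<close>, so that it exists and is
    measurable before any pointwise convergence is known.\<close>
  define G where "G x = (SUP m. ennreal ((S m x)^2))" for x
  have [measurable]: "G \<in> borel_measurable borel" unfolding G_def by measurable
  have Smono: "m \<le> k \<Longrightarrow> S m x \<le> S k x" and S0: "0 \<le> S m x" for m k x
    unfolding S_def by (auto intro!: sum_mono2 sum_nonneg)
  have "(\<integral>\<^sup>+x. G x \<partial>lborel) = (SUP m. \<integral>\<^sup>+x. ennreal ((S m x)^2) \<partial>lborel)"
    unfolding G_def
    by (intro nn_integral_monotone_convergence_SUP)
       (auto simp: incseq_def le_fun_def intro!: ennreal_leI power_mono Smono S0)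
  also have "\<dots> \<le> ennreal (B^2)"
  proof (rule SUP_least)
    fix m
    have "(\<integral>\<^sup>+x. ennreal ((S m x)^2) \<partial>lborel) = ennreal ((l2 (S m))^2)"
      using nn_integral_norm_power2[OF S(1)[of m]] by simp
    also have "\<dots> \<le> ennreal (B^2)"
      using S(2) by (intro ennreal_leI power_mono) auto
    finally show "(\<integral>\<^sup>+x. ennreal ((S m x)^2) \<partial>lborel) \<le> ennreal (B^2)" .
  qed
  finally have G: "(\<integral>\<^sup>+x. G x \<partial>lborel) \<le> ennreal (B^2)" .
  then have "(\<integral>\<^sup>+x. G x \<partial>lborel) \<noteq> \<infinity>"
    by (auto simp: top_unique)
  then have fin: "AE x in lborel. G x \<noteq> \<infinity>"
    by (intro nn_integral_PInf_AE) auto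
  have *: "summable (\<lambda>n. norm (f n x)) \<and> ennreal ((norm (\<Sum>n. f n x))^2) \<le> G x" if "G x \<noteq> \<infinity>" for x
  proof -
    define r where "r = enn2real (G x)"
    have r: "G x = ennreal r" "r \<ge> 0" using that by (auto simp: r_def less_top)
    have "ennreal ((S m x)^2) \<le> G x" for m
      unfolding G_def by (rule SUP_upper) simp
    then have Sm: "S m x \<le> sqrt r" for m
      using r S0[of m x] by (auto simp: real_le_rsqrt)
    have s: "summable (\<lambda>n. norm (f n x))"
      by (rule summableI_nonneg_bounded[where x="sqrt r"]) (use Sm in \<open>auto simp: S_def\<close>)
    have "norm (\<Sum>n. f n x) \<le> (\<Sum>n. norm (f n x))"
      by (rule summable_norm[OF s])
    also have "\<dots> \<le> sqrt r"
      by (rule suminf_le_const[OF s]) (use Sm in \<open>auto simp: S_def\<close>)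
    finally have "(norm (\<Sum>n. f n x))^2 \<le> r"
      using r(2) by (metis norm_ge_zero power_mono real_sqrt_pow2)
    with s r show ?thesis by (auto intro: ennreal_leI)
  qed
  show "AE x in lborel. summable (\<lambda>n. norm (f n x))"
    using fin by eventually_elim (use * in auto)
  have le: "(\<integral>\<^sup>+x. ennreal ((norm (\<Sum>n. f n x))^2) \<partial>lborel) \<le> ennreal (B^2)"
    
    by (intro order_trans[OF nn_integral_mono_AE G] eventually_mono[OF fin]) (use * in auto)
  have m: "(\<lambda>x. \<Sum>n. f n x) \<in> borel_measurable borel" by measurable
  show "sq_integrable (\<lambda>x. \<Sum>n. f n x)"
    by (rule sq_integrableI_nn(1)[OF m le])
  have "(l2 (\<lambda>x. \<Sum>n. f n x))^2 \<le> B^2"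
    by (rule sq_integrableI_nn(2)[OF m le]) simp
  then show "l2 (\<lambda>x. \<Sum>n. f n x) \<le> (\<Sum>n. l2 (f n))"
    unfolding B_def[symmetric] using B by (rule power2_le_imp_le)
qed

text \<open>The remainder is itself a series to which \<open>l2_suminf\<close> applies, so its norm
  is at most the tail of a convergent numerical series.\<close>

lemma l2_suminf_tendsto:
  fixes f :: "nat \<Rightarrow> real \<Rightarrow> 'b::{banach, second_countable_topology}"
  assumes f: "\<And>n. sq_integrable (f n)" and sum: "summable (\<lambda>n. l2 (f n))"
  shows "(\<lambda>m. l2 (\<lambda>x. (\<Sum>n. f n x) - (\<Sum>n<m. f n x))) \<longlonglongrightarrow> 0"
proof (rule tendsto_sandwich[OF _ _ tendsto_const])
  note [measurable] = sq_integrable_measurable[OF f]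
  have "l2 (\<lambda>x. (\<Sum>n. f n x) - (\<Sum>n<m. f n x)) \<le> (\<Sum>n. l2 (f (n + m)))" for m
  proof -
    have "AE x in lborel. (\<Sum>n. f (n + m) x) = (\<Sum>n. f n x) - (\<Sum>n<m. f n x)"
      using l2_suminf(1)[OF f sum]
      by eventually_elim (rule suminf_minus_initial_segment[OF summable_norm_cancel])
    then have "l2 (\<lambda>x. (\<Sum>n. f n x) - (\<Sum>n<m. f n x)) = l2 (\<lambda>x. \<Sum>n. f (n + m) x)"
      by (intro l2_cong_AE[symmetric]) auto
    also have "\<dots> \<le> (\<Sum>n. l2 (f (n + m)))"
      by (rule l2_suminf(3)) (use f sum in \<open>auto intro: summable_ignore_initial_segment\<close>)
    finally show ?thesis .
  qed
  then show "\<forall>\<^sub>F m in sequentially. l2 (\<lambda>x. (\<Sum>n. f n x) - (\<Sum>n<m. f n x)) \<le> (\<Sum>n. l2 (f (n + m)))"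
    by simp
  show "(\<lambda>m. \<Sum>n. l2 (f (n + m))) \<longlonglongrightarrow> 0"
    by (rule suminf_exist_split2[OF sum])
qed simp

subsection \<open>Fubini\<close>

lemma Fubini_lborel:
  fixes F :: "real \<Rightarrow> real \<Rightarrow> 'b::{banach, second_countable_topology}"
  assumes [measurable]: "(\<lambda>(x, y). F x y) \<in> borel_measurable (borel \<Otimes>\<^sub>M borel)"
    and fin: "(\<integral>\<^sup>+x. (\<integral>\<^sup>+y. ennreal (norm (F x y)) \<partial>lborel) \<partial>lborel) < \<infinity>"
  shows "(LINT x|lborel. (LINT y|lborel. F x y)) = (LINT y|lborel. (LINT x|lborel. F x y))"
    and "integrable lborel (\<lambda>x. LINT y|lborel. F x y)"
proof -
  have "integrable (lborel \<Otimes>\<^sub>M lborel) (\<lambda>(x, y). F x y)"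
    unfolding integrable_iff_bounded
  proof
    have "(\<integral>\<^sup>+z. ennreal (norm (case z of (x, y) \<Rightarrow> F x y)) \<partial>(lborel \<Otimes>\<^sub>M lborel))
        = (\<integral>\<^sup>+x. (\<integral>\<^sup>+y. ennreal (norm (F x y)) \<partial>lborel) \<partial>lborel)"
      by (subst lborel.nn_integral_fst[symmetric]) auto
    with fin show "(\<integral>\<^sup>+z. ennreal (norm (case z of (x, y) \<Rightarrow> F x y)) \<partial>(lborel \<Otimes>\<^sub>M lborel)) < \<infinity>"
      by simp
  qed measurable
  from lborel_pair.Fubini_integral[OF this] lborel_pair.integrable_fst[OF this]
  show "(LINT x|lborel. (LINT y|lborel. F x y)) = (LINT y|lborel. (LINT x|lborel. F x y))"
    "integrable lborel (\<lambda>x. LINT y|lborel. F x y)" by simp_all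
qed

lemma integrable_nn_finite:
  fixes f :: "real \<Rightarrow> 'b::{banach, second_countable_topology}"
  shows "integrable lborel f \<Longrightarrow> (\<integral>\<^sup>+x. ennreal (norm (f x)) \<partial>lborel) < \<infinity>"
  unfolding integrable_iff_bounded by blast

lemma integrable_nn_eq:
  fixes f :: "real \<Rightarrow> 'b::{banach, second_countable_topology}"
  shows "integrable lborel f \<Longrightarrow> (\<integral>\<^sup>+x. ennreal (norm (f x)) \<partial>lborel) = ennreal (LINT x|lborel. norm (f x))"
  by (intro nn_integral_eq_integral) auto

lemma nn_integral_product_finite:
  fixes f g :: "real \<Rightarrow> 'b::{banach, second_countable_topology}"
  assumes "integrable lborel f" "integrable lborel g" "\<And>x y. norm (F x y) \<le> norm (f x) * norm (g y)"
  shows "(\<integral>\<^sup>+x. (\<integral>\<^sup>+y. ennreal (norm (F x y)) \<partial>lborel) \<partial>lborel) < \<infinity>"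
proof -
  note [measurable] = borel_measurable_integrable[OF assms(1)] borel_measurable_integrable[OF assms(2)]
  have "(\<integral>\<^sup>+x. (\<integral>\<^sup>+y. ennreal (norm (F x y)) \<partial>lborel) \<partial>lborel)
      \<le> (\<integral>\<^sup>+x. (\<integral>\<^sup>+y. ennreal (norm (f x)) * ennreal (norm (g y)) \<partial>lborel) \<partial>lborel)"
    using assms(3) by (intro nn_integral_mono) (auto simp flip: ennreal_mult)
  also have "\<dots> = (\<integral>\<^sup>+x. ennreal (norm (f x)) \<partial>lborel) * (\<integral>\<^sup>+x. ennreal (norm (g x)) \<partial>lborel)"
    by (simp add: nn_integral_cmult nn_integral_multc)
  also have "\<dots> < \<infinity>"
    using integrable_nn_finite[OF assms(1)] integrable_nn_finite[OF assms(2)]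
    by (simp add: ennreal_mult_less_top)
  finally show ?thesis .
qed

subsection \<open>The transform of integrable functions\<close>

lemma borel_measurable_cis [measurable]: "cis \<in> borel_measurable borel"
  by (intro borel_measurable_continuous_onI continuous_intros)

lemma borel_measurable_cnj [measurable]: "cnj \<in> borel_measurable borel"
  by (intro borel_measurable_continuous_onI continuous_intros)

lemma integrable_cis:
  fixes f :: "real \<Rightarrow> complex"
  assumes "integrable lborel f" shows "integrable lborel (\<lambda>x. f x * cis (a * x))"
  using assms by (rule Bochner_Integration.integrable_bound) (use assms in \<open>auto simp: norm_mult\<close>)

lemma borel_measurable_fourier_L1 [measurable (raw)]:
  assumes [measurable]: "f \<in> borel_measurable borel"
  shows "fourier_L1 f \<in> borel_measurable borel"
  unfolding fourier_L1_def by measurable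

lemma norm_fourier_L1_le: "norm (fourier_L1 f x) \<le> (LINT x|lborel. norm (f x))"
  unfolding fourier_L1_def
  by (rule order_trans[OF integral_norm_bound]) (simp add: norm_mult)

lemma fourier_L1_modulation: "fourier_L1 (\<lambda>\<xi>. f \<xi> * cis (a * \<xi>)) x = fourier_L1 f (x - a)"
  unfolding fourier_L1_def
  by (intro Bochner_Integration.integral_cong) (auto simp: mult.assoc cis_mult algebra_simps)

lemma fourier_L1_translation: "fourier_L1 (\<lambda>\<xi>. f (\<xi> - a)) x = cis (- (a * x)) * fourier_L1 f x"
proof -
  have "fourier_L1 (\<lambda>\<xi>. f (\<xi> - a)) x = (LINT \<xi>|lborel. f (a + 1 * \<xi> - a) * cis (- (x * (a + 1 * \<xi>))))"
    unfolding fourier_L1_def by (subst lborel_integral_real_affine[where c=1 and t=a]) auto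
  also have "\<dots> = (LINT \<xi>|lborel. cis (- (a * x)) * (f \<xi> * cis (- (x * \<xi>))))"
    by (intro Bochner_Integration.integral_cong) (auto simp: mult_ac cis_mult algebra_simps)
  finally show ?thesis unfolding fourier_L1_def by simp
qed

lemma fourier_L1_cmult: "fourier_L1 (\<lambda>\<xi>. c * f \<xi>) x = c * fourier_L1 f x"
  unfolding fourier_L1_def by (simp add: mult.assoc)

text \<open>The kernel \<open>cis (- (x * \<xi>))\<close> is symmetric in its two variables, so
  Fubini moves the transform from one factor to the other. The formula later serves as the
  definition of the transform on L2.\<close>

lemma fourier_L1_multiplication_formula:
  assumes f: "integrable lborel f" and g: "integrable lborel g"
  shows "(LINT \<xi>|lborel. fourier_L1 f \<xi> * g \<xi>) = (LINT x|lborel. f x * fourier_L1 g x)"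
proof -
  have [measurable]: "f \<in> borel_measurable borel" "g \<in> borel_measurable borel" using f g by auto
  have "(LINT \<xi>|lborel. fourier_L1 f \<xi> * g \<xi>)
      = (LINT \<xi>|lborel. (LINT x|lborel. f x * cis (- (\<xi> * x)) * g \<xi>))"
    by (simp add: fourier_L1_def)
  also have "\<dots> = (LINT x|lborel. (LINT \<xi>|lborel. f x * cis (- (\<xi> * x)) * g \<xi>))"
    by (rule Fubini_lborel(1), measurable, rule nn_integral_product_finite[OF g f])
       (simp add: norm_mult)
  also have "\<dots> = (LINT x|lborel. (LINT \<xi>|lborel. f x * (g \<xi> * cis (- (x * \<xi>)))))"
    by (simp add: mult_ac)
  also have "\<dots> = (LINT x|lborel. f x * fourier_L1 g x)"
    by (simp add: fourier_L1_def)
  finally show ?thesis .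
qed

text \<open>Read off from the characteristic function of the standard normal law, which has the
  opposite sign in the exponent and is therefore evaluated at - x.\<close>

lemma fourier_L1_gaussian:
  "fourier_L1 (\<lambda>\<xi>. complex_of_real (exp (- \<xi>\<^sup>2 / 2))) x = complex_of_real (sqrt (2 * pi) * exp (- x\<^sup>2 / 2))"
proof -
  have "complex_of_real (exp (- ((-x)\<^sup>2) / 2)) = char std_normal_distribution (-x)"
    by (simp add: char_std_normal_distribution)
  also have "\<dots> = (LINT \<xi>|lborel. std_normal_density \<xi> *\<^sub>R iexp (-x * \<xi>))"
    unfolding char_def by (subst integral_density) auto
  also have "\<dots> = (LINT \<xi>|lborel. complex_of_real (1 / sqrt (2 * pi)) * (complex_of_real (exp (- \<xi>\<^sup>2 / 2)) * cis (- (x * \<xi>))))"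
    by (intro Bochner_Integration.integral_cong)
      (auto simp: normal_density_def scaleR_conv_of_real cis_conv_exp)
  also have "\<dots> = complex_of_real (1 / sqrt (2 * pi)) * fourier_L1 (\<lambda>\<xi>. complex_of_real (exp (- \<xi>\<^sup>2 / 2))) x"
    unfolding fourier_L1_def by (rule integral_mult_right_zero)
  finally have "complex_of_real (exp (- x\<^sup>2 / 2)) = complex_of_real (1 / sqrt (2 * pi)) * fourier_L1 (\<lambda>\<xi>. complex_of_real (exp (- \<xi>\<^sup>2 / 2))) x"
    by simp
  then show ?thesis
    by (simp add: field_simps)
qed

lemma integrable_gaussian: "integrable lborel (\<lambda>\<xi>::real. exp (- \<xi>\<^sup>2 / 2))"
proof -
  have "integrable lborel (\<lambda>\<xi>. sqrt (2 * pi) * std_normal_density \<xi>)"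
    by (intro integrable_mult_right integrable_normal_density) simp
  then show ?thesis
    by (simp add: std_normal_density_def)
qed

lemma integrable_gaussian_scaled:
  "b > 0 \<Longrightarrow> integrable lborel (\<lambda>\<xi>::real. exp (- (b * \<xi>)\<^sup>2 / 2))"
  using lborel_integrable_real_affine[OF integrable_gaussian, of b 0] by simp

text \<open>Expressing the result through a normal density makes its mass visible: it is 2 pi for
  every b, and this is the only property used when b tends to 0.\<close>

lemma fourier_L1_gaussian_scaled:
  assumes "b > 0"
  shows "fourier_L1 (\<lambda>\<xi>. complex_of_real (exp (- (b * \<xi>)\<^sup>2 / 2))) x
    = complex_of_real (2 * pi * normal_density 0 b x)"
proof -
  define g where "g \<xi> = complex_of_real (exp (- \<xi>\<^sup>2 / 2))" for \<xi>
  have "fourier_L1 g (x / b) = \<bar>b\<bar> *\<^sub>R (LINT \<xi>|lborel. g (0 + b * \<xi>) * cis (- (x / b * (0 + b * \<xi>))))"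
    unfolding fourier_L1_def using assms by (subst lborel_integral_real_affine[where c=b and t=0]) auto
  also have "\<dots> = complex_of_real b * fourier_L1 (\<lambda>\<xi>. g (b * \<xi>)) x"
    using assms by (simp add: fourier_L1_def scaleR_conv_of_real)
  finally have "complex_of_real b * fourier_L1 (\<lambda>\<xi>. g (b * \<xi>)) x = complex_of_real (sqrt (2 * pi) * exp (- (x / b)\<^sup>2 / 2))"
    unfolding g_def fourier_L1_gaussian by simp
  also have "sqrt (2 * pi) * exp (- (x / b)\<^sup>2 / 2) = b * (2 * pi * normal_density 0 b x)"
  proof -
    have "sqrt (2 * pi * b\<^sup>2) = sqrt (2 * pi) * b"
      using assms by (simp add: real_sqrt_mult)
    moreover have "2 * pi / sqrt (2 * pi) = sqrt (2 * pi)"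
      by (rule real_div_sqrt) simp
    ultimately show ?thesis
      using assms by (simp add: normal_density_def power_divide field_simps)
  qed
  finally show ?thesis
    using assms by (simp add: g_def)
qed

subsection \<open>Plancherel bound\<close>

lemma nn_integral_normal_density: "b > 0 \<Longrightarrow> (\<integral>\<^sup>+x. ennreal (normal_density \<mu> b x) \<partial>lborel) = 1"
  by (subst nn_integral_eq_integral) auto

lemma normal_density_reflect: "normal_density 0 b (x + y) = normal_density (- x) b y"
  by (simp add: normal_density_def add.commute)

lemma sq_integrable_reflect:
  assumes "sq_integrable f"
  shows "sq_integrable (\<lambda>x. f (- x))" and "l2 (\<lambda>x. f (- x)) = l2 f"
proof -
  have "integrable lborel (\<lambda>x. (norm (f (0 + (-1) * x)))\<^sup>2)"
    by (rule lborel_integrable_real_affine[OF sq_integrable_D[OF assms]]) simp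
  then show "sq_integrable (\<lambda>x. f (- x))"
    using sq_integrable_measurable[OF assms] by (simp add: sq_integrable_def)
  have "(LINT x|lborel. (norm (f x))\<^sup>2) = \<bar>- 1\<bar> *\<^sub>R (LINT x|lborel. (norm (f (0 + (-1) * x)))\<^sup>2)"
    by (rule lborel_integral_real_affine) simp
  then show "l2 (\<lambda>x. f (- x)) = l2 f"
    by (simp add: l2_def)
qed

lemma sq_integrable_translate:
  assumes "sq_integrable f"
  shows "sq_integrable (\<lambda>x. f (x + a))" and "l2 (\<lambda>x. f (x + a)) = l2 f"
proof -
  have "integrable lborel (\<lambda>x. (norm (f (a + 1 * x)))\<^sup>2)"
    by (rule lborel_integrable_real_affine[OF sq_integrable_D[OF assms]]) simp
  then show "sq_integrable (\<lambda>x. f (x + a))"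
    using sq_integrable_measurable[OF assms] by (simp add: sq_integrable_def add.commute)
  have "(LINT x|lborel. (norm (f x))\<^sup>2) = \<bar>1\<bar> *\<^sub>R (LINT x|lborel. (norm (f (a + 1 * x)))\<^sup>2)"
    by (rule lborel_integral_real_affine) simp
  then show "l2 (\<lambda>x. f (x + a)) = l2 f"
    by (simp add: l2_def add.commute)
qed

text \<open>Plancherel with a regularising Gaussian. The integrand is P times \<psi>, with \<psi>
  the product of the conjugate of P and the Gaussian. The multiplication formula, applied once to P
  and once inside the transform of \<psi>, leaves a double integral against the kernel N (x + y),
  whose mass in either variable is 2 pi. The bound does not depend on b.\<close>

lemma fourier_L1_gaussian_bound:
  assumes "integrable lborel \<phi>" "sq_integrable \<phi>" and b: "b > 0"
  shows "(\<integral>\<^sup>+\<xi>. ennreal ((norm (fourier_L1 \<phi> \<xi>))\<^sup>2 * exp (- (b * \<xi>)\<^sup>2 / 2)) \<partial>lborel)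
    \<le> ennreal (2 * pi * (l2 \<phi>)\<^sup>2)"
proof -
  define h where "h \<xi> = complex_of_real (exp (- (b * \<xi>)\<^sup>2 / 2))" for \<xi>
  define N where "N x = 2 * pi * normal_density 0 b x" for x
  define P where "P = fourier_L1 \<phi>"
  \<comment> \<open>Reflection and conjugation together turn the conjugate of P into a transform
    again.\<close>
  define \<phi>' where "\<phi>' y = cnj (\<phi> (- y))" for y
  have [measurable]: "\<phi> \<in> borel_measurable borel" "h \<in> borel_measurable borel" "N \<in> borel_measurable borel"
    using assms by (auto simp: h_def[abs_def] N_def[abs_def])
  have [measurable]: "P \<in> borel_measurable borel" unfolding P_def by measurable
  have [measurable]: "\<phi>' \<in> borel_measurable borel" unfolding \<phi>'_def by (intro measurable_compose[OF _ borel_measurable_cnj]) measurable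
  have ih: "integrable lborel h"
    unfolding h_def using integrable_gaussian_scaled[OF b] by (rule integrable_of_real)
  have "integrable lborel (\<lambda>y. \<phi> (0 + (-1) * y))"
    by (rule lborel_integrable_real_affine[OF assms(1)]) simp
  then have i\<phi>': "integrable lborel \<phi>'"
    unfolding \<phi>'_def by simp
  have cP: "cnj (P \<xi>) = fourier_L1 \<phi>' \<xi>" for \<xi>
  proof -
    have "fourier_L1 \<phi>' \<xi> = \<bar>-1\<bar> *\<^sub>R (LINT y|lborel. \<phi>' (0 + (-1) * y) * cis (- (\<xi> * (0 + (-1) * y))))"
      unfolding fourier_L1_def by (rule lborel_integral_real_affine) simp
    also have "\<dots> = (LINT y|lborel. cnj (\<phi> y * cis (- (\<xi> * y))))"
      by (simp add: \<phi>'_def cis_cnj)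
    also have "\<dots> = cnj (P \<xi>)"
      unfolding P_def fourier_L1_def
      by (rule Bochner_Integration.integral_cnj)
    finally show ?thesis by simp
  qed
  define \<psi> where "\<psi> \<xi> = cnj (P \<xi>) * h \<xi>" for \<xi>
  have i\<psi>: "integrable lborel \<psi>"
  proof (rule Bochner_Integration.integrable_bound)
    show "integrable lborel (\<lambda>\<xi>. (LINT x|lborel. norm (\<phi> x)) * norm (h \<xi>))"
      using ih by auto
    show "\<psi> \<in> borel_measurable lborel" unfolding \<psi>_def
      by (intro borel_measurable_times measurable_compose[OF _ borel_measurable_cnj]) auto
    show "AE x in lborel. norm (\<psi> x) \<le> norm ((LINT x|lborel. norm (\<phi> x)) * norm (h x))"
      using norm_fourier_L1_le[of \<phi>]
      by (auto simp: \<psi>_def norm_mult P_def intro!: mult_right_mono)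
  qed
  have F\<psi>: "fourier_L1 \<psi> x = (LINT y|lborel. \<phi>' y * complex_of_real (N (x + y)))" for x
  proof -
    have "fourier_L1 \<psi> x = (LINT \<xi>|lborel. fourier_L1 \<phi>' \<xi> * (h \<xi> * cis ((- x) * \<xi>)))"
      unfolding fourier_L1_def[of \<psi>] \<psi>_def cP by (simp add: mult_ac)
    also have "\<dots> = (LINT y|lborel. \<phi>' y * fourier_L1 (\<lambda>\<xi>. h \<xi> * cis ((- x) * \<xi>)) y)"
      by (intro fourier_L1_multiplication_formula i\<phi>' integrable_cis ih)
    also have "\<dots> = (LINT y|lborel. \<phi>' y * complex_of_real (N (x + y)))"
      unfolding fourier_L1_modulation
      unfolding h_def fourier_L1_gaussian_scaled[OF b] N_def by (simp add: add.commute)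
    finally show ?thesis .
  qed
  have N0: "N x \<ge> 0" for x by (simp add: N_def)
  have NN: "(\<integral>\<^sup>+y. ennreal (N (x + y)) \<partial>lborel) = ennreal (2 * pi)" for x
    unfolding N_def normal_density_reflect
    using nn_integral_normal_density[OF b, of "-x"] by (simp add: ennreal_mult nn_integral_cmult)
  have NN': "(\<integral>\<^sup>+x. ennreal (N (x + y)) \<partial>lborel) = ennreal (2 * pi)" for y
    using NN[of y] by (simp add: add.commute)
  have l': "sq_integrable \<phi>'" "l2 \<phi>' = l2 \<phi>"
    using sq_integrable_reflect[OF assms(2)]
    by (auto simp: \<phi>'_def[abs_def] sq_integrable_def l2_def intro!: measurable_compose[OF _ borel_measurable_cnj])
  have "(\<integral>\<^sup>+\<xi>. ennreal ((norm (P \<xi>))\<^sup>2 * exp (- (b * \<xi>)\<^sup>2 / 2)) \<partial>lborel)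
      = (\<integral>\<^sup>+\<xi>. ennreal (norm (P \<xi> * \<psi> \<xi>)) \<partial>lborel)"
    by (intro nn_integral_cong) (simp add: \<psi>_def norm_mult h_def power2_eq_square)
  also have "\<dots> = ennreal (LINT \<xi>|lborel. norm (P \<xi> * \<psi> \<xi>))"
  proof (rule integrable_nn_eq, rule Bochner_Integration.integrable_bound)
    show "integrable lborel (\<lambda>\<xi>. (LINT x|lborel. norm (\<phi> x)) * norm (\<psi> \<xi>))"
      using i\<psi> by auto
    show "AE x in lborel. norm (P x * \<psi> x) \<le> norm ((LINT x|lborel. norm (\<phi> x)) * norm (\<psi> x))"
      using norm_fourier_L1_le[of \<phi>]
      by (auto simp: norm_mult P_def intro!: mult_right_mono)
  qed (use borel_measurable_integrable[OF i\<psi>] in auto)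
  also have "(LINT \<xi>|lborel. norm (P \<xi> * \<psi> \<xi>)) = norm (LINT \<xi>|lborel. P \<xi> * \<psi> \<xi>)"
  proof -
    have "P \<xi> * \<psi> \<xi> = complex_of_real (norm (P \<xi> * \<psi> \<xi>))" for \<xi>
      by (simp add: \<psi>_def norm_mult h_def mult.assoc[symmetric] complex_norm_square[symmetric] power2_eq_square)
    then have "(LINT \<xi>|lborel. P \<xi> * \<psi> \<xi>) = complex_of_real (LINT \<xi>|lborel. norm (P \<xi> * \<psi> \<xi>))"
      by (subst integral_complex_of_real[symmetric]) metis
    then show ?thesis by (simp add: integral_nonneg_AE)
  qed
  also have "(LINT \<xi>|lborel. P \<xi> * \<psi> \<xi>) = (LINT x|lborel. \<phi> x * fourier_L1 \<psi> x)"
    unfolding P_def by (rule fourier_L1_multiplication_formula[OF assms(1) i\<psi>])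
  also have "ennreal (norm \<dots>) \<le> (\<integral>\<^sup>+x. ennreal (norm (\<phi> x * fourier_L1 \<psi> x)) \<partial>lborel)"
    by (rule integral_norm_bound_ennreal, rule Bochner_Integration.integrable_bound[where f="\<lambda>x. (LINT x|lborel. norm (\<psi> x)) * norm (\<phi> x)"])
       (use borel_measurable_integrable[OF i\<psi>] norm_fourier_L1_le[of \<psi>] assms(1)
         in \<open>auto simp: norm_mult mult.commute intro!: mult_left_mono\<close>)
  also have "\<dots> \<le> (\<integral>\<^sup>+x. (\<integral>\<^sup>+y. ennreal (norm (\<phi> x) * norm (\<phi>' y) * N (x + y)) \<partial>lborel) \<partial>lborel)"
  proof (rule nn_integral_mono)
    fix x
    \<comment> \<open>If the inner integrand is not integrable, the Bochner integral has the value 0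
      and the bound still holds, so every x is covered.\<close>
    have "ennreal (norm (fourier_L1 \<psi> x)) \<le> (\<integral>\<^sup>+y. ennreal (norm (\<phi>' y * complex_of_real (N (x + y)))) \<partial>lborel)"
      unfolding F\<psi> by (cases "integrable lborel (\<lambda>y. \<phi>' y * complex_of_real (N (x + y)))")
        (auto simp: not_integrable_integral_eq intro: integral_norm_bound_ennreal)
    then have "ennreal (norm (\<phi> x)) * ennreal (norm (fourier_L1 \<psi> x))
        \<le> ennreal (norm (\<phi> x)) * (\<integral>\<^sup>+y. ennreal (norm (\<phi>' y * complex_of_real (N (x + y)))) \<partial>lborel)"
      by (intro mult_left_mono) auto
    also have "\<dots> = (\<integral>\<^sup>+y. ennreal (norm (\<phi> x) * norm (\<phi>' y) * N (x + y)) \<partial>lborel)"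
      using N0 by (subst nn_integral_cmult[symmetric]) (auto simp: norm_mult mult.assoc simp flip: ennreal_mult)
    finally show "ennreal (norm (\<phi> x * fourier_L1 \<psi> x)) \<le> \<dots>"
      by (simp add: norm_mult ennreal_mult)
  qed
  \<comment> \<open>Schur test: the product of the two norms is at most half the sum of their
    squares, after which N is integrated out in the other variable.\<close>
  also have "\<dots> \<le> (\<integral>\<^sup>+x. (\<integral>\<^sup>+y. ennreal ((norm (\<phi> x))\<^sup>2 / 2) * ennreal (N (x + y))
      + ennreal ((norm (\<phi>' y))\<^sup>2 / 2) * ennreal (N (x + y)) \<partial>lborel) \<partial>lborel)"
  proof (intro nn_integral_mono)
    fix x y
    have "norm (\<phi> x) * norm (\<phi>' y) \<le> (norm (\<phi> x))\<^sup>2 / 2 + (norm (\<phi>' y))\<^sup>2 / 2"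
      using sum_squares_bound[of "norm (\<phi> x)" "norm (\<phi>' y)"] by simp
    from mult_right_mono[OF this N0[of "x + y"]]
    show "ennreal (norm (\<phi> x) * norm (\<phi>' y) * N (x + y)) \<le> ennreal ((norm (\<phi> x))\<^sup>2 / 2) * ennreal (N (x + y))
      + ennreal ((norm (\<phi>' y))\<^sup>2 / 2) * ennreal (N (x + y))"
      using N0 by (simp add: ennreal_leI algebra_simps flip: ennreal_mult ennreal_plus)
  qed
  also have "\<dots> = (\<integral>\<^sup>+x. ennreal ((norm (\<phi> x))\<^sup>2 / 2) * ennreal (2 * pi) \<partial>lborel)
      + (\<integral>\<^sup>+x. (\<integral>\<^sup>+y. ennreal ((norm (\<phi>' y))\<^sup>2 / 2) * ennreal (N (x + y)) \<partial>lborel) \<partial>lborel)"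
    by (simp add: nn_integral_add nn_integral_cmult NN)
  also have "(\<integral>\<^sup>+x. (\<integral>\<^sup>+y. ennreal ((norm (\<phi>' y))\<^sup>2 / 2) * ennreal (N (x + y)) \<partial>lborel) \<partial>lborel)
      = (\<integral>\<^sup>+y. (\<integral>\<^sup>+x. ennreal ((norm (\<phi>' y))\<^sup>2 / 2) * ennreal (N (x + y)) \<partial>lborel) \<partial>lborel)"
    by (rule lborel_pair.Fubini') measurable
  also have "\<dots> = (\<integral>\<^sup>+y. ennreal ((norm (\<phi>' y))\<^sup>2 / 2) * ennreal (2 * pi) \<partial>lborel)"
    by (simp add: nn_integral_cmult NN')
  also have "(\<integral>\<^sup>+x. ennreal ((norm (\<phi> x))\<^sup>2 / 2) * ennreal (2 * pi) \<partial>lborel) = ennreal (pi * (l2 \<phi>)\<^sup>2)"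
  proof -
    have "(\<integral>\<^sup>+x. ennreal ((norm (\<phi> x))\<^sup>2 / 2) * ennreal (2 * pi) \<partial>lborel) = (\<integral>\<^sup>+x. ennreal pi * ennreal ((norm (\<phi> x))\<^sup>2) \<partial>lborel)"
      by (intro nn_integral_cong) (simp flip: ennreal_mult add: mult_ac)
    then show ?thesis using nn_integral_norm_power2[OF assms(2)]
      by (simp add: nn_integral_cmult ennreal_mult)
  qed
  also have "(\<integral>\<^sup>+x. ennreal ((norm (\<phi>' x))\<^sup>2 / 2) * ennreal (2 * pi) \<partial>lborel) = ennreal (pi * (l2 \<phi>)\<^sup>2)"
  proof -
    have "(\<integral>\<^sup>+x. ennreal ((norm (\<phi>' x))\<^sup>2 / 2) * ennreal (2 * pi) \<partial>lborel) = (\<integral>\<^sup>+x. ennreal pi * ennreal ((norm (\<phi>' x))\<^sup>2) \<partial>lborel)"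
      by (intro nn_integral_cong) (simp flip: ennreal_mult add: mult_ac)
    then show ?thesis using nn_integral_norm_power2[OF l'(1)] l'(2)
      by (simp add: nn_integral_cmult ennreal_mult)
  qed
  finally show ?thesis
    by (simp add: P_def mult.assoc flip: ennreal_plus)
qed

text \<open>The Gaussian width is 1 / (n + 1); Fatou removes the weight because the preceding bound
  is uniform in it.\<close>

lemma fourier_L1_L2_bound:
  assumes "integrable lborel \<phi>" "sq_integrable \<phi>"
  shows "sq_integrable (fourier_L1 \<phi>)" and "l2 (fourier_L1 \<phi>) \<le> sqrt (2 * pi) * l2 \<phi>"
proof -
  define f where "f n \<xi> = ennreal ((norm (fourier_L1 \<phi> \<xi>))\<^sup>2 * exp (- (inverse (Suc n) * \<xi>)\<^sup>2 / 2))" for n \<xi>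
  have [measurable]: "\<phi> \<in> borel_measurable borel" using assms by auto
  have [measurable]: "f n \<in> borel_measurable borel" for n unfolding f_def by measurable
  have lim: "(\<lambda>n. f n \<xi>) \<longlonglongrightarrow> ennreal ((norm (fourier_L1 \<phi> \<xi>))\<^sup>2)" for \<xi>
  proof -
    have "(\<lambda>n. (norm (fourier_L1 \<phi> \<xi>))\<^sup>2 * exp (- (inverse (Suc n) * \<xi>)\<^sup>2 / 2)) \<longlonglongrightarrow> (norm (fourier_L1 \<phi> \<xi>))\<^sup>2 * exp (- (0 * \<xi>)\<^sup>2 / 2)"
      by (intro tendsto_intros LIMSEQ_inverse_real_of_nat) auto
    then show ?thesis unfolding f_def by (intro tendsto_ennrealI) simp
  qed
  have "(\<integral>\<^sup>+\<xi>. ennreal ((norm (fourier_L1 \<phi> \<xi>))\<^sup>2) \<partial>lborel) = (\<integral>\<^sup>+\<xi>. liminf (\<lambda>n. f n \<xi>) \<partial>lborel)"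
    by (intro nn_integral_cong) (simp add: lim_imp_Liminf[OF _ lim])
  also have "\<dots> \<le> liminf (\<lambda>n. \<integral>\<^sup>+\<xi>. f n \<xi> \<partial>lborel)"
    by (rule nn_integral_liminf) measurable
  also have "\<dots> \<le> liminf (\<lambda>n. ennreal (2 * pi * (l2 \<phi>)\<^sup>2))"
    unfolding f_def
    by (intro Liminf_mono always_eventually allI fourier_L1_gaussian_bound[OF assms]) simp
  also have "\<dots> = ennreal (2 * pi * (l2 \<phi>)\<^sup>2)"
    by (simp add: Liminf_const)
  finally have le: "(\<integral>\<^sup>+\<xi>. ennreal ((norm (fourier_L1 \<phi> \<xi>))\<^sup>2) \<partial>lborel) \<le> ennreal (2 * pi * (l2 \<phi>)\<^sup>2)" .
  have m: "fourier_L1 \<phi> \<in> borel_measurable borel" by measurable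
  show "sq_integrable (fourier_L1 \<phi>)"
    by (rule sq_integrableI_nn(1)[OF m le])
  have "(l2 (fourier_L1 \<phi>))\<^sup>2 \<le> (sqrt (2 * pi) * l2 \<phi>)\<^sup>2"
    using sq_integrableI_nn(2)[OF m le] by (simp add: power_mult_distrib)
  then show "l2 (fourier_L1 \<phi>) \<le> sqrt (2 * pi) * l2 \<phi>"
    by (rule power2_le_imp_le) simp
qed

subsection \<open>Uniqueness of transforms\<close>

lemma integrable_Re_cis:
  fixes p :: "real \<Rightarrow> real"
  assumes "integrable lborel p"
  shows "integrable lborel (\<lambda>x. complex_of_real (p x) * cis (a * x))"
  using assms by (intro integrable_cis integrable_of_real)

lemma real_distribution_density:
  assumes "p \<in> borel_measurable borel" "\<And>x. 0 \<le> p x" "integrable lborel p" "(LINT x|lborel. p x) = 1"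
  shows "real_distribution (density lborel (\<lambda>x. ennreal (p x)))"
proof -
  have "emeasure (density lborel (\<lambda>x. ennreal (p x))) UNIV = (\<integral>\<^sup>+x. ennreal (p x) \<partial>lborel)"
    using assms(1) by (subst emeasure_density) auto
  also have "\<dots> = 1"
    using assms by (subst nn_integral_eq_integral) auto
  finally show ?thesis
    by (intro real_distribution.intro prob_spaceI real_distribution_axioms.intro) simp_all
qed

lemma char_density:
  assumes "p \<in> borel_measurable borel" "\<And>x. 0 \<le> p x"
  shows "char (density lborel (\<lambda>x. ennreal (p x))) a = (LINT x|lborel. complex_of_real (p x) * cis (a * x))"
  unfolding char_def using assms
  by (subst integral_density) (auto simp: scaleR_conv_of_real cis_conv_exp)

text \<open>The positive and negative parts of d have the same transform, and at frequency 0 the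
  same mass m. If m > 0, dividing by m gives two probability densities with the same characteristic
  function, to which Levy's uniqueness theorem applies; if m = 0, both parts vanish.\<close>

lemma fourier_eq_zero_real:
  fixes d :: "real \<Rightarrow> real"
  assumes d: "integrable lborel d" and z: "\<And>a. (LINT x|lborel. complex_of_real (d x) * cis (a * x)) = 0"
  shows "AE x in lborel. d x = 0"
proof -
  have [measurable]: "d \<in> borel_measurable borel" using d by auto
  define p where "p x = max (d x) 0" for x
  define q where "q x = max (- d x) 0" for x
  have [measurable]: "p \<in> borel_measurable borel" "q \<in> borel_measurable borel"
    unfolding p_def[abs_def] q_def[abs_def] by measurable
  have ip: "integrable lborel p" and iq: "integrable lborel q"
    using d unfolding p_def[abs_def] q_def[abs_def] by auto
  have p0: "0 \<le> p x" and q0: "0 \<le> q x" and pq: "d x = p x - q x" for x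
    by (auto simp: p_def q_def)
  have eq: "(LINT x|lborel. complex_of_real (p x) * cis (a * x)) = (LINT x|lborel. complex_of_real (q x) * cis (a * x))" for a
  proof -
    have "(LINT x|lborel. complex_of_real (p x) * cis (a * x)) - (LINT x|lborel. complex_of_real (q x) * cis (a * x))
      = (LINT x|lborel. complex_of_real (d x) * cis (a * x))"
      by (subst Bochner_Integration.integral_diff[symmetric])
        (auto intro!: integrable_Re_cis ip iq Bochner_Integration.integral_cong simp: pq left_diff_distrib)
    with z show ?thesis by simp
  qed
  define m where "m = (LINT x|lborel. p x)"
  have m': "m = (LINT x|lborel. q x)"
    using eq[of 0] by (simp add: m_def integral_complex_of_real)
  have m0: "m \<ge> 0" unfolding m_def using p0 by simp
  show ?thesis
  proof (cases "m = 0")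
    case True
    then have "AE x in lborel. p x = 0" "AE x in lborel. q x = 0"
      using integral_nonneg_eq_0_iff_AE[OF ip] integral_nonneg_eq_0_iff_AE[OF iq] p0 q0 m_def m' by auto
    then show ?thesis by eventually_elim (simp add: pq)
  next
    case False
    with m0 have m: "m > 0" by simp
    define P where "P x = p x / m" for x
    define Q where "Q x = q x / m" for x
    have [measurable]: "P \<in> borel_measurable borel" "Q \<in> borel_measurable borel"
      unfolding P_def[abs_def] Q_def[abs_def] by measurable
    have P0: "0 \<le> P x" and Q0: "0 \<le> Q x" for x
      using p0 q0 m by (auto simp: P_def Q_def)
    have iP: "integrable lborel P" and iQ: "integrable lborel Q"
      unfolding P_def[abs_def] Q_def[abs_def] using ip iq by auto
    have P1: "(LINT x|lborel. P x) = 1" "(LINT x|lborel. Q x) = 1"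
      unfolding P_def Q_def using m m' by (simp_all add: m_def[symmetric])
    have "char (density lborel (\<lambda>x. ennreal (P x))) = char (density lborel (\<lambda>x. ennreal (Q x)))"
    proof
      fix a
      have "(LINT x|lborel. complex_of_real (p x) * cis (a * x) / complex_of_real m)
        = (LINT x|lborel. complex_of_real (q x) * cis (a * x) / complex_of_real m)"
        using eq[of a] by simp
      then show "char (density lborel (\<lambda>x. ennreal (P x))) a = char (density lborel (\<lambda>x. ennreal (Q x))) a"
        unfolding char_density[OF \<open>P \<in> borel_measurable borel\<close> P0] char_density[OF \<open>Q \<in> borel_measurable borel\<close> Q0]
        by (simp add: P_def Q_def)
    qed
    then have "density lborel (\<lambda>x. ennreal (P x)) = density lborel (\<lambda>x. ennreal (Q x))"
      by (intro Levy_uniqueness real_distribution_density P0 Q0 iP iQ P1) auto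
    then have "AE x in lborel. ennreal (P x) = ennreal (Q x)"
      by (intro sigma_finite_measure.density_unique[OF lborel.sigma_finite_measure_axioms]) auto
    then show ?thesis
      by eventually_elim (use P0 Q0 m in \<open>auto simp: P_def Q_def pq\<close>)
  qed
qed

text \<open>Conjugating the hypothesis at - a shows that \<open>cnj (d x)\<close> also has a
  vanishing transform, hence so do the real and the imaginary part.\<close>

lemma fourier_eq_zero:
  fixes d :: "real \<Rightarrow> complex"
  assumes d: "integrable lborel d" and z: "\<And>a. (LINT x|lborel. d x * cis (a * x)) = 0"
  shows "AE x in lborel. d x = 0"
proof -
  have z': "(LINT x|lborel. cnj (d x) * cis (a * x)) = 0" for a
  proof -
    have "(LINT x|lborel. cnj (d x * cis ((-a) * x))) = cnj (LINT x|lborel. d x * cis ((-a) * x))"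
      by (rule Bochner_Integration.integral_cnj)
    then show ?thesis using z[of "-a"] by (simp add: cis_cnj)
  qed
  have id': "integrable lborel (\<lambda>x. cnj (d x))" using d by simp
  have "AE x in lborel. Re (d x) = 0"
  proof (rule fourier_eq_zero_real)
    fix a
    have pt: "d x * c + cnj (d x) * c = 2 * (complex_of_real (Re (d x)) * c)" for x c
      by (simp add: complex_eq_iff algebra_simps)
    have "(LINT x|lborel. d x * cis (a * x)) + (LINT x|lborel. cnj (d x) * cis (a * x))
      = (LINT x|lborel. 2 * (complex_of_real (Re (d x)) * cis (a * x)))"
      by (subst Bochner_Integration.integral_add[symmetric]) (intro integrable_cis d id', intro integrable_cis d id', simp only: pt)
    with z z' show "(LINT x|lborel. complex_of_real (Re (d x)) * cis (a * x)) = 0" by simp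
  qed (use d in auto)
  moreover have "AE x in lborel. Im (d x) = 0"
  proof (rule fourier_eq_zero_real)
    fix a
    have pt: "d x * c - cnj (d x) * c = (2 * \<i>) * (complex_of_real (Im (d x)) * c)" for x c
      by (simp add: complex_eq_iff algebra_simps)
    have "(LINT x|lborel. d x * cis (a * x)) - (LINT x|lborel. cnj (d x) * cis (a * x))
      = (LINT x|lborel. (2 * \<i>) * (complex_of_real (Im (d x)) * cis (a * x)))"
      by (subst Bochner_Integration.integral_diff[symmetric]) (intro integrable_cis d id', intro integrable_cis d id', simp only: pt)
    with z z' show "(LINT x|lborel. complex_of_real (Im (d x)) * cis (a * x)) = 0" by simp
  qed (use d in auto)
  ultimately show ?thesis by eventually_elim (simp add: complex_eq_iff)
qed

text \<open>Gaussian waves have explicit transforms and separate points of $L^2$ (by the uniqueness theorem for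
  characteristic functions), so it is enough to test identities of transforms against them.\<close>

definition gauss_wave :: "real \<Rightarrow> real \<Rightarrow> complex" where
  "gauss_wave a x = complex_of_real (exp (- x\<^sup>2 / 2)) * cis (a * x)"

lemma gauss_wave_measurable [measurable]: "gauss_wave a \<in> borel_measurable borel"
  unfolding gauss_wave_def by measurable

lemma norm_gauss_wave: "norm (gauss_wave a x) = exp (- x\<^sup>2 / 2)"
  by (simp add: gauss_wave_def norm_mult)

lemma integrable_gauss_wave: "integrable lborel (gauss_wave a)"
  unfolding gauss_wave_def by (intro integrable_cis integrable_of_real integrable_gaussian)

lemma sq_integrable_integrable_bounded:
  fixes f :: "real \<Rightarrow> complex"
  assumes "integrable lborel f" "\<And>x. norm (f x) \<le> C"
  shows "sq_integrable f"
  unfolding sq_integrable_def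
proof
  have "integrable lborel (\<lambda>x. C * norm (f x))" using assms by auto
  then show "integrable lborel (\<lambda>x. (norm (f x))\<^sup>2)"
    by (rule Bochner_Integration.integrable_bound)
      (use assms borel_measurable_integrable[OF assms(1)] in \<open>auto simp: power2_eq_square abs_mult intro!: mult_right_mono order_trans[OF assms(2)]\<close>)
qed (use assms in auto)

lemma sq_integrable_gauss_wave: "sq_integrable (gauss_wave a)"
  by (rule sq_integrable_integrable_bounded[OF integrable_gauss_wave, of _ 1]) (simp add: norm_gauss_wave)

lemma fourier_L1_gauss_wave:
  "fourier_L1 (gauss_wave a) x = complex_of_real (sqrt (2 * pi)) * complex_of_real (exp (- (x - a)\<^sup>2 / 2))"
  unfolding gauss_wave_def fourier_L1_modulation fourier_L1_gaussian by simp

text \<open>Multiplying by the fixed Gaussian makes d integrable, the parameter a runs through all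
  characters, and the Gaussian has no zeros, so that it can be divided out.\<close>

lemma gauss_wave_eq_zero:
  assumes d: "sq_integrable d" and z: "\<And>a. (LINT x|lborel. d x * gauss_wave a x) = 0"
  shows "AE x in lborel. d x = 0"
proof -
  have "AE x in lborel. d x * gauss_wave 0 x = 0"
  proof (rule fourier_eq_zero)
    show "integrable lborel (\<lambda>x. d x * gauss_wave 0 x)"
      by (rule integrable_mult_L2[OF d sq_integrable_gauss_wave])
    show "(LINT x|lborel. d x * gauss_wave 0 x * cis (a * x)) = 0" for a
      using z[of a] by (simp add: gauss_wave_def mult.assoc)
  qed
  then show ?thesis by (simp add: gauss_wave_def)
qed

subsection \<open>The transform of square integrable functions\<close>

text \<open>Complex counterpart of \<open>is_L2_fourier\<close>: inversion applies the transform to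
  a transform, which is not real in general. Both functions are in L2 by definition, so that a
  transform pair carries its own integrability.\<close>

definition is_fourier :: "(real \<Rightarrow> complex) \<Rightarrow> (real \<Rightarrow> complex) \<Rightarrow> bool" where
  "is_fourier f g \<longleftrightarrow> sq_integrable f \<and> sq_integrable g \<and>
     (\<forall>\<phi>. integrable lborel \<phi> \<and> sq_integrable \<phi> \<longrightarrow>
        (LINT \<xi>|lborel. g \<xi> * \<phi> \<xi>) = (LINT x|lborel. f x * fourier_L1 \<phi> x))"

lemma is_fourierD:
  assumes "is_fourier f g"
  shows "sq_integrable f" "sq_integrable g"
    "integrable lborel \<phi> \<Longrightarrow> sq_integrable \<phi> \<Longrightarrow> (LINT \<xi>|lborel. g \<xi> * \<phi> \<xi>) = (LINT x|lborel. f x * fourier_L1 \<phi> x)"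
  using assms by (auto simp: is_fourier_def)

text \<open>Both candidates have the same pairing with every Gaussian wave, and these separate
  points of L2.\<close>

lemma is_fourier_unique:
  assumes "is_fourier f g" "is_fourier f h"
  shows "AE x in lborel. g x = h x"
proof -
  note g = is_fourierD[OF assms(1)] and h = is_fourierD[OF assms(2)]
  have "AE x in lborel. g x - h x = 0"
  proof (rule gauss_wave_eq_zero)
    show "sq_integrable (\<lambda>x. g x - h x)" using g(2) h(2) by (rule sq_integrable_diff)
    fix a
    note w = integrable_gauss_wave[of a] sq_integrable_gauss_wave[of a]
    have "(LINT x|lborel. (g x - h x) * gauss_wave a x)
        = (LINT x|lborel. g x * gauss_wave a x) - (LINT x|lborel. h x * gauss_wave a x)"
      unfolding left_diff_distrib
      by (intro Bochner_Integration.integral_diff integrable_mult_L2 g h w)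
    then show "(LINT x|lborel. (g x - h x) * gauss_wave a x) = 0"
      using g(3)[OF w] h(3)[OF w] by simp
  qed
  then show ?thesis by simp
qed

lemma is_fourier_cong_AE:
  assumes "is_fourier f g" "f' \<in> borel_measurable borel" "g' \<in> borel_measurable borel"
    "AE x in lborel. f x = f' x" "AE x in lborel. g x = g' x"
  shows "is_fourier f' g'"
proof -
  note h = is_fourierD[OF assms(1)]
  have s: "sq_integrable f'" "sq_integrable g'"
    using sq_integrable_cong_AE[OF h(1) assms(2,4)] sq_integrable_cong_AE[OF h(2) assms(3,5)] .
  show ?thesis
    unfolding is_fourier_def
  proof (intro conjI s allI impI)
    fix \<phi> :: "real \<Rightarrow> complex" assume \<phi>: "integrable lborel \<phi> \<and> sq_integrable \<phi>"
    then have [measurable]: "\<phi> \<in> borel_measurable borel" by auto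
    note [measurable] = sq_integrable_measurable[OF h(1)] sq_integrable_measurable[OF h(2)] assms(2,3)
    have "(LINT \<xi>|lborel. g' \<xi> * \<phi> \<xi>) = (LINT \<xi>|lborel. g \<xi> * \<phi> \<xi>)"
      using assms(5) by (intro integral_cong_AE) auto
    also have "\<dots> = (LINT x|lborel. f x * fourier_L1 \<phi> x)"
      using \<phi> by (intro h) auto
    also have "\<dots> = (LINT x|lborel. f' x * fourier_L1 \<phi> x)"
      using assms(4) by (intro integral_cong_AE) auto
    finally show "(LINT \<xi>|lborel. g' \<xi> * \<phi> \<xi>) = (LINT x|lborel. f' x * fourier_L1 \<phi> x)" .
  qed
qed

lemma is_fourier_L1:
  assumes "integrable lborel f" "sq_integrable f"
  shows "is_fourier f (fourier_L1 f)"
  unfolding is_fourier_def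
  using assms fourier_L1_L2_bound(1)[OF assms] by (auto intro: fourier_L1_multiplication_formula)

section \<open>Linearity and closedness of the transform relation\<close>

lemma is_fourier_add:
  assumes "is_fourier f g" "is_fourier f' g'"
  shows "is_fourier (\<lambda>x. f x + f' x) (\<lambda>x. g x + g' x)"
  unfolding is_fourier_def
proof (intro conjI allI impI)
  note h = is_fourierD[OF assms(1)] and h' = is_fourierD[OF assms(2)]
  show "sq_integrable (\<lambda>x. f x + f' x)" "sq_integrable (\<lambda>x. g x + g' x)"
    using h h' by (auto intro: sq_integrable_add)
  fix \<phi> :: "real \<Rightarrow> complex" assume \<phi>: "integrable lborel \<phi> \<and> sq_integrable \<phi>"
  then have "sq_integrable (fourier_L1 \<phi>)" by (auto intro: fourier_L1_L2_bound)
  then show "(LINT \<xi>|lborel. (g \<xi> + g' \<xi>) * \<phi> \<xi>) = (LINT x|lborel. (f x + f' x) * fourier_L1 \<phi> x)"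
    using \<phi> h h' by (simp add: distrib_right integrable_mult_L2)
qed

lemma is_fourier_cmult:
  assumes "is_fourier f g"
  shows "is_fourier (\<lambda>x. c * f x) (\<lambda>x. c * g x)"
  using assms by (auto simp: is_fourier_def mult.assoc intro: sq_integrable_cmult)

lemma is_fourier_diff:
  assumes "is_fourier f g" "is_fourier f' g'"
  shows "is_fourier (\<lambda>x. f x - f' x) (\<lambda>x. g x - g' x)"
  using is_fourier_add[OF assms(1) is_fourier_cmult[OF assms(2), of "-1"]] by simp

lemma is_fourier_sum:
  "(\<And>i. i \<in> I \<Longrightarrow> is_fourier (f i) (g i)) \<Longrightarrow> is_fourier (\<lambda>x. \<Sum>i\<in>I. f i x) (\<lambda>x. \<Sum>i\<in>I. g i x)"
proof (induction I rule: infinite_finite_induct)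
  case (insert i I)
  then show ?case using is_fourier_add[of "f i" "g i"] by simp
qed (auto simp: is_fourier_def)

lemma integral_mult_tendsto_L2:
  fixes f :: "nat \<Rightarrow> real \<Rightarrow> complex"
  assumes f: "\<And>n. sq_integrable (f n)" and g: "sq_integrable g" and h: "sq_integrable h"
    and lim: "(\<lambda>n. l2 (\<lambda>x. g x - f n x)) \<longlonglongrightarrow> 0"
  shows "(\<lambda>n. LINT x|lborel. f n x * h x) \<longlonglongrightarrow> (LINT x|lborel. g x * h x)"
proof (rule Lim_transform2[OF tendsto_const])
  show "(\<lambda>n. (LINT x|lborel. g x * h x) - (LINT x|lborel. f n x * h x)) \<longlonglongrightarrow> 0"
  proof (rule Lim_null_comparison)
    have "norm ((LINT x|lborel. g x * h x) - (LINT x|lborel. f n x * h x)) \<le> l2 (\<lambda>x. g x - f n x) * l2 h" for n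
    proof -
      have "(LINT x|lborel. g x * h x) - (LINT x|lborel. f n x * h x) = (LINT x|lborel. (g x - f n x) * h x)"
        using f g h by (simp add: left_diff_distrib integrable_mult_L2)
      then show ?thesis
        using Cauchy_Schwarz_L2[OF sq_integrable_diff[OF g f] h] by simp
    qed
    then show "\<forall>\<^sub>F n in sequentially. norm ((LINT x|lborel. g x * h x) - (LINT x|lborel. f n x * h x)) \<le> l2 (\<lambda>x. g x - f n x) * l2 h"
      by simp
    show "(\<lambda>n. l2 (\<lambda>x. g x - f n x) * l2 h) \<longlonglongrightarrow> 0"
      using tendsto_mult_right[OF lim, of "l2 h"] by simp
  qed
qed

text \<open>For a fixed test function both sides of the multiplication formula are continuous in L2
  by Cauchy-Schwarz, so the relation is closed.\<close>

lemma is_fourier_limit: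
  assumes fg: "\<And>n. is_fourier (f n) (g n)" and F: "sq_integrable F" and G: "sq_integrable G"
    and lim: "(\<lambda>n. l2 (\<lambda>x. F x - f n x)) \<longlonglongrightarrow> 0" "(\<lambda>n. l2 (\<lambda>x. G x - g n x)) \<longlonglongrightarrow> 0"
  shows "is_fourier F G"
  unfolding is_fourier_def
proof (intro conjI F G allI impI)
  fix \<phi> :: "real \<Rightarrow> complex" assume \<phi>: "integrable lborel \<phi> \<and> sq_integrable \<phi>"
  then have F\<phi>: "sq_integrable (fourier_L1 \<phi>)" by (auto intro: fourier_L1_L2_bound)
  have "(\<lambda>n. LINT x|lborel. g n x * \<phi> x) \<longlonglongrightarrow> (LINT x|lborel. G x * \<phi> x)"
    by (intro integral_mult_tendsto_L2 is_fourierD(2)[OF fg] G lim) (use \<phi> in auto)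
  moreover have "(\<lambda>n. LINT x|lborel. f n x * fourier_L1 \<phi> x) \<longlonglongrightarrow> (LINT x|lborel. F x * fourier_L1 \<phi> x)"
    by (intro integral_mult_tendsto_L2 is_fourierD(1)[OF fg] F lim F\<phi>)
  moreover have "(LINT x|lborel. g n x * \<phi> x) = (LINT x|lborel. f n x * fourier_L1 \<phi> x)" for n
    by (intro is_fourierD(3)[OF fg]) (use \<phi> in auto)
  ultimately show "(LINT x|lborel. G x * \<phi> x) = (LINT x|lborel. F x * fourier_L1 \<phi> x)"
    using LIMSEQ_unique by auto
qed

lemma is_fourier_suminf:
  assumes fg: "\<And>n. is_fourier (f n) (g n)" and "summable (\<lambda>n. l2 (f n))" "summable (\<lambda>n. l2 (g n))"
  shows "is_fourier (\<lambda>x. \<Sum>n. f n x) (\<lambda>x. \<Sum>n. g n x)"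
proof (rule is_fourier_limit)
  note f = is_fourierD(1)[OF fg] and g = is_fourierD(2)[OF fg]
  show "is_fourier (\<lambda>x. \<Sum>n<m. f n x) (\<lambda>x. \<Sum>n<m. g n x)" for m
    by (rule is_fourier_sum[OF fg])
qed (use is_fourierD(1,2)[OF fg] assms(2,3) in \<open>auto intro: l2_suminf_tendsto l2_suminf(2)\<close>)

lemma l2_truncation_tendsto:
  fixes f :: "real \<Rightarrow> complex"
  assumes "sq_integrable f"
  shows "(\<lambda>n. l2 (\<lambda>x. f x - indicator {-real n..real n} x * f x)) \<longlonglongrightarrow> 0"
proof -
  note [measurable] = sq_integrable_measurable[OF assms]
  have "(\<lambda>n. LINT x|lborel. (norm (f x - indicator {-real n..real n} x * f x))\<^sup>2) \<longlonglongrightarrow> (LINT x::real|lborel. (0::real))"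
  proof (rule integral_dominated_convergence[where w="\<lambda>x. (norm (f x))\<^sup>2"])
    show "AE x in lborel. (\<lambda>n. (norm (f x - indicator {-real n..real n} x * f x))\<^sup>2) \<longlonglongrightarrow> 0"
    proof (rule AE_I2, rule tendsto_eventually)
      fix x :: real
      have "\<forall>\<^sub>F n in sequentially. \<bar>x\<bar> \<le> real n"
        by (rule eventually_sequentiallyI[of "nat \<lceil>\<bar>x\<bar>\<rceil>"]) linarith
      then show "\<forall>\<^sub>F n in sequentially. (norm (f x - indicator {-real n..real n} x * f x))\<^sup>2 = 0"
        by eventually_elim (auto simp: indicator_def)
    qed
    show "AE x in lborel. norm ((norm (f x - indicator {-real n..real n} x * f x))\<^sup>2) \<le> (norm (f x))\<^sup>2" for n
      by (auto simp: indicator_def)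
  qed (use assms in \<open>auto simp: sq_integrable_def\<close>)
  then have "(\<lambda>n. sqrt (LINT x|lborel. (norm (f x - indicator {-real n..real n} x * f x))\<^sup>2)) \<longlonglongrightarrow> sqrt 0"
    by (intro tendsto_real_sqrt) simp
  then show ?thesis by (simp add: l2_def)
qed

lemma integrable_truncation:
  fixes f :: "real \<Rightarrow> complex"
  assumes "sq_integrable f"
  shows "sq_integrable (\<lambda>x. indicator {-r..r} x * f x)" and "integrable lborel (\<lambda>x. indicator {-r..r::real} x * f x)"
proof -
  have i: "sq_integrable (\<lambda>x. indicator {-r..r} x :: complex)"
    unfolding sq_integrable_def
  proof
    have "(\<lambda>x. (norm (indicator {-r..r} x :: complex))\<^sup>2) = (\<lambda>x. indicator {-r..r} x)"
      by (auto simp: indicator_def)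
    then show "integrable lborel (\<lambda>x. (norm (indicator {-r..r} x :: complex))\<^sup>2)"
      by (simp add: integrable_indicator_iff emeasure_lborel_Icc_eq)
  qed simp
  show "integrable lborel (\<lambda>x. indicator {-r..r::real} x * f x)"
    by (rule integrable_mult_L2[OF i assms])
  show "sq_integrable (\<lambda>x. indicator {-r..r} x * f x)"
    by (rule sq_integrable_bounded_mult[OF assms, where C=1]) (auto simp: indicator_def)
qed

text \<open>Completeness is available for series only, so the truncations of f are taken along a
  subsequence with error below 2^-k and f is written as a telescoping series. The differences are
  integrable, the L1 transform applies to each, and the Plancherel bound makes the transforms
  summable in L2.\<close>

lemma fourier_exists:
  assumes f: "sq_integrable f"
  shows "\<exists>g. is_fourier f g \<and> l2 g \<le> sqrt (2 * pi) * l2 f"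
proof -
  note [measurable] = sq_integrable_measurable[OF f]
  define t where "t n x = indicator {-real n..real n} x * f x" for n x
  have lim: "(\<lambda>n. l2 (\<lambda>x. f x - t n x)) \<longlonglongrightarrow> 0"
    unfolding t_def by (rule l2_truncation_tendsto[OF f])
  have t: "sq_integrable (t n)" "integrable lborel (t n)" for n
    unfolding t_def[abs_def] by (rule integrable_truncation[OF f])+
  have "\<exists>n. l2 (\<lambda>x. f x - t n x) < (1/2)^k" for k
    using order_tendstoD(2)[OF lim, of "(1/2)^k"] by (auto simp: eventually_sequentially)
  then obtain N where N: "\<And>k. l2 (\<lambda>x. f x - t (N k) x) < (1/2)^k" by metis
  define p where "p k x = t (N (Suc k)) x - t (N k) x" for k x
  have ip: "integrable lborel (p k)" and sp: "sq_integrable (p k)" for k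
    unfolding p_def using t by (auto intro: sq_integrable_diff)
  have lp: "l2 (p k) \<le> 2 * (1/2)^k" for k
  proof -
    have "l2 (p k) = l2 (\<lambda>x. (f x - t (N k) x) - (f x - t (N (Suc k)) x))"
      unfolding p_def by (rule arg_cong[where f=l2]) auto
    also have "\<dots> \<le> l2 (\<lambda>x. f x - t (N k) x) + l2 (\<lambda>x. f x - t (N (Suc k)) x)"
      by (intro l2_triangle_diff sq_integrable_diff f t)
    also have "\<dots> \<le> (1/2)^k + (1/2)^Suc k"
      using N[of k] N[of "Suc k"] by simp
    also have "\<dots> \<le> 2 * (1/2)^k" by simp
    finally show ?thesis .
  qed
  have sg: "summable (\<lambda>k. C * (1/2::real)^k)" for C
    by (intro summable_mult summable_geometric) simp
  define q where "q k = fourier_L1 (p k)" for k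
  have pq: "is_fourier (p k) (q k)" for k
    unfolding q_def by (rule is_fourier_L1[OF ip sp])
  have sq: "sq_integrable (q k)" for k using is_fourierD(2)[OF pq] .
  have lq: "l2 (q k) \<le> sqrt (2 * pi) * 2 * (1/2)^k" for k
    unfolding q_def mult.assoc
    by (rule order_trans[OF fourier_L1_L2_bound(2)[OF ip sp] mult_left_mono[OF lp]]) simp
  have suml: "summable (\<lambda>k. l2 (q k))"
    by (rule summable_comparison_test[OF _ sg]) (use lq in auto)
  define g0 where "g0 = fourier_L1 (t (N 0))"
  define g where "g x = g0 x + (\<Sum>k. q k x)" for x
  define S where "S m x = g0 x + (\<Sum>k<m. q k x)" for m x
  have sg0: "is_fourier (t (N 0)) g0"
    unfolding g0_def by (rule is_fourier_L1[OF t(2,1)])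
  have sqg: "sq_integrable g"
    unfolding g_def by (intro sq_integrable_add is_fourierD(2)[OF sg0] l2_suminf(2)[OF sq suml])
  have tele: "t (N m) x = t (N 0) x + (\<Sum>k<m. p k x)" for m x
    by (induction m) (auto simp: p_def)
  have F1: "is_fourier (t (N m)) (S m)" for m
    unfolding S_def tele[of m] by (intro is_fourier_add sg0 is_fourier_sum pq)
  have limS: "(\<lambda>m. l2 (\<lambda>x. g x - S m x)) \<longlonglongrightarrow> 0"
    using l2_suminf_tendsto[OF sq suml] by (simp add: g_def S_def)
  have limN: "(\<lambda>m. l2 (\<lambda>x. f x - t (N m) x)) \<longlonglongrightarrow> 0"
    by (rule tendsto_sandwich[OF _ _ tendsto_const, where h="\<lambda>m. (1/2)^m"])
      (auto intro!: less_imp_le[OF N] LIMSEQ_realpow_zero always_eventually)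
  have fg: "is_fourier f g"
    by (rule is_fourier_limit[OF F1 f sqg limN limS])
  \<comment> \<open>The sum of the bounds of the pieces would lose the constant. Instead each
    partial sum is recognised as the transform of one truncation, whose norm is at most that of f,
    and m tends to infinity.\<close>
  have "l2 g \<le> sqrt (2 * pi) * l2 f + l2 (\<lambda>x. g x - S m x)" for m
  proof -
    have "AE x in lborel. S m x = fourier_L1 (t (N m)) x"
      by (rule is_fourier_unique[OF F1 is_fourier_L1[OF t(2,1)]])
    then have "l2 (S m) = l2 (fourier_L1 (t (N m)))"
      using is_fourierD(2)[OF F1] by (intro l2_cong_AE) (auto intro!: borel_measurable_fourier_L1 simp: sq_integrable_measurable t)
    also have "\<dots> \<le> sqrt (2 * pi) * l2 (t (N m))"
      by (rule fourier_L1_L2_bound(2)[OF t(2,1)])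
    also have "l2 (t (N m)) \<le> 1 * l2 f"
      unfolding t_def using f by (intro l2_mono) (auto simp: indicator_def)
    finally have "l2 (S m) \<le> sqrt (2 * pi) * l2 f" by simp
    moreover have "l2 (\<lambda>x. S m x + (g x - S m x)) \<le> l2 (S m) + l2 (\<lambda>x. g x - S m x)"
      by (intro l2_triangle sq_integrable_diff sqg is_fourierD(2)[OF F1])
    ultimately show ?thesis by simp
  qed
  then have "l2 g \<le> sqrt (2 * pi) * l2 f + 0"
    by (intro LIMSEQ_le_const[OF tendsto_add[OF tendsto_const limS]]) auto
  with fg show ?thesis by auto
qed

text \<open>The bound known for the constructed transform passes to every other one by
  uniqueness.\<close>

lemma is_fourier_bound:
  assumes "is_fourier f g"
  shows "l2 g \<le> sqrt (2 * pi) * l2 f"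
proof -
  obtain h where h: "is_fourier f h" "l2 h \<le> sqrt (2 * pi) * l2 f"
    using fourier_exists[OF is_fourierD(1)[OF assms]] by auto
  have "l2 g = l2 h"
    using is_fourier_unique[OF assms h(1)] is_fourierD(2)[OF assms] is_fourierD(2)[OF h(1)]
    by (intro l2_cong_AE) (auto simp: sq_integrable_measurable)
  with h show ?thesis by simp
qed

text \<open>For Gaussian waves the double transform is explicit, namely 2 pi times the reflection.
  Two applications of the multiplication formula move both transforms from f onto the wave, and the
  waves determine an L2 function.\<close>

lemma is_fourier_inversion:
  assumes fg: "is_fourier f g"
  shows "is_fourier g (\<lambda>x. 2 * complex_of_real pi * f (- x))"
proof -
  obtain h where h: "is_fourier g h"
    using fourier_exists[OF is_fourierD(2)[OF fg]] by auto
  have rf: "sq_integrable (\<lambda>x. 2 * complex_of_real pi * f (- x))"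
    by (intro sq_integrable_cmult sq_integrable_reflect is_fourierD(1)[OF fg])
  have "AE x in lborel. h x - 2 * complex_of_real pi * f (- x) = 0"
  proof (rule gauss_wave_eq_zero)
    show "sq_integrable (\<lambda>x. h x - 2 * complex_of_real pi * f (- x))"
      by (intro sq_integrable_diff is_fourierD(2)[OF h] rf)
    fix a
    define \<phi> where "\<phi> = fourier_L1 (gauss_wave a)"
    have \<phi>: "\<phi> = (\<lambda>\<xi>. complex_of_real (sqrt (2 * pi)) * gauss_wave 0 (\<xi> - a))"
      unfolding \<phi>_def fourier_L1_gauss_wave by (simp add: gauss_wave_def)
    have i\<phi>: "integrable lborel \<phi>"
      unfolding \<phi> using lborel_integrable_real_affine[OF integrable_gauss_wave[of 0], of 1 "-a"]
      by (intro integrable_mult_right) simp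
    have s\<phi>: "sq_integrable \<phi>"
      unfolding \<phi> using sq_integrable_translate(1)[OF sq_integrable_gauss_wave[of 0], of "-a"]
      by (intro sq_integrable_cmult) simp
    have F\<phi>: "fourier_L1 \<phi> x = 2 * complex_of_real pi * gauss_wave a (- x)" for x
    proof -
      have "fourier_L1 \<phi> x = complex_of_real (sqrt (2 * pi)) * (cis (- (a * x)) * (complex_of_real (sqrt (2 * pi)) * complex_of_real (exp (- x\<^sup>2 / 2))))"
        unfolding \<phi> fourier_L1_cmult fourier_L1_translation fourier_L1_gauss_wave by simp
      also have "\<dots> = (complex_of_real (sqrt (2 * pi)) * complex_of_real (sqrt (2 * pi))) * gauss_wave a (- x)"
        by (simp add: gauss_wave_def)
      also have "complex_of_real (sqrt (2 * pi)) * complex_of_real (sqrt (2 * pi)) = 2 * complex_of_real pi"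
      proof -
        have "sqrt (2 * pi) * sqrt (2 * pi) = 2 * pi" by simp
        then show ?thesis by (metis of_real_mult of_real_numeral)
      qed
      finally show ?thesis .
    qed
    have "(LINT x|lborel. h x * gauss_wave a x) = (LINT \<xi>|lborel. g \<xi> * \<phi> \<xi>)"
      unfolding \<phi>_def by (intro is_fourierD(3)[OF h] integrable_gauss_wave sq_integrable_gauss_wave)
    also have "\<dots> = (LINT x|lborel. f x * fourier_L1 \<phi> x)"
      by (intro is_fourierD(3)[OF fg] i\<phi> s\<phi>)
    also have "\<dots> = \<bar>-1\<bar> *\<^sub>R (LINT x|lborel. f (0 + (-1) * x) * fourier_L1 \<phi> (0 + (-1) * x))"
      by (rule lborel_integral_real_affine) simp
    also have "\<dots> = (LINT x|lborel. 2 * complex_of_real pi * f (- x) * gauss_wave a x)"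
      unfolding F\<phi> by (simp add: mult_ac)
    finally show "(LINT x|lborel. (h x - 2 * complex_of_real pi * f (- x)) * gauss_wave a x) = 0"
      using integrable_mult_L2[OF is_fourierD(2)[OF h] sq_integrable_gauss_wave[of a]]
        integrable_mult_L2[OF rf sq_integrable_gauss_wave[of a]]
      by (simp add: left_diff_distrib)
  qed
  then show ?thesis
    by (intro is_fourier_cong_AE[OF h]) (auto simp: sq_integrable_measurable is_fourierD(2)[OF fg] rf)
qed

text \<open>The upper bound applied to the inverse pair; with \<open>is_fourier_bound\<close> this
  is Plancherel's identity.\<close>

lemma is_fourier_bound':
  assumes "is_fourier f g"
  shows "sqrt (2 * pi) * l2 f \<le> l2 g"
proof -
  have "2 * pi * l2 f = l2 (\<lambda>x. 2 * complex_of_real pi * f (- x))"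
    using sq_integrable_reflect(2)[OF is_fourierD(1)[OF assms]] by (simp add: l2_cmult norm_mult)
  also have "\<dots> \<le> sqrt (2 * pi) * l2 g"
    by (rule is_fourier_bound[OF is_fourier_inversion[OF assms]])
  finally have "sqrt (2 * pi) * (sqrt (2 * pi) * l2 f) \<le> sqrt (2 * pi) * l2 g"
    by (simp add: mult.assoc[symmetric])
  then show ?thesis by simp
qed

subsection \<open>Convolution with an integrable kernel\<close>

text \<open>The orientation y - x is that of \<open>conv\<close>, which is why
  \<open>fourier_L1 V\<close> is evaluated at - \<xi> in the multiplier.\<close>

definition cconv :: "(real \<Rightarrow> complex) \<Rightarrow> (real \<Rightarrow> complex) \<Rightarrow> real \<Rightarrow> complex" where
  "cconv V v x = (LINT y|lborel. V (y - x) * v y)"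

lemma integrable_shift:
  fixes V :: "real \<Rightarrow> 'b::{banach, second_countable_topology}"
  shows "integrable lborel V \<Longrightarrow> integrable lborel (\<lambda>y. V (y - x))"
  using lborel_integrable_real_affine[of V 1 "-x"] by simp

lemma integral_shift:
  fixes V :: "real \<Rightarrow> 'b::{banach, second_countable_topology}"
  shows "(LINT y|lborel. V (y + x)) = (LINT y|lborel. V y)"
  by (subst (2) lborel_integral_real_affine[where c=1 and t=x]) (auto simp: add.commute)

lemma nn_integral_shift_reflect:
  assumes [measurable]: "f \<in> borel_measurable borel"
  shows "(\<integral>\<^sup>+x. f (y - x) \<partial>lborel) = (\<integral>\<^sup>+x. f (x::real) \<partial>lborel)"
  by (subst (2) nn_integral_real_affine[where c="-1" and t=y]) auto

lemma integrable_conv: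
  fixes V v :: "real \<Rightarrow> 'b::{real_normed_algebra, banach, second_countable_topology}"
  assumes V: "integrable lborel V" and [measurable]: "v \<in> borel_measurable borel" and b: "AE x in lborel. norm (v x) \<le> C"
  shows "integrable lborel (\<lambda>y. V (y - x) * v y)"
    and "norm (LINT y|lborel. V (y - x) * v y) \<le> (LINT y|lborel. norm (V y)) * C"
proof -
  have [measurable]: "V \<in> borel_measurable borel" using V by auto
  have Vx: "integrable lborel (\<lambda>y. norm (V (y - x)) * C)"
    using integrable_shift[OF V] by auto
  have le: "AE y in lborel. norm (V (y - x) * v y) \<le> norm (V (y - x)) * C"
    using b by eventually_elim (meson mult_left_mono norm_ge_zero norm_mult_ineq order_trans)
  show i: "integrable lborel (\<lambda>y. V (y - x) * v y)"
    by (rule Bochner_Integration.integrable_bound[OF Vx]) (measurable, use le in eventually_elim, simp)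
  have "norm (LINT y|lborel. V (y - x) * v y) \<le> (LINT y|lborel. norm (V (y - x) * v y))"
    by (rule integral_norm_bound)
  also have "\<dots> \<le> (LINT y|lborel. norm (V (y - x)) * C)"
    using i Vx le by (intro integral_mono_AE) auto
  also have "\<dots> = (LINT y|lborel. norm (V y)) * C"
    using integral_shift[of "\<lambda>y. norm (V y)" "-x"] by simp
  finally show "norm (LINT y|lborel. V (y - x) * v y) \<le> (LINT y|lborel. norm (V y)) * C" .
qed

text \<open>Young's inequality for L1 and L2: one square root of the kernel is attached to each
  factor, Cauchy-Schwarz is applied for fixed x, and Tonelli integrates the kernel out in x.\<close>

lemma sq_integrable_cconv:
  assumes V: "integrable lborel V" and v: "sq_integrable v"
  shows "sq_integrable (cconv V v)"
proof -
  note [measurable] = sq_integrable_measurable[OF v]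
  have [measurable]: "V \<in> borel_measurable borel" using V by auto
  have m: "cconv V v \<in> borel_measurable borel" unfolding cconv_def by measurable
  define I where "I = (LINT y|lborel. norm (V y))"
  have I: "I \<ge> 0" unfolding I_def by simp
  have VI: "(\<integral>\<^sup>+y. ennreal (norm (V (y - x))) \<partial>lborel) = ennreal I" for x
    unfolding integrable_nn_eq[OF integrable_shift[OF V]] I_def
    using integral_shift[of "\<lambda>y. norm (V y)" "-x"] by simp
  have VI': "(\<integral>\<^sup>+x. ennreal (norm (V (y - x))) \<partial>lborel) = ennreal I" for y
    using nn_integral_shift_reflect[of "\<lambda>x. ennreal (norm (V x))" y] VI[of 0] by simp
  have pt: "ennreal ((norm (cconv V v x))\<^sup>2) \<le> ennreal I * (\<integral>\<^sup>+y. ennreal (norm (V (y - x))) * ennreal ((norm (v y))\<^sup>2) \<partial>lborel)" for x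
  proof -
    have "ennreal (norm (cconv V v x)) \<le> (\<integral>\<^sup>+y. ennreal (norm (V (y - x) * v y)) \<partial>lborel)"
      unfolding cconv_def by (cases "integrable lborel (\<lambda>y. V (y - x) * v y)")
        (auto simp: not_integrable_integral_eq intro: integral_norm_bound_ennreal)
    also have "\<dots> = (\<integral>\<^sup>+y. ennreal (sqrt (norm (V (y - x)))) * ennreal (sqrt (norm (V (y - x))) * norm (v y)) \<partial>lborel)"
      by (intro nn_integral_cong) (simp add: norm_mult flip: ennreal_mult)
    finally have "(ennreal (norm (cconv V v x)))\<^sup>2 \<le> (\<integral>\<^sup>+y. ennreal (sqrt (norm (V (y - x)))) * ennreal (sqrt (norm (V (y - x))) * norm (v y)) \<partial>lborel)\<^sup>2"
      by (rule power_mono) simp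
    also have "\<dots> \<le> (\<integral>\<^sup>+y. (ennreal (sqrt (norm (V (y - x)))))\<^sup>2 \<partial>lborel) * (\<integral>\<^sup>+y. (ennreal (sqrt (norm (V (y - x))) * norm (v y)))\<^sup>2 \<partial>lborel)"
      by (rule Cauchy_Schwarz_nn_integral) measurable
    also have "\<dots> = ennreal I * (\<integral>\<^sup>+y. ennreal (norm (V (y - x))) * ennreal ((norm (v y))\<^sup>2) \<partial>lborel)"
      by (simp add: ennreal_power power_mult_distrib VI flip: ennreal_mult)
    finally show ?thesis by (simp add: ennreal_power)
  qed
  have "(\<integral>\<^sup>+x. ennreal ((norm (cconv V v x))\<^sup>2) \<partial>lborel)
      \<le> (\<integral>\<^sup>+x. ennreal I * (\<integral>\<^sup>+y. ennreal (norm (V (y - x))) * ennreal ((norm (v y))\<^sup>2) \<partial>lborel) \<partial>lborel)"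
    by (intro nn_integral_mono pt)
  also have "\<dots> = ennreal I * (\<integral>\<^sup>+x. (\<integral>\<^sup>+y. ennreal (norm (V (y - x))) * ennreal ((norm (v y))\<^sup>2) \<partial>lborel) \<partial>lborel)"
    by (rule nn_integral_cmult) measurable
  also have "(\<integral>\<^sup>+x. (\<integral>\<^sup>+y. ennreal (norm (V (y - x))) * ennreal ((norm (v y))\<^sup>2) \<partial>lborel) \<partial>lborel)
      = (\<integral>\<^sup>+y. (\<integral>\<^sup>+x. ennreal (norm (V (y - x))) * ennreal ((norm (v y))\<^sup>2) \<partial>lborel) \<partial>lborel)"
    by (rule lborel_pair.Fubini') measurable
  also have "\<dots> = ennreal I * ennreal ((l2 v)\<^sup>2)"
    by (simp add: nn_integral_multc nn_integral_cmult VI' nn_integral_norm_power2[OF v])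
  finally have "(\<integral>\<^sup>+x. ennreal ((norm (cconv V v x))\<^sup>2) \<partial>lborel) \<le> ennreal (I * (I * (l2 v)\<^sup>2))"
    using I by (simp add: ennreal_mult)
  then show ?thesis by (rule sq_integrableI_nn(1)[OF m])
qed

text \<open>The multiplier is an integral of characters \<open>cis (\<xi> * z)\<close> against V z.
  Each character modulates the test function, hence translates its transform by z; translating back
  and integrating over z rebuilds the correlation.\<close>

lemma is_fourier_cconv:
  assumes V: "integrable lborel V" and vg: "is_fourier v g"
  shows "is_fourier (cconv V v) (\<lambda>\<xi>. fourier_L1 V (- \<xi>) * g \<xi>)"
  unfolding is_fourier_def
proof (intro conjI allI impI)
  note v = is_fourierD(1)[OF vg] and g = is_fourierD(2)[OF vg]
  note [measurable] = sq_integrable_measurable[OF v] sq_integrable_measurable[OF g]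
  have Vm [measurable]: "V \<in> borel_measurable borel" using V by auto
  show "sq_integrable (cconv V v)" by (rule sq_integrable_cconv[OF V v])
  show "sq_integrable (\<lambda>\<xi>. fourier_L1 V (- \<xi>) * g \<xi>)"
    by (rule sq_integrable_bounded_mult[OF g, where C="LINT x|lborel. norm (V x)"])
      (auto intro!: norm_fourier_L1_le measurable_compose[OF _ borel_measurable_fourier_L1[OF Vm]])
  fix \<phi> :: "real \<Rightarrow> complex" assume \<phi>: "integrable lborel \<phi> \<and> sq_integrable \<phi>"
  then have [measurable]: "\<phi> \<in> borel_measurable borel" by auto
  define P where "P = fourier_L1 \<phi>"
  have P: "sq_integrable P" unfolding P_def using \<phi> by (intro fourier_L1_L2_bound) auto
  have [measurable]: "P \<in> borel_measurable borel" unfolding P_def by measurable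
  have "(LINT \<xi>|lborel. fourier_L1 V (- \<xi>) * g \<xi> * \<phi> \<xi>) = (LINT \<xi>|lborel. (LINT z|lborel. (g \<xi> * \<phi> \<xi>) * (V z * cis (\<xi> * z))))"
    unfolding fourier_L1_def
    by (intro Bochner_Integration.integral_cong refl) (simp add: mult_ac flip: integral_mult_right_zero)
  also have "\<dots> = (LINT z|lborel. (LINT \<xi>|lborel. (g \<xi> * \<phi> \<xi>) * (V z * cis (\<xi> * z))))"
    by (rule Fubini_lborel(1), measurable, rule nn_integral_product_finite[OF integrable_mult_L2[OF g conjunct2[OF \<phi>]] V])
      (simp add: norm_mult)
  also have "\<dots> = (LINT z|lborel. (LINT w|lborel. V z * v (w + z) * P w))"
  proof (rule Bochner_Integration.integral_cong, rule refl)
    fix z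
    have sc: "sq_integrable (\<lambda>\<xi>. \<phi> \<xi> * cis (z * \<xi>))"
      using \<phi> by - (rule sq_integrable_bound[where g=\<phi> and C=1], auto simp: norm_mult)
    have "(LINT \<xi>|lborel. (g \<xi> * \<phi> \<xi>) * (V z * cis (\<xi> * z))) = V z * (LINT \<xi>|lborel. g \<xi> * (\<phi> \<xi> * cis (z * \<xi>)))"
      by (simp add: mult_ac flip: integral_mult_right_zero)
    also have "(LINT \<xi>|lborel. g \<xi> * (\<phi> \<xi> * cis (z * \<xi>))) = (LINT x|lborel. v x * fourier_L1 (\<lambda>\<xi>. \<phi> \<xi> * cis (z * \<xi>)) x)"
      using \<phi> sc by (intro is_fourierD(3)[OF vg] integrable_cis) auto
    also have "\<dots> = (LINT x|lborel. v x * P (x - z))"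
      by (simp add: fourier_L1_modulation P_def)
    also have "\<dots> = (LINT w|lborel. v (w + z) * P w)"
      using integral_shift[of "\<lambda>x. v x * P (x - z)" z] by simp
    finally show "(LINT \<xi>|lborel. (g \<xi> * \<phi> \<xi>) * (V z * cis (\<xi> * z))) = (LINT w|lborel. V z * v (w + z) * P w)"
      by (simp add: mult.assoc)
  qed
  also have "\<dots> = (LINT w|lborel. (LINT z|lborel. V z * v (w + z) * P w))"
  proof (rule Fubini_lborel(1), measurable)
    \<comment> \<open>Since v and P are only in L2, finiteness comes from Cauchy-Schwarz in w,
      uniformly in z because translation preserves the norm.\<close>
    have "(\<integral>\<^sup>+z. (\<integral>\<^sup>+w. ennreal (norm (V z * v (w + z) * P w)) \<partial>lborel) \<partial>lborel)
        \<le> (\<integral>\<^sup>+z. ennreal (norm (V z)) * ennreal (l2 v * l2 P) \<partial>lborel)"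
    proof (rule nn_integral_mono)
      fix z
      have "(\<integral>\<^sup>+w. ennreal (norm (V z * v (w + z) * P w)) \<partial>lborel) = ennreal (norm (V z)) * (\<integral>\<^sup>+w. ennreal (norm (v (w + z)) * norm (P w)) \<partial>lborel)"
        by (subst nn_integral_cmult[symmetric]) (auto simp: norm_mult mult.assoc simp flip: ennreal_mult)
      also have "\<dots> \<le> ennreal (norm (V z)) * ennreal (l2 v * l2 P)"
        using Cauchy_Schwarz_nn_L2[OF sq_integrable_translate(1)[OF v, of z] P]
        unfolding sq_integrable_translate(2)[OF v] by (rule mult_left_mono) simp
      finally show "(\<integral>\<^sup>+w. ennreal (norm (V z * v (w + z) * P w)) \<partial>lborel) \<le> \<dots>" .
    qed
    also have "\<dots> < \<infinity>"
      by (simp add: nn_integral_multc integrable_nn_eq[OF V] ennreal_mult_less_top)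
    finally show "(\<integral>\<^sup>+z. (\<integral>\<^sup>+w. ennreal (norm (V z * v (w + z) * P w)) \<partial>lborel) \<partial>lborel) < \<infinity>" .
  qed
  also have "\<dots> = (LINT w|lborel. cconv V v w * P w)"
  proof (rule Bochner_Integration.integral_cong, rule refl)
    fix w
    have "cconv V v w = (LINT z|lborel. V z * v (w + z))"
      unfolding cconv_def using integral_shift[of "\<lambda>y. V (y - w) * v y" w] by (simp add: add.commute)
    then show "(LINT z|lborel. V z * v (w + z) * P w) = cconv V v w * P w" by simp
  qed
  finally show "(LINT \<xi>|lborel. fourier_L1 V (- \<xi>) * g \<xi> * \<phi> \<xi>) = (LINT x|lborel. cconv V v x * fourier_L1 \<phi> x)"
    by (simp add: P_def)
qed

subsection \<open>A band limiting kernel\<close>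

definition window :: "real \<Rightarrow> real \<Rightarrow> complex" where
  "window r = indicator {-r..r}"

lemma window_measurable [measurable]: "window r \<in> borel_measurable borel"
  unfolding window_def by measurable

lemma window_L1: "integrable lborel (window r)"
proof -
  have "integrable lborel (\<lambda>x. complex_of_real (indicator {-r..r} x))"
    by (intro integrable_of_real) (simp add: integrable_indicator_iff emeasure_lborel_Icc_eq)
  then show ?thesis
    by (simp add: window_def[abs_def] of_real_indicator)
qed

lemma window_bound: "norm (window r x) \<le> 1"
  by (simp add: window_def indicator_def)

lemma window_L2: "sq_integrable (window r)"
  by (rule sq_integrable_integrable_bounded[OF window_L1 window_bound])

lemma l2_window: "r \<ge> 0 \<Longrightarrow> l2 (window r) = sqrt (2 * r)"
proof -
  assume r: "r \<ge> 0"
  have "(\<lambda>x. (norm (window r x))\<^sup>2) = indicator {-r..r}"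
    by (auto simp: window_def indicator_def)
  then show ?thesis using r by (simp add: l2_def)
qed

text \<open>The trapezoid is written as a convolution of two windows so that its transform is a product of two
  $L^2$ functions, hence integrable with a bound independent of $R$.\<close>

definition trapezoid :: "real \<Rightarrow> real \<Rightarrow> complex" where
  "trapezoid R \<xi> = (LINT \<eta>|lborel. window (3 * R / 2) (\<xi> - \<eta>) * window (R / 2) \<eta>) / R"

lemma trapezoid_measurable [measurable]: "trapezoid R \<in> borel_measurable borel"
  unfolding trapezoid_def[abs_def] by measurable

lemma integral_window: "r \<ge> 0 \<Longrightarrow> (LINT \<eta>|lborel. window r \<eta>) = of_real (2 * r)"
proof -
  assume r: "r \<ge> 0"
  have "(LINT \<eta>|lborel. complex_of_real (indicator {-r..r} \<eta>)) = of_real (2 * r)"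
    using r by (subst integral_complex_of_real) simp
  then show ?thesis
    by (simp add: window_def[abs_def] of_real_indicator)
qed

text \<open>Origin of the widths: for |\<xi>| <= R the narrow window lies inside the shifted wide
  one, since R + R/2 = 3R/2; and the two are disjoint once |\<xi>| exceeds 3R/2 + R/2 = 2R.\<close>

lemma trapezoid_eq_1: "R > 0 \<Longrightarrow> \<bar>\<xi>\<bar> \<le> R \<Longrightarrow> trapezoid R \<xi> = 1"
proof -
  assume R: "R > 0" "\<bar>\<xi>\<bar> \<le> R"
  have "(\<lambda>\<eta>. window (3 * R / 2) (\<xi> - \<eta>) * window (R / 2) \<eta>) = window (R / 2)"
    using R by (auto simp: window_def indicator_def fun_eq_iff)
  then show ?thesis using R by (simp add: trapezoid_def integral_window)
qed

lemma trapezoid_eq_0: "R > 0 \<Longrightarrow> \<bar>\<xi>\<bar> > 2 * R \<Longrightarrow> trapezoid R \<xi> = 0"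
proof -
  assume R: "R > 0" "\<bar>\<xi>\<bar> > 2 * R"
  have "(\<lambda>\<eta>. window (3 * R / 2) (\<xi> - \<eta>) * window (R / 2) \<eta>) = (\<lambda>_. 0)"
    using R by (auto simp: window_def indicator_def fun_eq_iff)
  then show ?thesis using R by (simp add: trapezoid_def)
qed

lemma trapezoid_bound: "R > 0 \<Longrightarrow> norm (trapezoid R \<xi>) \<le> 1"
proof -
  assume R: "R > 0"
  have "norm (LINT \<eta>|lborel. window (3 * R / 2) (\<xi> - \<eta>) * window (R / 2) \<eta>) \<le> (LINT \<eta>|lborel. norm (window (R / 2) \<eta>))"
  proof (rule Bochner_Integration.integral_norm_bound_integral)
    show "integrable lborel (\<lambda>\<eta>. window (3 * R / 2) (\<xi> - \<eta>) * window (R / 2) \<eta>)"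
      by (rule Bochner_Integration.integrable_bound[OF window_L1[of "R / 2"]])
        (auto simp: norm_mult window_def indicator_def)
    show "norm (window (3 * R / 2) (\<xi> - \<eta>) * window (R / 2) \<eta>) \<le> norm (window (R / 2) \<eta>)" for \<eta>
      by (auto simp: norm_mult window_def indicator_def)
  qed (use window_L1 in auto)
  also have "(LINT \<eta>|lborel. norm (window (R / 2) \<eta>)) = R"
  proof -
    have "(\<lambda>\<eta>. norm (window (R / 2) \<eta>)) = indicator {-(R/2)..R/2}"
      by (auto simp: window_def indicator_def)
    then show ?thesis using R by simp
  qed
  finally show ?thesis using R by (simp add: trapezoid_def norm_divide divide_le_eq)
qed

lemma trapezoid_L1: "R > 0 \<Longrightarrow> integrable lborel (trapezoid R)"
proof -
  assume R: "R > 0"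
  have "norm (trapezoid R x) \<le> norm (window (2 * R) x)" for x
    using trapezoid_bound[OF R, of x] trapezoid_eq_0[OF R, of x]
    by (cases "\<bar>x\<bar> > 2 * R") (auto simp: window_def indicator_def)
  then show ?thesis
    by (intro Bochner_Integration.integrable_bound[OF window_L1[of "2 * R"]]) auto
qed

lemma trapezoid_L2: "R > 0 \<Longrightarrow> sq_integrable (trapezoid R)"
  by (rule sq_integrable_integrable_bounded[OF trapezoid_L1 trapezoid_bound])

lemma fourier_L1_trapezoid:
  assumes R: "R > 0"
  shows "fourier_L1 (trapezoid R) x = fourier_L1 (window (3 * R / 2)) x * fourier_L1 (window (R / 2)) x / R"
proof -
  define a b where "a = window (3 * R / 2)" and "b = window (R / 2)"
  have ia: "integrable lborel a" and ib: "integrable lborel b" unfolding a_def b_def by (rule window_L1)+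
  have [measurable]: "a \<in> borel_measurable borel" "b \<in> borel_measurable borel" using ia ib by auto
  have "fourier_L1 (trapezoid R) x = (LINT \<xi>|lborel. (LINT \<eta>|lborel. a (\<xi> - \<eta>) * b \<eta> * cis (- (x * \<xi>)))) / R"
    unfolding fourier_L1_def trapezoid_def a_def b_def by simp
  also have "(LINT \<xi>|lborel. (LINT \<eta>|lborel. a (\<xi> - \<eta>) * b \<eta> * cis (- (x * \<xi>))))
      = (LINT \<eta>|lborel. (LINT \<xi>|lborel. a (\<xi> - \<eta>) * b \<eta> * cis (- (x * \<xi>))))"
  proof (rule Fubini_lborel(1), measurable)
    have "(\<integral>\<^sup>+\<xi>. (\<integral>\<^sup>+\<eta>. ennreal (norm (a (\<xi> - \<eta>) * b \<eta> * cis (- (x * \<xi>)))) \<partial>lborel) \<partial>lborel)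
        = (\<integral>\<^sup>+\<eta>. (\<integral>\<^sup>+\<xi>. ennreal (norm (a (\<xi> - \<eta>) * b \<eta> * cis (- (x * \<xi>)))) \<partial>lborel) \<partial>lborel)"
      by (rule lborel_pair.Fubini') measurable
    also have "\<dots> = (\<integral>\<^sup>+\<eta>. (\<integral>\<^sup>+\<xi>. ennreal (norm (a (\<xi> - \<eta>))) \<partial>lborel) * ennreal (norm (b \<eta>)) \<partial>lborel)"
      by (intro nn_integral_cong) (simp add: norm_mult ennreal_mult nn_integral_multc)
    also have "\<dots> = (\<integral>\<^sup>+\<eta>. ennreal (LINT \<xi>|lborel. norm (a \<xi>)) * ennreal (norm (b \<eta>)) \<partial>lborel)"
      using integral_shift[of "\<lambda>y. norm (a y)" "-_"] by (simp add: integrable_nn_eq[OF integrable_shift[OF ia]])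
    also have "\<dots> < \<infinity>"
      by (simp add: nn_integral_cmult integrable_nn_eq[OF ib] ennreal_mult_less_top)
    finally show "(\<integral>\<^sup>+\<xi>. (\<integral>\<^sup>+\<eta>. ennreal (norm (a (\<xi> - \<eta>) * b \<eta> * cis (- (x * \<xi>)))) \<partial>lborel) \<partial>lborel) < \<infinity>" .
  qed
  also have "\<dots> = (LINT \<eta>|lborel. b \<eta> * fourier_L1 (\<lambda>\<xi>. a (\<xi> - \<eta>)) x)"
    unfolding fourier_L1_def by (simp add: mult_ac flip: integral_mult_right_zero)
  also have "\<dots> = fourier_L1 a x * fourier_L1 b x"
    unfolding fourier_L1_translation fourier_L1_def[of b] by (simp add: mult_ac flip: integral_mult_right_zero)
  finally show ?thesis by (simp add: a_def b_def)
qed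

text \<open>The inverse transform of the trapezoid in the orientation of \<open>cconv\<close>; the
  factor 2 pi is that of the inversion formula.\<close>

definition band_kernel :: "real \<Rightarrow> real \<Rightarrow> complex" where
  "band_kernel R x = fourier_L1 (trapezoid R) x / (2 * pi)"

text \<open>The L2 norms of the two windows are sqrt (3R) and sqrt R, so Cauchy-Schwarz and
  Plancherel give 2 pi sqrt 3 after division by R: the scale cancels. The root of 3 is rounded up to
  2.\<close>

lemma fourier_L1_trapezoid_L1:
  assumes R: "R > 0"
  shows "integrable lborel (fourier_L1 (trapezoid R))"
    and "(LINT x|lborel. norm (fourier_L1 (trapezoid R) x)) \<le> 2 * pi * 2"
proof -
  note F = fourier_L1_L2_bound[OF window_L1 window_L2]
  have eq: "fourier_L1 (trapezoid R) = (\<lambda>x. fourier_L1 (window (3 * R / 2)) x * fourier_L1 (window (R / 2)) x / R)"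
    using fourier_L1_trapezoid[OF R] by auto
  show "integrable lborel (fourier_L1 (trapezoid R))"
    unfolding eq by (intro integrable_divide integrable_mult_L2 F)
  have "(LINT x|lborel. norm (fourier_L1 (trapezoid R) x))
      = (LINT x|lborel. norm (fourier_L1 (window (3 * R / 2)) x) * norm (fourier_L1 (window (R / 2)) x)) / R"
    unfolding eq using R by (simp add: norm_mult norm_divide)
  also have "\<dots> \<le> (l2 (fourier_L1 (window (3 * R / 2))) * l2 (fourier_L1 (window (R / 2)))) / R"
    using R by (intro divide_right_mono Cauchy_Schwarz_norm_L2 F) auto
  also have "\<dots> \<le> ((sqrt (2 * pi) * sqrt (3 * R)) * (sqrt (2 * pi) * sqrt R)) / R"
    using F(2)[of "3 * R / 2"] F(2)[of "R / 2"] R by (intro divide_right_mono mult_mono) (auto simp: l2_window)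
  also have "\<dots> = (sqrt (2 * pi) * sqrt (2 * pi)) * sqrt 3 * ((sqrt R * sqrt R) / R)"
    by (simp add: real_sqrt_mult)
  also have "\<dots> = 2 * pi * sqrt 3"
    using R by simp
  also have "\<dots> \<le> 2 * pi * 2"
    by (intro mult_left_mono real_le_lsqrt) auto
  finally show "(LINT x|lborel. norm (fourier_L1 (trapezoid R) x)) \<le> 2 * pi * 2" .
qed

lemma band_kernel_L1:
  assumes R: "R > 0"
  shows "integrable lborel (band_kernel R)" and "(LINT x|lborel. norm (band_kernel R x)) \<le> 2"
  unfolding band_kernel_def[abs_def]
  using fourier_L1_trapezoid_L1[OF R] by (auto simp: norm_divide divide_le_eq)

text \<open>Inversion identifies L2 classes, so the identity holds almost everywhere, which suffices
  for a multiplier. The sign is absorbed by the reflection of null sets.\<close>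

lemma fourier_L1_band_kernel:
  assumes R: "R > 0"
  shows "AE \<xi> in lborel. fourier_L1 (band_kernel R) (- \<xi>) = trapezoid R \<xi>"
proof -
  define F where "F = fourier_L1 (trapezoid R)"
  have 1: "is_fourier (trapezoid R) F"
    unfolding F_def by (rule is_fourier_L1[OF trapezoid_L1[OF R] trapezoid_L2[OF R]])
  have 2: "is_fourier F (fourier_L1 F)"
    by (rule is_fourier_L1[OF _ is_fourierD(2)[OF 1]]) (simp add: F_def fourier_L1_trapezoid_L1[OF R])
  have [measurable]: "F \<in> borel_measurable borel" by (rule sq_integrable_measurable[OF is_fourierD(2)[OF 1]])
  have "AE x in lborel. fourier_L1 F x = 2 * complex_of_real pi * trapezoid R (- x)"
    by (rule is_fourier_unique[OF 2 is_fourier_inversion[OF 1]])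
  then have "AE x in lborel. fourier_L1 F (0 + (-1) * x) = 2 * complex_of_real pi * trapezoid R (- (0 + (-1) * x))"
    by (intro AE_borel_affine) auto
  then show ?thesis
  proof eventually_elim
    case (elim x)
    have "fourier_L1 (band_kernel R) (- x) = (1 / (2 * complex_of_real pi)) * fourier_L1 F (- x)"
      unfolding fourier_L1_cmult[symmetric] by (simp add: band_kernel_def[abs_def] F_def)
    with elim show ?case by simp
  qed
qed

text \<open>In the second part the shifted kernel is the transform of a modulated trapezoid, and the
  multiplication formula moves it onto g. This represents the band limited function at every point
  as a superposition of waves, as \<open>spectrum_product\<close> requires.\<close>

lemma cconv_band_kernel:
  assumes R: "R > 0" and ug: "is_fourier u g"
  shows "is_fourier (cconv (band_kernel R) u) (\<lambda>\<xi>. trapezoid R \<xi> * g \<xi>)"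
    and "cconv (band_kernel R) u x = (LINT \<xi>|lborel. (trapezoid R \<xi> * g \<xi> / (2 * pi)) * cis (x * \<xi>))"
proof -
  note [measurable] = sq_integrable_measurable[OF is_fourierD(2)[OF ug]]
  have [measurable]: "band_kernel R \<in> borel_measurable borel" using band_kernel_L1[OF R] by auto
  note h = is_fourier_cconv[OF band_kernel_L1(1)[OF R] ug]
  show "is_fourier (cconv (band_kernel R) u) (\<lambda>\<xi>. trapezoid R \<xi> * g \<xi>)"
  proof (rule is_fourier_cong_AE[OF h])
    show "AE \<xi> in lborel. fourier_L1 (band_kernel R) (- \<xi>) * g \<xi> = trapezoid R \<xi> * g \<xi>"
      using fourier_L1_band_kernel[OF R] by eventually_elim simp
    show "cconv (band_kernel R) u \<in> borel_measurable borel"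
      by (rule sq_integrable_measurable[OF is_fourierD(1)[OF h]])
  qed simp_all
  have sc: "sq_integrable (\<lambda>\<xi>. trapezoid R \<xi> * cis (x * \<xi>))"
    using trapezoid_L2[OF R] by - (rule sq_integrable_bound[where g="trapezoid R" and C=1], auto simp: norm_mult)
  have "cconv (band_kernel R) u x = (LINT y|lborel. u y * fourier_L1 (\<lambda>\<xi>. trapezoid R \<xi> * cis (x * \<xi>)) y) / (2 * pi)"
    unfolding cconv_def fourier_L1_modulation band_kernel_def by (simp add: mult.commute)
  also have "\<dots> = (LINT \<xi>|lborel. g \<xi> * (trapezoid R \<xi> * cis (x * \<xi>))) / (2 * pi)"
    by (subst is_fourierD(3)[OF ug]) (auto intro: integrable_cis trapezoid_L1[OF R] sc)
  also have "\<dots> = (LINT \<xi>|lborel. (trapezoid R \<xi> * g \<xi> / (2 * pi)) * cis (x * \<xi>))"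
    by (simp add: mult_ac flip: integral_divide_zero)
  finally show "cconv (band_kernel R) u x = (LINT \<xi>|lborel. (trapezoid R \<xi> * g \<xi> / (2 * pi)) * cis (x * \<xi>))" .
qed

text \<open>Stands in for the convolution theorem. Multiplying w by a wave of frequency \<eta>
  translates its transform by \<eta>, and u is a superposition of waves with |\<eta>| <= a, so the
  spectrum of the product stays within a + b. It is tested against Gaussian waves cut off to the
  complement of that interval.\<close>

lemma spectrum_product:
  assumes \<Gamma>: "integrable lborel \<Gamma>" and \<Gamma>0: "\<And>\<eta>. \<bar>\<eta>\<bar> > a \<Longrightarrow> \<Gamma> \<eta> = 0"
    and u: "\<And>x. u x = (LINT \<eta>|lborel. \<Gamma> \<eta> * cis (x * \<eta>))"
    and wH: "is_fourier w H" and H0: "\<And>\<xi>. \<bar>\<xi>\<bar> > b \<Longrightarrow> H \<xi> = 0"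
    and k: "is_fourier (\<lambda>x. u x * w x) k"
  shows "AE \<xi> in lborel. \<bar>\<xi>\<bar> > a + b \<longrightarrow> k \<xi> = 0"
proof -
  note [measurable] = sq_integrable_measurable[OF is_fourierD(1)[OF wH]] sq_integrable_measurable[OF is_fourierD(2)[OF k]]
  have [measurable]: "\<Gamma> \<in> borel_measurable borel" using \<Gamma> by auto
  define I :: "real \<Rightarrow> complex" where "I \<xi> = (if \<bar>\<xi>\<bar> > a + b then 1 else 0)" for \<xi>
  have [measurable]: "I \<in> borel_measurable borel" unfolding I_def by measurable
  have In: "norm (I \<xi>) \<le> 1" for \<xi> by (simp add: I_def)
  have "AE \<xi> in lborel. I \<xi> * k \<xi> = 0"
  proof (rule gauss_wave_eq_zero)
    show "sq_integrable (\<lambda>\<xi>. I \<xi> * k \<xi>)"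
      by (rule sq_integrable_bounded_mult[OF is_fourierD(2)[OF k], where C=1]) (auto simp: In)
    fix c
    define \<phi> where "\<phi> \<xi> = I \<xi> * gauss_wave c \<xi>" for \<xi>
    have [measurable]: "\<phi> \<in> borel_measurable borel" unfolding \<phi>_def by measurable
    have s\<phi>: "sq_integrable \<phi>" unfolding \<phi>_def
      by (rule sq_integrable_bounded_mult[OF sq_integrable_gauss_wave, where C=1]) (auto simp: In)
    have i\<phi>: "integrable lborel \<phi>"
      by (rule Bochner_Integration.integrable_bound[OF integrable_gauss_wave[of c]])
        (auto simp: \<phi>_def norm_mult I_def)
    define P where "P = fourier_L1 \<phi>"
    have [measurable]: "P \<in> borel_measurable borel" unfolding P_def by measurable
    have sP: "sq_integrable P" unfolding P_def by (rule fourier_L1_L2_bound[OF i\<phi> s\<phi>])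
    have "(LINT \<xi>|lborel. I \<xi> * k \<xi> * gauss_wave c \<xi>) = (LINT \<xi>|lborel. k \<xi> * \<phi> \<xi>)"
      by (simp add: \<phi>_def mult_ac)
    also have "\<dots> = (LINT x|lborel. u x * w x * P x)"
      unfolding P_def by (rule is_fourierD(3)[OF k i\<phi> s\<phi>])
    also have "\<dots> = (LINT x|lborel. (LINT \<eta>|lborel. (w x * P x) * (\<Gamma> \<eta> * cis (x * \<eta>))))"
      unfolding u by (intro Bochner_Integration.integral_cong refl) (simp add: mult_ac flip: integral_mult_right_zero)
    also have "\<dots> = (LINT \<eta>|lborel. (LINT x|lborel. (w x * P x) * (\<Gamma> \<eta> * cis (x * \<eta>))))"
      by (rule Fubini_lborel(1), measurable, rule nn_integral_product_finite[OF integrable_mult_L2[OF is_fourierD(1)[OF wH] sP] \<Gamma>])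
        (auto simp: norm_mult)
    also have "\<dots> = (LINT \<eta>|(lborel::real measure). (0::complex))"
    proof (rule Bochner_Integration.integral_cong, rule refl)
      fix \<eta> :: real
      define \<phi>' where "\<phi>' \<xi> = \<phi> (\<xi> - (- \<eta>))" for \<xi>
      have "fourier_L1 \<phi>' x = cis (x * \<eta>) * P x" for x
        unfolding \<phi>'_def fourier_L1_translation P_def by (simp add: mult.commute)
      then have "(LINT x|lborel. (w x * P x) * (\<Gamma> \<eta> * cis (x * \<eta>))) = \<Gamma> \<eta> * (LINT x|lborel. w x * fourier_L1 \<phi>' x)"
        by (simp add: mult_ac flip: integral_mult_right_zero)
      also have "(LINT x|lborel. w x * fourier_L1 \<phi>' x) = (LINT \<xi>|lborel. H \<xi> * \<phi>' \<xi>)"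
        unfolding \<phi>'_def
        by (rule is_fourierD(3)[OF wH, symmetric])
          (use integrable_shift[OF i\<phi>, of "-\<eta>"] sq_integrable_translate(1)[OF s\<phi>, of \<eta>] in auto)
      also have "\<Gamma> \<eta> * \<dots> = 0"
      proof (cases "\<bar>\<eta>\<bar> > a")
        case False
        \<comment> \<open>The shifted test function is supported where |\<xi> + \<eta>| > a + b;
          with |\<eta>| <= a this forces |\<xi>| > b, where H vanishes.\<close>
        have "(\<lambda>\<xi>. H \<xi> * \<phi>' \<xi>) = (\<lambda>\<xi>. 0)"
        proof
          show "H \<xi> * \<phi>' \<xi> = 0" for \<xi>
            using H0[of \<xi>] False by (cases "\<bar>\<xi>\<bar> > b") (auto simp: \<phi>'_def \<phi>_def I_def)
        qed
        then show ?thesis by (simp only: integral_zero mult_zero_right)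
      qed (simp add: \<Gamma>0)
      finally show "(LINT x|lborel. (w x * P x) * (\<Gamma> \<eta> * cis (x * \<eta>))) = 0" .
    qed
    finally show "(LINT \<xi>|lborel. I \<xi> * k \<xi> * gauss_wave c \<xi>) = 0" by simp
  qed
  then show ?thesis by eventually_elim (auto simp: I_def split: if_splits)
qed

subsection \<open>The product estimate in Sobolev spaces\<close>

definition tail :: "real \<Rightarrow> (real \<Rightarrow> complex) \<Rightarrow> real \<Rightarrow> complex" where
  "tail R g \<xi> = indicator {\<xi>. \<bar>\<xi>\<bar> > R} \<xi> * g \<xi>"

lemma tail_measurable [measurable]:
  assumes [measurable]: "g \<in> borel_measurable borel"
  shows "tail R g \<in> borel_measurable borel"
  unfolding tail_def[abs_def] by measurable

lemma sq_integrable_tail: "sq_integrable g \<Longrightarrow> sq_integrable (tail R g)"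
  unfolding tail_def[abs_def] by (rule sq_integrable_bounded_mult[where C=1]) (auto simp: indicator_def)

text \<open>The trapezoid is 1 on [-R, R], so only the tail of g contributes, and there the
  multiplier 1 minus trapezoid is at most 2 in modulus.\<close>

lemma l2_band_error:
  assumes R: "R > 0" and ug: "is_fourier u g"
  shows "sqrt (2 * pi) * l2 (\<lambda>x. u x - cconv (band_kernel R) u x) \<le> 2 * l2 (tail R g)"
proof -
  note g = is_fourierD(2)[OF ug]
  note [measurable] = sq_integrable_measurable[OF g]
  have F: "is_fourier (\<lambda>x. u x - cconv (band_kernel R) u x) (\<lambda>\<xi>. g \<xi> - trapezoid R \<xi> * g \<xi>)"
    by (rule is_fourier_diff[OF ug cconv_band_kernel(1)[OF R ug]])
  have "norm (g \<xi> - trapezoid R \<xi> * g \<xi>) \<le> 2 * norm (tail R g \<xi>)" for \<xi>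
  proof (cases "\<bar>\<xi>\<bar> > R")
    case True
    have "norm (g \<xi> - trapezoid R \<xi> * g \<xi>) \<le> norm (g \<xi>) + norm (trapezoid R \<xi>) * norm (g \<xi>)"
      using norm_triangle_ineq4[of "g \<xi>" "trapezoid R \<xi> * g \<xi>"] by (simp add: norm_mult)
    also have "\<dots> \<le> norm (g \<xi>) + 1 * norm (g \<xi>)"
      by (intro add_left_mono mult_right_mono trapezoid_bound R) simp
    finally show ?thesis using True by (simp add: tail_def)
  qed (simp add: trapezoid_eq_1[OF R] tail_def)
  then have "l2 (\<lambda>\<xi>. g \<xi> - trapezoid R \<xi> * g \<xi>) \<le> 2 * l2 (tail R g)"
    by (intro l2_mono sq_integrable_tail g) auto
  with is_fourier_bound'[OF F] show ?thesis by simp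
qed

text \<open>The constants are not symmetric because the splitting is not: v is bounded by B, but the
  band limited U only by 2A, and each band error contributes a further factor 2. The factors sqrt (2
  pi) of the upper and lower Plancherel bounds cancel.\<close>

lemma tail_product:
  assumes ug: "is_fourier u g" and vh: "is_fourier v h" and k: "is_fourier (\<lambda>x. u x * v x) k"
    and A: "AE x in lborel. norm (u x) \<le> A" and B: "AE x in lborel. norm (v x) \<le> B"
    and A0: "A \<ge> 0" and B0: "B \<ge> 0" and R: "R > 0"
  shows "l2 (tail (4 * R) k) \<le> 2 * B * l2 (tail R g) + 4 * A * l2 (tail R h)"
proof -
  note u = is_fourierD(1)[OF ug] and v = is_fourierD(1)[OF vh]
  note g = is_fourierD(2)[OF ug] and h = is_fourierD(2)[OF vh]
  note [measurable] = sq_integrable_measurable[OF u] sq_integrable_measurable[OF v]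
    sq_integrable_measurable[OF g] sq_integrable_measurable[OF h] sq_integrable_measurable[OF is_fourierD(2)[OF k]]
  define U where "U = cconv (band_kernel R) u"
  define W where "W = cconv (band_kernel R) v"
  note FU = cconv_band_kernel(1)[OF R ug, folded U_def] and FW = cconv_band_kernel(1)[OF R vh, folded W_def]
  note [measurable] = sq_integrable_measurable[OF is_fourierD(1)[OF FU]] sq_integrable_measurable[OF is_fourierD(1)[OF FW]]
  have Ub: "norm (U x) \<le> 2 * A" for x
  proof -
    have "norm (U x) \<le> (LINT y|lborel. norm (band_kernel R y)) * A"
      unfolding U_def cconv_def by (rule integrable_conv(2)[OF band_kernel_L1(1)[OF R] _ A]) measurable
    also have "\<dots> \<le> 2 * A" by (intro mult_right_mono band_kernel_L1(2) R A0)
    finally show ?thesis .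
  qed
  have sUW: "sq_integrable (\<lambda>x. U x * W x)"
    by (rule sq_integrable_bounded_mult[OF is_fourierD(1)[OF FW], where C="2*A"]) (auto simp: Ub)
  obtain kR where kR: "is_fourier (\<lambda>x. U x * W x) kR"
    using fourier_exists[OF sUW] by auto
  note [measurable] = sq_integrable_measurable[OF is_fourierD(2)[OF kR]]
  have "AE \<xi> in lborel. \<bar>\<xi>\<bar> > 2 * R + 2 * R \<longrightarrow> kR \<xi> = 0"
  proof (rule spectrum_product[OF _ _ _ FW _ kR])
    show "integrable lborel (\<lambda>\<xi>. trapezoid R \<xi> * g \<xi> / (2 * pi))"
      by (intro integrable_divide integrable_mult_L2 trapezoid_L2 R g)
    show "U x = (LINT \<eta>|lborel. trapezoid R \<eta> * g \<eta> / (2 * pi) * cis (x * \<eta>))" for x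
      unfolding U_def by (rule cconv_band_kernel(2)[OF R ug])
  qed (auto simp: trapezoid_eq_0[OF R])
  then have AE: "AE \<xi> in lborel. tail (4 * R) k \<xi> = indicator {\<xi>. \<bar>\<xi>\<bar> > 4 * R} \<xi> * (k \<xi> - kR \<xi>)"
    by eventually_elim (auto simp: tail_def indicator_def)
  have skk: "sq_integrable (\<lambda>\<xi>. k \<xi> - kR \<xi>)"
    by (intro sq_integrable_diff is_fourierD(2)[OF k] is_fourierD(2)[OF kR])
  have su: "sq_integrable (\<lambda>x. u x - U x)" and sv: "sq_integrable (\<lambda>x. v x - W x)"
    by (intro sq_integrable_diff u v is_fourierD(1)[OF FU] is_fourierD(1)[OF FW])+
  have s1: "sq_integrable (\<lambda>x. v x * (u x - U x))"
    by (rule sq_integrable_bounded_mult[OF su _ B]) simp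
  have s2: "sq_integrable (\<lambda>x. U x * (v x - W x))"
    by (rule sq_integrable_bounded_mult[OF sv, where C="2*A"]) (auto simp: Ub)
  have "l2 (tail (4 * R) k) = l2 (\<lambda>\<xi>. indicator {\<xi>. \<bar>\<xi>\<bar> > 4 * R} \<xi> * (k \<xi> - kR \<xi>))"
    using AE by (intro l2_cong_AE) auto
  also have "\<dots> \<le> 1 * l2 (\<lambda>\<xi>. k \<xi> - kR \<xi>)"
    by (rule l2_bounded_mult[OF skk]) (auto simp: indicator_def)
  also have "\<dots> \<le> sqrt (2 * pi) * l2 (\<lambda>x. u x * v x - U x * W x)"
    using is_fourier_bound[OF is_fourier_diff[OF k kR]] by simp
  also have "(\<lambda>x. u x * v x - U x * W x) = (\<lambda>x. v x * (u x - U x) + U x * (v x - W x))"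
    by (simp add: algebra_simps)
  also have "sqrt (2 * pi) * l2 (\<lambda>x. v x * (u x - U x) + U x * (v x - W x))
      \<le> sqrt (2 * pi) * (B * l2 (\<lambda>x. u x - U x) + 2 * A * l2 (\<lambda>x. v x - W x))"
  proof (rule mult_left_mono)
    have "l2 (\<lambda>x. v x * (u x - U x)) \<le> B * l2 (\<lambda>x. u x - U x)"
      by (rule l2_bounded_mult[OF su _ B B0]) simp
    moreover have "l2 (\<lambda>x. U x * (v x - W x)) \<le> 2 * A * l2 (\<lambda>x. v x - W x)"
      by (rule l2_bounded_mult[OF sv]) (auto simp: Ub A0)
    ultimately show "l2 (\<lambda>x. v x * (u x - U x) + U x * (v x - W x)) \<le> B * l2 (\<lambda>x. u x - U x) + 2 * A * l2 (\<lambda>x. v x - W x)"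
      using l2_triangle[OF s1 s2] by simp
  qed simp
  also have "\<dots> = B * (sqrt (2 * pi) * l2 (\<lambda>x. u x - U x)) + 2 * A * (sqrt (2 * pi) * l2 (\<lambda>x. v x - W x))"
    by (simp add: algebra_simps)
  also have "\<dots> \<le> B * (2 * l2 (tail R g)) + 2 * A * (2 * l2 (tail R h))"
    unfolding U_def W_def using A0 B0
    by (intro add_mono mult_left_mono l2_band_error R ug vh) auto
  finally show ?thesis by (simp add: algebra_simps)
qed

section \<open>From spectral tails to the weighted norm\<close>

lemma nn_integral_powr:
  assumes s: "s > 0" and a: "a \<ge> 0"
  shows "(\<integral>\<^sup>+R. ennreal (2 * s * R powr (2 * s - 1)) * indicator {0<..<a} R \<partial>lborel) = ennreal (a powr (2 * s))"
proof -
  \<comment> \<open>The density is unbounded at 0 when s < 1/2 but remains integrable, as its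
    exponent exceeds -1 for s > 0.\<close>
  have "((\<lambda>x. 2 * s * x powr (2 * s - 1)) has_integral (2 * s * (a powr (2 * s - 1 + 1) / (2 * s - 1 + 1)))) {0..a}"
    using s a by (intro has_integral_mult_right has_integral_powr_from_0) auto
  then have "((\<lambda>x. 2 * s * x powr (2 * s - 1)) has_integral a powr (2 * s)) {0..a}"
    using s by simp
  from nn_integral_has_integral_lebesgue'[OF _ this]
  have "(\<integral>\<^sup>+R. ennreal (2 * s * R powr (2 * s - 1)) * indicator {0..a} R \<partial>lborel) = ennreal (a powr (2 * s))"
    using s by simp
  moreover have "(\<integral>\<^sup>+R. ennreal (2 * s * R powr (2 * s - 1)) * indicator {0<..<a} R \<partial>lborel)
      = (\<integral>\<^sup>+R. ennreal (2 * s * R powr (2 * s - 1)) * indicator {0..a} R \<partial>lborel)"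
  proof (rule nn_integral_cong_AE)
    have "AE R in lborel. R \<noteq> (0::real)" "AE R in lborel. R \<noteq> a"
      by (rule AE_lborel_singleton)+
    then show "AE R in lborel. ennreal (2 * s * R powr (2 * s - 1)) * indicator {0<..<a} R = ennreal (2 * s * R powr (2 * s - 1)) * indicator {0..a} R"
      by eventually_elim (auto simp: indicator_def)
  qed
  ultimately show ?thesis by simp
qed

text \<open>A frequency lies in the tail beyond c R exactly when R < |\<xi>| / c, so Tonelli weights
  it with the integral of the density up to that point. The dilation c is 1 for the factors and 4
  for their product.\<close>

lemma layer_cake_tail:
  assumes s: "s > 0" and c: "c > 0" and g: "sq_integrable g"
  shows "(\<integral>\<^sup>+R. ennreal (2 * s * R powr (2 * s - 1)) * indicator {0<..} R * ennreal ((l2 (tail (c * R) g))\<^sup>2) \<partial>lborel)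
    = (\<integral>\<^sup>+\<xi>. ennreal ((\<bar>\<xi>\<bar> / c) powr (2 * s)) * ennreal ((norm (g \<xi>))\<^sup>2) \<partial>lborel)"
proof -
  note [measurable] = sq_integrable_measurable[OF g]
  define w where "w R = ennreal (2 * s * R powr (2 * s - 1)) * indicator {0<..} R" for R
  have [measurable]: "w \<in> borel_measurable borel" unfolding w_def by measurable
  have "(\<integral>\<^sup>+R. w R * ennreal ((l2 (tail (c * R) g))\<^sup>2) \<partial>lborel)
      = (\<integral>\<^sup>+R. (\<integral>\<^sup>+\<xi>. w R * (indicator {\<xi>. \<bar>\<xi>\<bar> > c * R} \<xi> * ennreal ((norm (g \<xi>))\<^sup>2)) \<partial>lborel) \<partial>lborel)"
  proof (intro nn_integral_cong)
    fix R
    have "ennreal ((l2 (tail (c * R) g))\<^sup>2) = (\<integral>\<^sup>+\<xi>. ennreal ((norm (tail (c * R) g \<xi>))\<^sup>2) \<partial>lborel)"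
      by (rule nn_integral_norm_power2[symmetric, OF sq_integrable_tail[OF g]])
    also have "\<dots> = (\<integral>\<^sup>+\<xi>. indicator {\<xi>. \<bar>\<xi>\<bar> > c * R} \<xi> * ennreal ((norm (g \<xi>))\<^sup>2) \<partial>lborel)"
      by (intro nn_integral_cong) (auto simp: tail_def indicator_def)
    finally show "w R * ennreal ((l2 (tail (c * R) g))\<^sup>2) = (\<integral>\<^sup>+\<xi>. w R * (indicator {\<xi>. \<bar>\<xi>\<bar> > c * R} \<xi> * ennreal ((norm (g \<xi>))\<^sup>2)) \<partial>lborel)"
      by (simp add: nn_integral_cmult)
  qed
  also have "\<dots> = (\<integral>\<^sup>+\<xi>. (\<integral>\<^sup>+R. w R * (indicator {\<xi>. \<bar>\<xi>\<bar> > c * R} \<xi> * ennreal ((norm (g \<xi>))\<^sup>2)) \<partial>lborel) \<partial>lborel)"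
    by (rule lborel_pair.Fubini'[symmetric]) measurable
  also have "\<dots> = (\<integral>\<^sup>+\<xi>. ennreal ((\<bar>\<xi>\<bar> / c) powr (2 * s)) * ennreal ((norm (g \<xi>))\<^sup>2) \<partial>lborel)"
  proof (intro nn_integral_cong)
    fix \<xi> :: real
    have "w R * (indicator {\<xi>. \<bar>\<xi>\<bar> > c * R} \<xi> * ennreal ((norm (g \<xi>))\<^sup>2))
        = (ennreal (2 * s * R powr (2 * s - 1)) * indicator {0<..<\<bar>\<xi>\<bar> / c} R) * ennreal ((norm (g \<xi>))\<^sup>2)" for R
      using c by (auto simp: w_def indicator_def field_simps)
    then have "(\<integral>\<^sup>+R. w R * (indicator {\<xi>. \<bar>\<xi>\<bar> > c * R} \<xi> * ennreal ((norm (g \<xi>))\<^sup>2)) \<partial>lborel)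
      = (\<integral>\<^sup>+R. (ennreal (2 * s * R powr (2 * s - 1)) * indicator {0<..<\<bar>\<xi>\<bar> / c} R) * ennreal ((norm (g \<xi>))\<^sup>2) \<partial>lborel)"
      by simp
    also have "\<dots> = (\<integral>\<^sup>+R. ennreal (2 * s * R powr (2 * s - 1)) * indicator {0<..<\<bar>\<xi>\<bar> / c} R \<partial>lborel) * ennreal ((norm (g \<xi>))\<^sup>2)"
      by (rule nn_integral_multc) measurable
    also have "\<dots> = ennreal ((\<bar>\<xi>\<bar> / c) powr (2 * s)) * ennreal ((norm (g \<xi>))\<^sup>2)"
      using c by (subst nn_integral_powr[OF s]) auto
    finally show "(\<integral>\<^sup>+R. w R * (indicator {\<xi>. \<bar>\<xi>\<bar> > c * R} \<xi> * ennreal ((norm (g \<xi>))\<^sup>2)) \<partial>lborel) = \<dots>" .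
  qed
  finally show ?thesis by (simp add: w_def)
qed

text \<open>The exponent is halved so that the square has the Sobolev weight: the H^s norm becomes a
  plain \<open>l2\<close> norm, to which Minkowski and the results on series apply directly.\<close>

definition bessel :: "real \<Rightarrow> (real \<Rightarrow> complex) \<Rightarrow> real \<Rightarrow> complex" where
  "bessel s g \<xi> = complex_of_real ((1 + \<xi>\<^sup>2) powr (s / 2)) * g \<xi>"

lemma bessel_measurable [measurable]:
  assumes [measurable]: "g \<in> borel_measurable borel"
  shows "bessel s g \<in> borel_measurable borel"
  unfolding bessel_def[abs_def] by measurable

lemma one_plus_sq_pos: "(0::real) < 1 + \<xi>\<^sup>2"
  using zero_le_power2[of \<xi>] by linarith

lemma norm_bessel: "(norm (bessel s g \<xi>))\<^sup>2 = (1 + \<xi>\<^sup>2) powr s * (norm (g \<xi>))\<^sup>2"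
proof -
  have "((1 + \<xi>\<^sup>2) powr (s / 2))\<^sup>2 = (1 + \<xi>\<^sup>2) powr s"
    using one_plus_sq_pos[of \<xi>] by (simp add: power2_eq_square powr_add[symmetric])
  then show ?thesis by (simp add: bessel_def norm_mult power_mult_distrib)
qed

lemma abs_powr_double: "\<bar>\<xi>\<bar> powr (2 * s) = (\<xi>\<^sup>2) powr s" for \<xi> s :: real
proof -
  have "\<bar>\<xi>\<bar> powr (2 * s) = (\<bar>\<xi>\<bar> powr 2) powr s" by (simp only: powr_powr)
  also have "\<dots> = (\<xi>\<^sup>2) powr s" by (cases "\<xi> = 0") (auto simp: powr_numeral)
  finally show ?thesis .
qed

lemma abs_powr_le_bessel_weight: "s > 0 \<Longrightarrow> \<bar>\<xi>\<bar> powr (2 * s) \<le> (1 + \<xi>\<^sup>2) powr s" for \<xi> s :: real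
  unfolding abs_powr_double by (intro powr_mono2) auto

lemma bessel_weight_le:
  fixes s \<xi> :: real
  assumes "s > 0"
  shows "(1 + \<xi>\<^sup>2) powr s \<le> 2 powr s * (1 + \<bar>\<xi>\<bar> powr (2 * s))"
proof -
  have "(1 + \<xi>\<^sup>2) powr s \<le> (2 * max 1 (\<xi>\<^sup>2)) powr s"
    using assms by (intro powr_mono2) auto
  also have "\<dots> = 2 powr s * (max 1 (\<xi>\<^sup>2)) powr s" by (simp add: powr_mult)
  also have "\<dots> \<le> 2 powr s * (1 + (\<xi>\<^sup>2) powr s)"
    by (intro mult_left_mono) (auto simp: max_def)
  finally show ?thesis by (simp add: abs_powr_double)
qed

lemma bessel_weight_ge_1: "(s::real) > 0 \<Longrightarrow> 1 \<le> (1 + \<xi>\<^sup>2) powr (s / 2)" for \<xi> :: real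
  by (rule ge_one_powr_ge_zero) auto

lemma sq_integrable_bessel:
  assumes s: "s > 0" and g: "g \<in> borel_measurable borel" and b: "sq_integrable (bessel s g)"
  shows "sq_integrable g" and "l2 g \<le> l2 (bessel s g)"
proof -
  have le: "norm (g \<xi>) \<le> 1 * norm (bessel s g \<xi>)" for \<xi>
    using mult_right_mono[OF bessel_weight_ge_1[OF s, of \<xi>], of "norm (g \<xi>)"] by (simp add: bessel_def norm_mult)
  show "sq_integrable g" by (rule sq_integrable_bound[OF g b, of 1]) (use le in auto)
  show "l2 g \<le> l2 (bessel s g)" using l2_mono[OF g b, of 1] le by auto
qed

text \<open>The factor 2^s comes from splitting the weight, 4^(2s) from the dilation of the tail by
  4, and 32 is twice the square of the larger constant in \<open>tail_product\<close>. The summand 1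
  accounts for the unweighted L2 norm.\<close>

definition prod_const :: "real \<Rightarrow> real" where
  "prod_const s = sqrt (2 powr s * (1 + 32 * 4 powr (2 * s)))"

lemma prod_const_nonneg: "prod_const s \<ge> 0"
  by (simp add: prod_const_def)

lemma bessel_product:
  assumes s: "s > 0" and ug: "is_fourier u g" and vh: "is_fourier v h" and k: "is_fourier (\<lambda>x. u x * v x) k"
    and A: "AE x in lborel. norm (u x) \<le> A" and B: "AE x in lborel. norm (v x) \<le> B"
    and A0: "A \<ge> 0" and B0: "B \<ge> 0"
    and bg: "sq_integrable (bessel s g)" and bh: "sq_integrable (bessel s h)"
  shows "sq_integrable (bessel s k)"
    and "l2 (bessel s k) \<le> prod_const s * (B * l2 (bessel s g) + A * l2 (bessel s h))"
proof -
  note u = is_fourierD(1)[OF ug] and v = is_fourierD(1)[OF vh]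
  note g = is_fourierD(2)[OF ug] and h = is_fourierD(2)[OF vh] and sk = is_fourierD(2)[OF k]
  note [measurable] = sq_integrable_measurable[OF u] sq_integrable_measurable[OF v]
    sq_integrable_measurable[OF g] sq_integrable_measurable[OF h] sq_integrable_measurable[OF sk]
  define X where "X = l2 (bessel s g)"
  define Y where "Y = l2 (bessel s h)"
  have XY: "X \<ge> 0" "Y \<ge> 0" by (auto simp: X_def Y_def)
  define w where "w R = ennreal (2 * s * R powr (2 * s - 1)) * indicator {0<..} R" for R
  have [measurable]: "w \<in> borel_measurable borel" unfolding w_def by measurable
  \<comment> \<open>For the factors the tails add up to the homogeneous weight |\<xi>|^(2s), which
    the full weight dominates.\<close>
  have hom: "(\<integral>\<^sup>+R. w R * ennreal ((l2 (tail R f))\<^sup>2) \<partial>lborel) \<le> ennreal ((l2 (bessel s f))\<^sup>2)"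
    if f: "sq_integrable f" "sq_integrable (bessel s f)" for f
  proof -
    note [measurable] = sq_integrable_measurable[OF f(1)]
    have "(\<integral>\<^sup>+R. w R * ennreal ((l2 (tail R f))\<^sup>2) \<partial>lborel) = (\<integral>\<^sup>+\<xi>. ennreal (\<bar>\<xi>\<bar> powr (2 * s)) * ennreal ((norm (f \<xi>))\<^sup>2) \<partial>lborel)"
      using layer_cake_tail[OF s zero_less_one f(1)] by (simp add: w_def)
    also have "\<dots> \<le> (\<integral>\<^sup>+\<xi>. ennreal ((norm (bessel s f \<xi>))\<^sup>2) \<partial>lborel)"
      unfolding norm_bessel
      by (intro nn_integral_mono) (auto simp flip: ennreal_mult intro!: ennreal_leI mult_right_mono abs_powr_le_bessel_weight s)
    also have "\<dots> = ennreal ((l2 (bessel s f))\<^sup>2)" by (rule nn_integral_norm_power2[OF f(2)])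
    finally show ?thesis .
  qed
  have tail_meas: "(\<lambda>R. w R * ennreal ((l2 (tail R f))\<^sup>2)) \<in> borel_measurable borel" if f: "sq_integrable f" for f
  proof -
    note [measurable] = sq_integrable_measurable[OF f]
    have "(\<lambda>R. l2 (tail R f)) \<in> borel_measurable borel"
      unfolding l2_def tail_def by measurable
    then show ?thesis by measurable
  qed
  note [measurable] = tail_meas[OF g] tail_meas[OF h]
  have "(\<integral>\<^sup>+\<xi>. ennreal ((\<bar>\<xi>\<bar> / 4) powr (2 * s)) * ennreal ((norm (k \<xi>))\<^sup>2) \<partial>lborel)
      = (\<integral>\<^sup>+R. w R * ennreal ((l2 (tail (4 * R) k))\<^sup>2) \<partial>lborel)"
    unfolding w_def by (rule layer_cake_tail[symmetric]) (use s sk in auto)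
  also have "\<dots> \<le> (\<integral>\<^sup>+R. ennreal (8 * B\<^sup>2) * (w R * ennreal ((l2 (tail R g))\<^sup>2)) + ennreal (32 * A\<^sup>2) * (w R * ennreal ((l2 (tail R h))\<^sup>2)) \<partial>lborel)"
  proof (intro nn_integral_mono)
    fix R :: real
    show "w R * ennreal ((l2 (tail (4 * R) k))\<^sup>2) \<le> ennreal (8 * B\<^sup>2) * (w R * ennreal ((l2 (tail R g))\<^sup>2)) + ennreal (32 * A\<^sup>2) * (w R * ennreal ((l2 (tail R h))\<^sup>2))"
    proof (cases "R > 0")
      case True
      define a where "a = 2 * B * l2 (tail R g)"
      define b where "b = 4 * A * l2 (tail R h)"
      have "l2 (tail (4 * R) k) \<le> a + b"
        unfolding a_def b_def by (rule tail_product[OF ug vh k A B A0 B0 True])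
      then have "(l2 (tail (4 * R) k))\<^sup>2 \<le> (a + b)\<^sup>2" by (rule power_mono) simp
      also have "\<dots> \<le> 2 * a\<^sup>2 + 2 * b\<^sup>2" using sum_squares_bound[of a b] by (simp add: power2_sum)
      also have "\<dots> = 8 * B\<^sup>2 * (l2 (tail R g))\<^sup>2 + 32 * A\<^sup>2 * (l2 (tail R h))\<^sup>2"
        by (simp add: a_def b_def power_mult_distrib)
      finally have "ennreal ((l2 (tail (4 * R) k))\<^sup>2) \<le> ennreal (8 * B\<^sup>2) * ennreal ((l2 (tail R g))\<^sup>2) + ennreal (32 * A\<^sup>2) * ennreal ((l2 (tail R h))\<^sup>2)"
        by (simp add: ennreal_leI flip: ennreal_mult ennreal_plus)
      from mult_left_mono[OF this, of "w R"] show ?thesis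
        by (simp add: distrib_left mult_ac)
    qed (simp add: w_def)
  qed
  also have "\<dots> = ennreal (8 * B\<^sup>2) * (\<integral>\<^sup>+R. w R * ennreal ((l2 (tail R g))\<^sup>2) \<partial>lborel) + ennreal (32 * A\<^sup>2) * (\<integral>\<^sup>+R. w R * ennreal ((l2 (tail R h))\<^sup>2) \<partial>lborel)"
    by (simp add: nn_integral_add nn_integral_cmult)
  also have "\<dots> \<le> ennreal (8 * B\<^sup>2) * ennreal (X\<^sup>2) + ennreal (32 * A\<^sup>2) * ennreal (Y\<^sup>2)"
    unfolding X_def Y_def by (intro add_mono mult_left_mono hom g h bg bh) auto
  also have "\<dots> = ennreal (8 * B\<^sup>2 * X\<^sup>2 + 32 * A\<^sup>2 * Y\<^sup>2)"
    by (simp flip: ennreal_mult ennreal_plus)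
  finally have hk: "(\<integral>\<^sup>+\<xi>. ennreal ((\<bar>\<xi>\<bar> / 4) powr (2 * s)) * ennreal ((norm (k \<xi>))\<^sup>2) \<partial>lborel) \<le> \<dots>" .
  \<comment> \<open>The tails control only a weight that degenerates at frequency 0. The missing
    constant part of the weight is the L2 norm of k, bounded through |u v| <= B |u|.\<close>
  have lk: "(\<integral>\<^sup>+\<xi>. ennreal ((norm (k \<xi>))\<^sup>2) \<partial>lborel) \<le> ennreal (B\<^sup>2 * X\<^sup>2)"
  proof -
    have "l2 k \<le> sqrt (2 * pi) * l2 (\<lambda>x. v x * u x)"
      using is_fourier_bound[OF k] by (simp add: mult.commute)
    also have "l2 (\<lambda>x. v x * u x) \<le> B * l2 u"
      by (rule l2_bounded_mult[OF u _ B B0]) simp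
    also have "sqrt (2 * pi) * (B * l2 u) = B * (sqrt (2 * pi) * l2 u)" by simp
    also have "\<dots> \<le> B * l2 g" by (intro mult_left_mono is_fourier_bound' ug B0)
    also have "\<dots> \<le> B * X" unfolding X_def by (intro mult_left_mono sq_integrable_bessel(2) s bg B0) simp
    finally have "(l2 k)\<^sup>2 \<le> (B * X)\<^sup>2" by (simp add: power_mono)
    then show ?thesis using nn_integral_norm_power2[OF sk] by (simp add: power_mult_distrib ennreal_leI)
  qed
  have m: "bessel s k \<in> borel_measurable borel" by measurable
  have "(\<integral>\<^sup>+\<xi>. ennreal ((norm (bessel s k \<xi>))\<^sup>2) \<partial>lborel)
      \<le> (\<integral>\<^sup>+\<xi>. ennreal (2 powr s) * (ennreal ((norm (k \<xi>))\<^sup>2) + ennreal (4 powr (2 * s)) * (ennreal ((\<bar>\<xi>\<bar> / 4) powr (2 * s)) * ennreal ((norm (k \<xi>))\<^sup>2))) \<partial>lborel)"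
  proof (intro nn_integral_mono)
    fix \<xi>
    have "4 powr (2 * s) * (\<bar>\<xi>\<bar> / 4) powr (2 * s) = \<bar>\<xi>\<bar> powr (2 * s)"
      by (simp flip: powr_mult)
    then have "(1 + \<xi>\<^sup>2) powr s \<le> 2 powr s * (1 + 4 powr (2 * s) * (\<bar>\<xi>\<bar> / 4) powr (2 * s))"
      using bessel_weight_le[OF s, of \<xi>] by simp
    from mult_right_mono[OF this, of "(norm (k \<xi>))\<^sup>2"]
    show "ennreal ((norm (bessel s k \<xi>))\<^sup>2) \<le> ennreal (2 powr s) * (ennreal ((norm (k \<xi>))\<^sup>2) + ennreal (4 powr (2 * s)) * (ennreal ((\<bar>\<xi>\<bar> / 4) powr (2 * s)) * ennreal ((norm (k \<xi>))\<^sup>2)))"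
      unfolding norm_bessel by (simp add: ennreal_leI algebra_simps flip: ennreal_mult ennreal_plus)
  qed
  also have "\<dots> = ennreal (2 powr s) * ((\<integral>\<^sup>+\<xi>. ennreal ((norm (k \<xi>))\<^sup>2) \<partial>lborel) + ennreal (4 powr (2 * s)) * (\<integral>\<^sup>+\<xi>. ennreal ((\<bar>\<xi>\<bar> / 4) powr (2 * s)) * ennreal ((norm (k \<xi>))\<^sup>2) \<partial>lborel))"
    by (simp add: nn_integral_cmult nn_integral_add)
  also have "\<dots> \<le> ennreal (2 powr s) * (ennreal (B\<^sup>2 * X\<^sup>2) + ennreal (4 powr (2 * s)) * ennreal (8 * B\<^sup>2 * X\<^sup>2 + 32 * A\<^sup>2 * Y\<^sup>2))"
    by (intro mult_left_mono add_mono lk hk) auto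
  also have "\<dots> = ennreal (2 powr s * (B\<^sup>2 * X\<^sup>2 + 4 powr (2 * s) * (8 * B\<^sup>2 * X\<^sup>2 + 32 * A\<^sup>2 * Y\<^sup>2)))"
    by (simp flip: ennreal_mult ennreal_plus)
  also have "\<dots> \<le> ennreal ((prod_const s * (B * X + A * Y))\<^sup>2)"
  proof (rule ennreal_leI)
    \<comment> \<open>The smaller coefficient 8 is raised to 32 so that one constant serves both
      terms.\<close>
    have "B\<^sup>2 * X\<^sup>2 + 4 powr (2 * s) * (8 * B\<^sup>2 * X\<^sup>2 + 32 * A\<^sup>2 * Y\<^sup>2) \<le> (1 + 32 * 4 powr (2 * s)) * (B\<^sup>2 * X\<^sup>2 + A\<^sup>2 * Y\<^sup>2)"
      by (simp add: algebra_simps)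
    also have "\<dots> \<le> (1 + 32 * 4 powr (2 * s)) * (B * X + A * Y)\<^sup>2"
      using A0 B0 XY by (intro mult_left_mono) (auto simp: power2_sum power_mult_distrib)
    finally have "2 powr s * (B\<^sup>2 * X\<^sup>2 + 4 powr (2 * s) * (8 * B\<^sup>2 * X\<^sup>2 + 32 * A\<^sup>2 * Y\<^sup>2)) \<le> 2 powr s * ((1 + 32 * 4 powr (2 * s)) * (B * X + A * Y)\<^sup>2)"
      by (rule mult_left_mono) simp
    also have "\<dots> = (prod_const s * (B * X + A * Y))\<^sup>2"
      by (simp add: prod_const_def power_mult_distrib)
    finally show "2 powr s * (B\<^sup>2 * X\<^sup>2 + 4 powr (2 * s) * (8 * B\<^sup>2 * X\<^sup>2 + 32 * A\<^sup>2 * Y\<^sup>2)) \<le> (prod_const s * (B * X + A * Y))\<^sup>2" .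
  qed
  finally have le: "(\<integral>\<^sup>+\<xi>. ennreal ((norm (bessel s k \<xi>))\<^sup>2) \<partial>lborel) \<le> ennreal ((prod_const s * (B * X + A * Y))\<^sup>2)" .
  show "sq_integrable (bessel s k)" by (rule sq_integrableI_nn(1)[OF m le])
  have "(l2 (bessel s k))\<^sup>2 \<le> (prod_const s * (B * X + A * Y))\<^sup>2" by (rule sq_integrableI_nn(2)[OF m le]) simp
  then show "l2 (bessel s k) \<le> prod_const s * (B * l2 (bessel s g) + A * l2 (bessel s h))"
    unfolding X_def[symmetric] Y_def[symmetric]
    by (rule power2_le_imp_le) (auto intro!: mult_nonneg_nonneg add_nonneg_nonneg prod_const_nonneg A0 B0 XY)
qed

subsection \<open>The space X\<close>

abbreviation cr :: "(real \<Rightarrow> real) \<Rightarrow> real \<Rightarrow> complex" where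
  "cr u \<equiv> \<lambda>x. complex_of_real (u x)"

lemma sq_integrable_cr: "sq_integrable (cr u) \<longleftrightarrow> sq_integrable u"
proof
  assume a: "sq_integrable (cr u)"
  have "(\<lambda>x. Re (cr u x)) \<in> borel_measurable borel"
    by (rule measurable_compose[OF sq_integrable_measurable[OF a]]) measurable
  then have "u \<in> borel_measurable borel" by simp
  with a show "sq_integrable u" by (auto simp: sq_integrable_def)
qed (auto simp: sq_integrable_def)

lemma l2_cr [simp]: "l2 (cr u) = l2 u"
  by (simp add: l2_def)

text \<open>\<open>is_L2_fourier\<close> asks in addition that the transform of the test function be
  square integrable; the Plancherel bound guarantees this, so the two test classes coincide.\<close>

lemma is_L2_fourier_iff:
  "sq_integrable u \<Longrightarrow> is_L2_fourier u g \<longleftrightarrow> is_fourier (cr u) g"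
  unfolding is_L2_fourier_def is_fourier_def sq_integrable_cr
  using fourier_L1_L2_bound(1) by blast

lemma sq_integrable_bessel_iff:
  assumes "g \<in> borel_measurable borel"
  shows "sq_integrable (bessel s g) \<longleftrightarrow> integrable lborel (\<lambda>\<xi>. (1 + \<xi>\<^sup>2) powr s * (cmod (g \<xi>))\<^sup>2)"
  unfolding sq_integrable_def norm_bessel using bessel_measurable[OF assms] by simp

text \<open>\<open>fourier_L2\<close> is an unspecified choice; since all transforms agree almost
  everywhere, the norm may be computed on whichever one is at hand. \<open>in_HsE\<close> is the
  converse, and together they replace the choice operator from here on.\<close>

lemma in_HsI:
  assumes "is_fourier (cr u) g" "sq_integrable (bessel s g)"
  shows "in_Hs s u" and "Hs_norm s u = l2 (bessel s g)"
proof -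
  have u: "sq_integrable u" using is_fourierD(1)[OF assms(1)] by (simp add: sq_integrable_cr)
  note g = sq_integrable_measurable[OF is_fourierD(2)[OF assms(1)]]
  have gu: "is_L2_fourier u g" using is_L2_fourier_iff[OF u] assms(1) by simp
  then show "in_Hs s u"
    unfolding in_Hs_def using u assms(2) by (auto simp flip: sq_integrable_bessel_iff[OF g])
  have "is_L2_fourier u (fourier_L2 u)"
    unfolding fourier_L2_def by (rule someI[of "is_L2_fourier u", OF gu])
  then have F: "is_fourier (cr u) (fourier_L2 u)" using is_L2_fourier_iff[OF u] by simp
  note F' [measurable] = sq_integrable_measurable[OF is_fourierD(2)[OF F]]
  have "Hs_norm s u = l2 (bessel s (fourier_L2 u))"
    by (simp add: Hs_norm_def l2_def norm_bessel)
  also have "\<dots> = l2 (bessel s g)"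
    using is_fourier_unique[OF F assms(1)] g by (intro l2_cong_AE bessel_measurable F' g) (auto simp: bessel_def)
  finally show "Hs_norm s u = l2 (bessel s g)" .
qed

lemma in_HsE:
  assumes "in_Hs s u"
  obtains g where "is_fourier (cr u) g" "sq_integrable (bessel s g)" "Hs_norm s u = l2 (bessel s g)"
proof -
  have u: "sq_integrable u" using assms by (simp add: in_Hs_def)
  obtain g where g: "is_L2_fourier u g" "integrable lborel (\<lambda>\<xi>. (1 + \<xi>^2) powr s * (cmod (g \<xi>))^2)"
    using assms by (auto simp: in_Hs_def)
  have F: "is_fourier (cr u) g" using is_L2_fourier_iff[OF u] g by simp
  have b: "sq_integrable (bessel s g)"
    using g(2) sq_integrable_bessel_iff[OF sq_integrable_measurable[OF is_fourierD(2)[OF F]]] by simp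
  show ?thesis by (rule that[OF F b in_HsI(2)[OF F b]])
qed

lemma Hs_norm_nonneg [simp]: "Hs_norm s u \<ge> 0"
  by (simp add: Hs_norm_def)

lemma bessel_add: "bessel s (\<lambda>x. f x + g x) = (\<lambda>x. bessel s f x + bessel s g x)"
  by (auto simp: bessel_def algebra_simps)

lemma bessel_cmult: "bessel s (\<lambda>x. c * f x) = (\<lambda>x. c * bessel s f x)"
  by (auto simp: bessel_def algebra_simps)

lemma in_Hs_add:
  assumes "in_Hs s u" "in_Hs s v"
  shows "in_Hs s (\<lambda>x. u x + v x)" and "Hs_norm s (\<lambda>x. u x + v x) \<le> Hs_norm s u + Hs_norm s v"
proof -
  obtain g where g: "is_fourier (cr u) g" "sq_integrable (bessel s g)" "Hs_norm s u = l2 (bessel s g)"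
    using in_HsE[OF assms(1)] .
  obtain h where h: "is_fourier (cr v) h" "sq_integrable (bessel s h)" "Hs_norm s v = l2 (bessel s h)"
    using in_HsE[OF assms(2)] .
  have F: "is_fourier (cr (\<lambda>x. u x + v x)) (\<lambda>x. g x + h x)"
    using is_fourier_add[OF g(1) h(1)] by simp
  have b: "sq_integrable (bessel s (\<lambda>x. g x + h x))"
    unfolding bessel_add using g(2) h(2) by (rule sq_integrable_add)
  show "in_Hs s (\<lambda>x. u x + v x)" by (rule in_HsI(1)[OF F b])
  show "Hs_norm s (\<lambda>x. u x + v x) \<le> Hs_norm s u + Hs_norm s v"
    unfolding in_HsI(2)[OF F b] g(3) h(3) bessel_add by (rule l2_triangle[OF g(2) h(2)])
qed

lemma in_Hs_cmult:
  assumes "in_Hs s u"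
  shows "in_Hs s (\<lambda>x. c * u x)" and "Hs_norm s (\<lambda>x. c * u x) = \<bar>c\<bar> * Hs_norm s u"
proof -
  obtain g where g: "is_fourier (cr u) g" "sq_integrable (bessel s g)" "Hs_norm s u = l2 (bessel s g)"
    using in_HsE[OF assms(1)] .
  have F: "is_fourier (cr (\<lambda>x. c * u x)) (\<lambda>x. complex_of_real c * g x)"
    using is_fourier_cmult[OF g(1), of "complex_of_real c"] by simp
  have b: "sq_integrable (bessel s (\<lambda>x. complex_of_real c * g x))"
    unfolding bessel_cmult using g(2) by (rule sq_integrable_cmult)
  show "in_Hs s (\<lambda>x. c * u x)" by (rule in_HsI(1)[OF F b])
  show "Hs_norm s (\<lambda>x. c * u x) = \<bar>c\<bar> * Hs_norm s u"
    unfolding in_HsI(2)[OF F b] g(3) bessel_cmult by (simp add: l2_cmult)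
qed

lemma in_Hs_cong_AE:
  assumes "in_Hs s u" "v \<in> borel_measurable borel" "AE x in lborel. u x = v x"
  shows "in_Hs s v" "Hs_norm s v = Hs_norm s u"
proof -
  obtain g where g: "is_fourier (cr u) g" "sq_integrable (bessel s g)" "Hs_norm s u = l2 (bessel s g)"
    using in_HsE[OF assms(1)] .
  have F: "is_fourier (cr v) g"
    by (rule is_fourier_cong_AE[OF g(1)]) (use assms sq_integrable_measurable[OF is_fourierD(2)[OF g(1)]] in auto)
  show "in_Hs s v" "Hs_norm s v = Hs_norm s u"
    using in_HsI[OF F g(2)] g(3) by auto
qed

text \<open>\<open>real_of_ereal\<close> would turn an infinite value into 0, so finiteness has to
  come first: from above by the bound C, from below by comparison with the zero function.\<close>

lemma Linf_norm_props:
  assumes "in_Linf u"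
  shows "AE x in lborel. \<bar>u x\<bar> \<le> Linf_norm u" and "0 \<le> Linf_norm u"
proof -
  obtain C where C: "AE x in lborel. \<bar>u x\<bar> \<le> C" and [measurable]: "u \<in> borel_measurable borel"
    using assms by (auto simp: in_Linf_def)
  let ?e = "esssup lborel (\<lambda>x. ereal \<bar>u x\<bar>)"
  have le: "?e \<le> ereal C"
    by (rule esssup_I) (use C in auto)
  have "esssup lborel (\<lambda>x::real. 0::ereal) \<le> ?e"
    by (rule esssup_mono) auto
  then have ge: "0 \<le> ?e" by (simp add: esssup_const)
  from le ge have e: "?e = ereal (Linf_norm u)"
    unfolding Linf_norm_def by (cases ?e) auto
  have "AE x in lborel. ereal \<bar>u x\<bar> \<le> ?e" by (rule esssup_AE)
  then show "AE x in lborel. \<bar>u x\<bar> \<le> Linf_norm u" by (simp add: e)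
  show "0 \<le> Linf_norm u" using ge by (simp add: e)
qed

lemma in_LinfI:
  assumes "u \<in> borel_measurable borel" "AE x in lborel. \<bar>u x\<bar> \<le> C"
  shows "in_Linf u" "Linf_norm u \<le> C"
proof -
  show l: "in_Linf u" using assms by (auto simp: in_Linf_def)
  have [measurable]: "u \<in> borel_measurable borel" by fact
  have le: "esssup lborel (\<lambda>x. ereal \<bar>u x\<bar>) \<le> ereal C"
    by (rule esssup_I) (use assms in auto)
  have "esssup lborel (\<lambda>x::real. 0::ereal) \<le> esssup lborel (\<lambda>x. ereal \<bar>u x\<bar>)"
    by (rule esssup_mono) auto
  then have "0 \<le> esssup lborel (\<lambda>x. ereal \<bar>u x\<bar>)" by (simp add: esssup_const)
  with le show "Linf_norm u \<le> C"
    unfolding Linf_norm_def by (cases "esssup lborel (\<lambda>x. ereal \<bar>u x\<bar>)") auto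
qed

section \<open>Linear structure, products, convolution and series in X\<close>

lemma in_XD:
  assumes "in_X s u"
  shows "in_Hs s u" "in_Linf u" "u \<in> borel_measurable borel"
  using assms by (auto simp: in_X_def in_Linf_def)

lemma X_norm_nonneg: "in_X s u \<Longrightarrow> 0 \<le> X_norm s u"
  using Linf_norm_props(2)[OF in_XD(2)] by (simp add: X_norm_def)

lemma X_norm_parts: "in_X s u \<Longrightarrow> Hs_norm s u \<le> X_norm s u \<and> Linf_norm u \<le> X_norm s u"
  using Linf_norm_props(2)[OF in_XD(2)] by (simp add: X_norm_def)

lemma in_X_add:
  assumes u: "in_X s u" and v: "in_X s v"
  shows "in_X s (\<lambda>x. u x + v x)" and "X_norm s (\<lambda>x. u x + v x) \<le> X_norm s u + X_norm s v"
proof -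
  note [measurable] = in_XD(3)[OF u] in_XD(3)[OF v]
  have "AE x in lborel. \<bar>u x + v x\<bar> \<le> Linf_norm u + Linf_norm v"
    using Linf_norm_props(1)[OF in_XD(2)[OF u]] Linf_norm_props(1)[OF in_XD(2)[OF v]] by eventually_elim linarith
  then have l: "in_Linf (\<lambda>x. u x + v x)" "Linf_norm (\<lambda>x. u x + v x) \<le> Linf_norm u + Linf_norm v"
    by (auto intro!: in_LinfI)
  note h = in_Hs_add[OF in_XD(1)[OF u] in_XD(1)[OF v]]
  show "in_X s (\<lambda>x. u x + v x)" using l h by (simp add: in_X_def)
  show "X_norm s (\<lambda>x. u x + v x) \<le> X_norm s u + X_norm s v" using l h by (simp add: X_norm_def)
qed

lemma in_X_cmult_le:
  assumes u: "in_X s u"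
  shows "in_X s (\<lambda>x. c * u x)" and "X_norm s (\<lambda>x. c * u x) \<le> \<bar>c\<bar> * X_norm s u"
proof -
  note [measurable] = in_XD(3)[OF u]
  have "AE x in lborel. \<bar>c * u x\<bar> \<le> \<bar>c\<bar> * Linf_norm u"
    using Linf_norm_props(1)[OF in_XD(2)[OF u]] by eventually_elim (simp add: abs_mult mult_left_mono)
  then have l: "in_Linf (\<lambda>x. c * u x)" "Linf_norm (\<lambda>x. c * u x) \<le> \<bar>c\<bar> * Linf_norm u"
    by (auto intro!: in_LinfI)
  note h = in_Hs_cmult[OF in_XD(1)[OF u]]
  show "in_X s (\<lambda>x. c * u x)" using l h by (simp add: in_X_def)
  show "X_norm s (\<lambda>x. c * u x) \<le> \<bar>c\<bar> * X_norm s u" using l h by (simp add: X_norm_def algebra_simps)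
qed

lemma in_X_cong_AE:
  assumes u: "in_X s u" and v: "v \<in> borel_measurable borel" "AE x in lborel. u x = v x"
  shows "in_X s v" "X_norm s v = X_norm s u"
proof -
  note [measurable] = in_XD(3)[OF u] v(1)
  note h = in_Hs_cong_AE[OF in_XD(1)[OF u] v]
  have "AE x in lborel. \<bar>v x\<bar> \<le> Linf_norm u"
    using Linf_norm_props(1)[OF in_XD(2)[OF u]] v(2) by eventually_elim simp
  then have l: "in_Linf v" by (intro in_LinfI) auto
  have "Linf_norm v = Linf_norm u"
    unfolding Linf_norm_def using v(2) by (intro arg_cong[where f=real_of_ereal] esssup_AE_cong) auto
  then show "in_X s v" "X_norm s v = X_norm s u"
    using l h by (auto simp: in_X_def X_norm_def)
qed

lemma in_X_diff:
  assumes u: "in_X s u" and v: "in_X s v"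
  shows "in_X s (\<lambda>x. u x - v x)" and "X_norm s (\<lambda>x. u x - v x) \<le> X_norm s u + X_norm s v"
proof -
  note m = in_X_cmult_le[OF v, of "-1"]
  show "in_X s (\<lambda>x. u x - v x)" "X_norm s (\<lambda>x. u x - v x) \<le> X_norm s u + X_norm s v"
    using in_X_add[OF u m(1)] m(2) by auto
qed

lemma X_norm_minus_commute:
  assumes "in_X s u" "in_X s v"
  shows "X_norm s (\<lambda>x. u x - v x) = X_norm s (\<lambda>x. v x - u x)"
  using in_X_cmult_le(2)[OF in_X_diff(1)[OF assms], of "-1"] in_X_cmult_le(2)[OF in_X_diff(1)[OF assms(2,1)], of "-1"]
  by simp

lemma in_X_zero: "in_X s (\<lambda>x. 0)" and X_norm_zero: "X_norm s (\<lambda>x. 0) = 0"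
proof -
  have F: "is_fourier (cr (\<lambda>x. 0)) (\<lambda>x. 0)" by (simp add: is_fourier_def)
  have b: "bessel s (\<lambda>x. 0) = (\<lambda>x. 0)" by (simp add: bessel_def fun_eq_iff)
  have h: "in_Hs s (\<lambda>x. 0)" "Hs_norm s (\<lambda>x. 0) = 0"
    using in_HsI[OF F, of s] by (simp_all add: b l2_def)
  have l: "in_Linf (\<lambda>x. 0)" "Linf_norm (\<lambda>x. 0) \<le> 0" by (auto intro!: in_LinfI)
  show "in_X s (\<lambda>x. 0)" "X_norm s (\<lambda>x. 0) = 0"
    using h l Linf_norm_props(2)[OF l(1)] by (auto simp: in_X_def X_norm_def)
qed

lemma in_X_sum:
  "(\<And>i. i \<in> I \<Longrightarrow> in_X s (f i)) \<Longrightarrow> in_X s (\<lambda>x. \<Sum>i\<in>I. f i x) \<and> X_norm s (\<lambda>x. \<Sum>i\<in>I. f i x) \<le> (\<Sum>i\<in>I. X_norm s (f i))"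
proof (induction I rule: infinite_finite_induct)
  case (insert j I)
  then have "in_X s (\<lambda>x. \<Sum>i\<in>I. f i x)" "X_norm s (\<lambda>x. \<Sum>i\<in>I. f i x) \<le> (\<Sum>i\<in>I. X_norm s (f i))" "in_X s (f j)"
    by auto
  with in_X_add[of s "f j" "\<lambda>x. \<Sum>i\<in>I. f i x"] insert(1,2) show ?case by auto
qed (auto simp: in_X_zero X_norm_zero)

lemma X_norm_zero_AE:
  assumes u: "in_X s u" and "X_norm s u \<le> 0"
  shows "AE x in lborel. u x = 0"
proof -
  have "Linf_norm u \<le> 0" using X_norm_parts[OF u] assms(2) by simp
  with Linf_norm_props(1)[OF in_XD(2)[OF u]] show ?thesis
    by (auto elim!: eventually_mono)
qed

text \<open>The added 1 pays for the sup norm of the product.\<close>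

definition alg_const :: "real \<Rightarrow> real" where
  "alg_const s = prod_const s + 1"

lemma alg_const_ge_1: "alg_const s \<ge> 1"
  using prod_const_nonneg by (simp add: alg_const_def)

lemma in_X_mult:
  assumes s: "s > 0" and u: "in_X s u" and v: "in_X s v"
  shows "in_X s (\<lambda>x. u x * v x)" and "X_norm s (\<lambda>x. u x * v x) \<le> alg_const s * (X_norm s u * X_norm s v)"
proof -
  note [measurable] = in_XD(3)[OF u] in_XD(3)[OF v]
  note A = Linf_norm_props[OF in_XD(2)[OF u]] and B = Linf_norm_props[OF in_XD(2)[OF v]]
  obtain g where g: "is_fourier (cr u) g" "sq_integrable (bessel s g)" "Hs_norm s u = l2 (bessel s g)"
    using in_HsE[OF in_XD(1)[OF u]] .
  obtain h where h: "is_fourier (cr v) h" "sq_integrable (bessel s h)" "Hs_norm s v = l2 (bessel s h)"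
    using in_HsE[OF in_XD(1)[OF v]] .
  have A': "AE x in lborel. norm (cr u x) \<le> Linf_norm u" and B': "AE x in lborel. norm (cr v x) \<le> Linf_norm v"
    using A(1) B(1) by auto
  have "sq_integrable (\<lambda>x. cr u x * cr v x)"
    by (rule sq_integrable_bounded_mult[OF is_fourierD(1)[OF h(1)] _ A']) simp
  then obtain k where k: "is_fourier (\<lambda>x. cr u x * cr v x) k" using fourier_exists by blast
  note p = bessel_product[OF s g(1) h(1) k A' B' A(2) B(2) g(2) h(2)]
  have k': "is_fourier (cr (\<lambda>x. u x * v x)) k" using k by simp
  note H = in_HsI[OF k' p(1)]
  have Hn: "Hs_norm s (\<lambda>x. u x * v x) \<le> prod_const s * (Linf_norm v * Hs_norm s u + Linf_norm u * Hs_norm s v)"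
    using p(2) H(2) g(3) h(3) by simp
  have "AE x in lborel. \<bar>u x * v x\<bar> \<le> Linf_norm u * Linf_norm v"
    using A(1) B(1) by eventually_elim (auto simp: abs_mult intro!: mult_mono A(2))
  then have L: "in_Linf (\<lambda>x. u x * v x)" "Linf_norm (\<lambda>x. u x * v x) \<le> Linf_norm u * Linf_norm v"
    by (auto intro!: in_LinfI)
  show "in_X s (\<lambda>x. u x * v x)" using H L by (simp add: in_X_def)
  \<comment> \<open>The bound from the product estimate consists of the two mixed terms in the
    expansion of the product of the norms, so nonnegativity of the other terms is enough.\<close>
  have e: "X_norm s u * X_norm s v = Hs_norm s u * Hs_norm s v + (Linf_norm v * Hs_norm s u + Linf_norm u * Hs_norm s v) + Linf_norm u * Linf_norm v"
    by (simp add: X_norm_def algebra_simps)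
  have "Hs_norm s u * Hs_norm s v \<ge> 0" "Linf_norm v * Hs_norm s u + Linf_norm u * Hs_norm s v \<ge> 0" "Linf_norm u * Linf_norm v \<ge> 0"
    using A B by auto
  with e have 1: "Linf_norm v * Hs_norm s u + Linf_norm u * Hs_norm s v \<le> X_norm s u * X_norm s v" "Linf_norm u * Linf_norm v \<le> X_norm s u * X_norm s v"
    by linarith+
  have "X_norm s (\<lambda>x. u x * v x) \<le> prod_const s * (X_norm s u * X_norm s v) + X_norm s u * X_norm s v"
    unfolding X_norm_def[of s "\<lambda>x. u x * v x"]
    using Hn L(2) 1 mult_left_mono[OF 1(1) prod_const_nonneg[of s]] by linarith
  then show "X_norm s (\<lambda>x. u x * v x) \<le> alg_const s * (X_norm s u * X_norm s v)"
    by (simp add: alg_const_def algebra_simps)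
qed

text \<open>On the Sobolev side the operator is a multiplier bounded by the L1 norm of \<alpha>, and
  it commutes with the weight; on the sup side it is the trivial L1 bound.\<close>

lemma in_X_conv:
  assumes a: "integrable lborel \<alpha>" and u: "in_X s u"
  shows "in_X s (conv \<alpha> u)" and "X_norm s (conv \<alpha> u) \<le> (LINT x|lborel. \<bar>\<alpha> x\<bar>) * X_norm s u"
proof -
  define I where "I = (LINT x|lborel. \<bar>\<alpha> x\<bar>)"
  have I: "I \<ge> 0" by (simp add: I_def)
  have [measurable]: "\<alpha> \<in> borel_measurable borel" using a by auto
  note [measurable] = in_XD(3)[OF u]
  note A = Linf_norm_props[OF in_XD(2)[OF u]]
  have cm [measurable]: "conv \<alpha> u \<in> borel_measurable borel" unfolding conv_def[abs_def] by measurable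
  have "AE x in lborel. \<bar>conv \<alpha> u x\<bar> \<le> I * Linf_norm u"
    using integrable_conv(2)[OF a in_XD(3)[OF u], of "Linf_norm u"] A(1) by (simp add: conv_def I_def)
  then have L: "in_Linf (conv \<alpha> u)" "Linf_norm (conv \<alpha> u) \<le> I * Linf_norm u"
    by (auto intro!: in_LinfI cm)
  obtain g where g: "is_fourier (cr u) g" "sq_integrable (bessel s g)" "Hs_norm s u = l2 (bessel s g)"
    using in_HsE[OF in_XD(1)[OF u]] .
  note [measurable] = sq_integrable_measurable[OF is_fourierD(2)[OF g(1)]]
  have ca: "integrable lborel (cr \<alpha>)" using a by (rule integrable_of_real)
  have eq: "cconv (cr \<alpha>) (cr u) = cr (conv \<alpha> u)"
    by (auto simp: cconv_def conv_def fun_eq_iff simp flip: integral_complex_of_real)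
  have F: "is_fourier (cr (conv \<alpha> u)) (\<lambda>\<xi>. fourier_L1 (cr \<alpha>) (- \<xi>) * g \<xi>)"
    using is_fourier_cconv[OF ca g(1)] by (simp add: eq)
  have be: "bessel s (\<lambda>\<xi>. fourier_L1 (cr \<alpha>) (- \<xi>) * g \<xi>) = (\<lambda>\<xi>. fourier_L1 (cr \<alpha>) (- \<xi>) * bessel s g \<xi>)"
    by (auto simp: bessel_def mult_ac)
  have m: "(\<lambda>\<xi>. fourier_L1 (cr \<alpha>) (- \<xi>)) \<in> borel_measurable borel"
    by (intro measurable_compose[OF _ borel_measurable_fourier_L1]) auto
  have bd: "AE \<xi> in lborel. norm (fourier_L1 (cr \<alpha>) (- \<xi>)) \<le> I"
    using norm_fourier_L1_le[of "cr \<alpha>"] by (simp add: I_def)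
  have b: "sq_integrable (bessel s (\<lambda>\<xi>. fourier_L1 (cr \<alpha>) (- \<xi>) * g \<xi>))"
    unfolding be by (rule sq_integrable_bounded_mult[OF g(2) m bd])
  have "l2 (bessel s (\<lambda>\<xi>. fourier_L1 (cr \<alpha>) (- \<xi>) * g \<xi>)) \<le> I * l2 (bessel s g)"
    unfolding be by (rule l2_bounded_mult[OF g(2) m bd I])
  then have H: "in_Hs s (conv \<alpha> u)" "Hs_norm s (conv \<alpha> u) \<le> I * Hs_norm s u"
    using in_HsI[OF F b] g(3) by auto
  show "in_X s (conv \<alpha> u)" using H L by (simp add: in_X_def)
  show "X_norm s (conv \<alpha> u) \<le> (LINT x|lborel. \<bar>\<alpha> x\<bar>) * X_norm s u"
    using H L by (simp add: X_norm_def I_def[symmetric] algebra_simps)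
qed

text \<open>Completeness of X, with the pointwise series as the sum. The sup norms give pointwise
  convergence almost everywhere; the H^s norms dominate the L2 norms of the functions and of their
  transforms, so the transform of the sum is the sum of the transforms. Divergence occurs at most on
  a null set.\<close>

lemma in_X_suminf:
  assumes s: "s > 0" and c: "\<And>n. in_X s (c n)" and sum: "summable (\<lambda>n. X_norm s (c n))"
  shows "AE x in lborel. summable (\<lambda>n. \<bar>c n x\<bar>)"
    and "in_X s (\<lambda>x. \<Sum>n. c n x)"
    and "X_norm s (\<lambda>x. \<Sum>n. c n x) \<le> (\<Sum>n. X_norm s (c n))"
proof -
  note [measurable] = in_XD(3)[OF c]
  note A = Linf_norm_props[OF in_XD(2)[OF c]]
  have sH: "summable (\<lambda>n. Hs_norm s (c n))" and sL: "summable (\<lambda>n. Linf_norm (c n))"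
    by (rule summable_comparison_test'[OF sum], use X_norm_parts[OF c] A(2) in auto)+
  have AE: "AE x in lborel. \<forall>n. \<bar>c n x\<bar> \<le> Linf_norm (c n)"
    using A(1) by (simp add: AE_all_countable)
  then show S: "AE x in lborel. summable (\<lambda>n. \<bar>c n x\<bar>)"
    by eventually_elim (rule summable_comparison_test'[OF sL], auto)
  have "AE x in lborel. \<bar>\<Sum>n. c n x\<bar> \<le> (\<Sum>n. Linf_norm (c n))"
    using AE S
  proof eventually_elim
    case (elim x)
    then have "\<bar>\<Sum>n. c n x\<bar> \<le> (\<Sum>n. \<bar>c n x\<bar>)" by (intro summable_rabs)
    also have "\<dots> \<le> (\<Sum>n. Linf_norm (c n))" using elim by (intro suminf_le sL) auto
    finally show ?case .
  qed
  then have L: "in_Linf (\<lambda>x. \<Sum>n. c n x)" "Linf_norm (\<lambda>x. \<Sum>n. c n x) \<le> (\<Sum>n. Linf_norm (c n))"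
    by (auto intro!: in_LinfI)
  have "\<exists>g. is_fourier (cr (c n)) g \<and> sq_integrable (bessel s g) \<and> Hs_norm s (c n) = l2 (bessel s g)" for n
    using in_HsE[OF in_XD(1)[OF c[of n]]] by metis
  then obtain g where g: "\<And>n. is_fourier (cr (c n)) (g n)" "\<And>n. sq_integrable (bessel s (g n))" "\<And>n. Hs_norm s (c n) = l2 (bessel s (g n))"
    by metis
  note [measurable] = sq_integrable_measurable[OF is_fourierD(2)[OF g(1)]]
  have sB: "summable (\<lambda>n. l2 (bessel s (g n)))" using sH g(3) by simp
  have gB: "l2 (g n) \<le> l2 (bessel s (g n))" for n by (intro sq_integrable_bessel(2) s g) simp
  have sg: "summable (\<lambda>n. l2 (g n))"
    by (rule summable_comparison_test'[OF sB]) (use gB in auto)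
  have "l2 (cr (c n)) \<le> l2 (g n)" for n
  proof -
    have "1 * l2 (cr (c n)) \<le> sqrt (2 * pi) * l2 (cr (c n))"
      using pi_ge_two by (intro mult_right_mono) auto
    also have "\<dots> \<le> l2 (g n)" by (rule is_fourier_bound'[OF g(1)])
    finally show ?thesis by simp
  qed
  then have sc: "summable (\<lambda>n. l2 (cr (c n)))"
    by (intro summable_comparison_test'[OF sg]) auto
  have F: "is_fourier (\<lambda>x. \<Sum>n. cr (c n) x) (\<lambda>\<xi>. \<Sum>n. g n \<xi>)"
    by (rule is_fourier_suminf[OF g(1) sc sg])
  have F': "is_fourier (cr (\<lambda>x. \<Sum>n. c n x)) (\<lambda>\<xi>. \<Sum>n. g n \<xi>)"
  proof (rule is_fourier_cong_AE[OF F])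
    show "AE x in lborel. (\<Sum>n. cr (c n) x) = cr (\<lambda>x. \<Sum>n. c n x) x"
      using S
    proof eventually_elim
      case (elim x)
      then show ?case by (rule suminf_of_real[symmetric, OF summable_rabs_cancel])
    qed
  qed auto
  \<comment> \<open>The weight passes through the sum at each frequency of convergence, so the
    completeness argument can be run on the weighted transforms.\<close>
  have bs: "AE \<xi> in lborel. (\<Sum>n. bessel s (g n) \<xi>) = bessel s (\<lambda>\<xi>. \<Sum>n. g n \<xi>) \<xi>"
    using l2_suminf(1)[OF is_fourierD(2)[OF g(1)] sg]
    by eventually_elim (simp add: bessel_def suminf_mult summable_norm_cancel)
  note B = l2_suminf(2,3)[OF g(2) sB]
  have b: "sq_integrable (bessel s (\<lambda>\<xi>. \<Sum>n. g n \<xi>))"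
    by (rule sq_integrable_cong_AE[OF B(1) _ bs]) measurable
  have "l2 (bessel s (\<lambda>\<xi>. \<Sum>n. g n \<xi>)) = l2 (\<lambda>\<xi>. \<Sum>n. bessel s (g n) \<xi>)"
    using bs by (intro l2_cong_AE) auto
  then have H: "in_Hs s (\<lambda>x. \<Sum>n. c n x)" "Hs_norm s (\<lambda>x. \<Sum>n. c n x) \<le> (\<Sum>n. Hs_norm s (c n))"
    using in_HsI[OF F' b] B(2) g(3) by auto
  show "in_X s (\<lambda>x. \<Sum>n. c n x)" using H L by (simp add: in_X_def)
  have "(\<Sum>n. X_norm s (c n)) = (\<Sum>n. Hs_norm s (c n)) + (\<Sum>n. Linf_norm (c n))"
    unfolding X_norm_def by (rule suminf_add[symmetric, OF sH sL])
  then show "X_norm s (\<lambda>x. \<Sum>n. c n x) \<le> (\<Sum>n. X_norm s (c n))"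
    using H L by (simp add: X_norm_def)
qed

subsection \<open>A Gronwall inequality\<close>

text \<open>f is compared with a barrier that grows strictly faster than the hypothesis allows. At
  the infimum m of the times of violation f is still below the barrier, and \<open>step\<close> at m
  keeps it there for a short time, which contradicts the choice of m.\<close>

lemma gronwall_right:
  fixes f :: "real \<Rightarrow> real"
  assumes K: "K \<ge> 0" and f0: "f 0 \<ge> 0" and cont: "continuous_on {0..T} f"
    and step: "\<And>t \<epsilon>. 0 \<le> t \<Longrightarrow> t < T \<Longrightarrow> \<epsilon> > 0 \<Longrightarrow>
      \<exists>\<delta>>0. \<forall>t'. t < t' \<and> t' \<le> T \<and> t' - t < \<delta> \<longrightarrow> f t' \<le> f t + (t' - t) * (K * f t + \<epsilon>)"
    and t: "0 \<le> t" "t \<le> T"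
  shows "f t \<le> f 0 * exp (K * t)"
proof -
  have main: "f t \<le> exp (K * t) * (f 0 + \<eta> + \<eta> * t)" if \<eta>: "\<eta> > 0" for \<eta>
  proof (rule ccontr)
    \<comment> \<open>The slope \<eta> absorbs the error term of \<open>step\<close>, which is
      applied with \<epsilon> equal to \<eta>.\<close>
    define g where "g t = exp (K * t) * (f 0 + \<eta> + \<eta> * t)" for t
    have contg: "continuous_on {0..T} g" unfolding g_def by (intro continuous_intros)
    assume "\<not> f t \<le> exp (K * t) * (f 0 + \<eta> + \<eta> * t)"
    then have tb: "f t > g t" by (simp add: g_def)
    define S where "S = {t. 0 \<le> t \<and> t \<le> T \<and> f t > g t}"
    have tS: "t \<in> S" using tb t by (simp add: S_def)
    have bdd: "bdd_below S" by (rule bdd_belowI[of _ 0]) (simp add: S_def)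
    define m where "m = Inf S"
    have m0: "0 \<le> m" unfolding m_def using tS by (intro cInf_greatest) (auto simp: S_def)
    have mt: "m \<le> t" unfolding m_def by (rule cInf_lower[OF tS bdd])
    have below: "f \<tau> \<le> g \<tau>" if "0 \<le> \<tau>" "\<tau> < m" for \<tau>
    proof (rule ccontr)
      assume "\<not> f \<tau> \<le> g \<tau>"
      then have "\<tau> \<in> S" using that mt t by (simp add: S_def)
      then show False using cInf_lower[OF _ bdd, of \<tau>] that by (simp add: m_def)
    qed
    have fm: "f m \<le> g m"
    proof (cases "m = 0")
      case True
      then show ?thesis using \<eta> by (simp add: g_def)
    next
      case False
      \<comment> \<open>By continuity a violation at m would persist slightly to the left of m,
        where there is none.\<close>
      show ?thesis
      proof (rule ccontr)
        assume "\<not> f m \<le> g m"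
        then have d: "f m - g m > 0" by simp
        have "continuous_on {0..T} (\<lambda>t. f t - g t)" by (intro continuous_on_diff cont contg)
        then obtain \<delta> where \<delta>: "\<delta> > 0" "\<And>\<tau>. \<tau> \<in> {0..T} \<Longrightarrow> dist \<tau> m < \<delta> \<Longrightarrow> dist (f \<tau> - g \<tau>) (f m - g m) < f m - g m"
          unfolding continuous_on_iff using m0 mt t d by (metis (no_types, lifting) atLeastAtMost_iff order_trans)
        define \<tau> where "\<tau> = max 0 (m - \<delta> / 2)"
        have \<tau>: "0 \<le> \<tau>" "\<tau> < m" "\<tau> \<in> {0..T}" "dist \<tau> m < \<delta>"
          using \<delta>(1) m0 False mt t by (auto simp: \<tau>_def dist_real_def max_def)
        show False using \<delta>(2)[OF \<tau>(3,4)] below[OF \<tau>(1,2)] by (simp add: dist_real_def)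
      qed
    qed
    have mT: "m < T"
    proof (rule ccontr)
      assume "\<not> m < T"
      then have "m = t" using mt t by simp
      then show False using fm tb by simp
    qed
    obtain \<delta> where \<delta>: "\<delta> > 0" "\<And>t'. m < t' \<Longrightarrow> t' \<le> T \<Longrightarrow> t' - m < \<delta> \<Longrightarrow> f t' \<le> f m + (t' - m) * (K * f m + \<eta>)"
      using step[OF m0 mT \<eta>] by metis
    have "m + \<delta> \<le> Inf S"
    proof (rule cInf_greatest)
      fix t' assume t': "t' \<in> S"
      show "m + \<delta> \<le> t'"
      proof (rule ccontr)
        assume c: "\<not> m + \<delta> \<le> t'"
        have "m \<le> t'" using cInf_lower[OF t' bdd] by (simp add: m_def)
        then have mt': "m < t'" using fm t' by (cases "m = t'") (auto simp: S_def)
        define h where "h = t' - m"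
        have h: "h > 0" using mt' by (simp add: h_def)
        have "f t' \<le> f m + h * (K * f m + \<eta>)"
          unfolding h_def using t' c mt' by (intro \<delta>(2)) (auto simp: S_def)
        also have "\<dots> = f m * (1 + h * K) + h * \<eta>" by (simp add: algebra_simps)
        also have "\<dots> \<le> g m * (1 + h * K) + h * \<eta>"
          using fm h K by (intro add_right_mono mult_right_mono) auto
        also have "\<dots> \<le> g t'"
        proof -
          \<comment> \<open>One step of length h multiplies by at most 1 + h K <= exp (h K) and adds
            h \<eta>, which is what the barrier gains in the same time.\<close>
          define c where "c = f 0 + \<eta> + \<eta> * m"
          have c0: "c \<ge> 0" using f0 \<eta> m0 by (simp add: c_def)
          have "h * \<eta> \<le> exp (K * m) * (h * \<eta>)" 
            using h \<eta> K m0 mult_right_mono[of 1 "exp (K * m)" "h * \<eta>"] by simp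
          then have "g m * (1 + h * K) + h * \<eta> \<le> exp (K * m) * (c * (1 + h * K) + h * \<eta>)"
            by (simp add: g_def c_def algebra_simps)
          also have "\<dots> \<le> exp (K * m) * ((c + h * \<eta>) * (1 + h * K))"
            using h \<eta> K by (intro mult_left_mono) (auto simp: algebra_simps)
          also have "\<dots> \<le> exp (K * m) * ((c + h * \<eta>) * exp (h * K))"
            using c0 h \<eta> by (intro mult_left_mono exp_ge_add_one_self) auto
          also have "\<dots> = exp (K * m + h * K) * (c + h * \<eta>)"
            by (simp add: exp_add)
          also have "\<dots> = g t'" by (simp add: g_def c_def h_def algebra_simps)
          finally show ?thesis .
        qed
        finally show False using t' by (simp add: S_def)
      qed
    qed (use tS in auto)
    then show False using \<delta>(1) by (simp add: m_def)
  qed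
  show ?thesis
  proof (rule field_le_epsilon)
    fix e :: real assume e: "e > 0"
    \<comment> \<open>Chosen so that the excess of the barrier at time t equals e.\<close>
    define \<eta> where "\<eta> = e / (exp (K * t) * (1 + t))"
    have p: "exp (K * t) * (1 + t) > 0" using t by simp
    have "f t \<le> exp (K * t) * (f 0 + \<eta> + \<eta> * t)" using e p by (intro main) (simp add: \<eta>_def)
    also have "\<dots> = f 0 * exp (K * t) + \<eta> * (exp (K * t) * (1 + t))" by (simp add: algebra_simps)
    also have "\<eta> * (exp (K * t) * (1 + t)) = e"
      using less_imp_neq[OF p] unfolding \<eta>_def by (intro nonzero_eq_divide_eq[THEN iffD1]) auto
    finally show "f t \<le> f 0 * exp (K * t) + e" .
  qed
qed

subsection \<open>Power series in time\<close>

text \<open>The base 1/2 is the bound for R t on the time interval; the polynomial factors arise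
  from Cauchy products and from differentiating term by term.\<close>

lemma summable_poly_half: "summable (\<lambda>n. real (n + 1) ^ k * (1 / 2) ^ n)"
proof (rule summable_comparison_test_bigo)
  show "summable (\<lambda>n. norm ((3 / 4 :: real) ^ n))" by simp
  show "(\<lambda>n. real (n + 1) ^ k * (1 / 2) ^ n) \<in> O(\<lambda>n. (3 / 4) ^ n)" by real_asymp
qed

definition cauchy_prod :: "(nat \<Rightarrow> real \<Rightarrow> real) \<Rightarrow> (nat \<Rightarrow> real \<Rightarrow> real) \<Rightarrow> nat \<Rightarrow> real \<Rightarrow> real" where
  "cauchy_prod a b n x = (\<Sum>i\<le>n. a i x * b (n - i) x)"

definition time_series :: "(nat \<Rightarrow> real \<Rightarrow> real) \<Rightarrow> real \<Rightarrow> real \<Rightarrow> real" where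
  "time_series a t x = (\<Sum>n. a n x * t ^ n)"

text \<open>The coefficient of t^n when \<open>rhs\<close> is applied to a power series in t: powers
  become Cauchy products, and the convolution in x acts on coefficients.\<close>

definition rhs_coeff :: "(real \<Rightarrow> real) \<Rightarrow> (nat \<Rightarrow> real \<Rightarrow> real) \<Rightarrow> nat \<Rightarrow> real \<Rightarrow> real" where
  "rhs_coeff \<alpha> a n x =
     conv \<alpha> (cauchy_prod a (cauchy_prod a a) n) x
     - 3 * cauchy_prod a (\<lambda>m. conv \<alpha> (cauchy_prod a a m)) n x
     + 3 * cauchy_prod (cauchy_prod a a) (\<lambda>m. conv \<alpha> (a m)) n x
     - (LINT y|lborel. \<alpha> y) * cauchy_prod a (cauchy_prod a a) n x"

lemma cauchy_prod_cong:
  "(\<And>i. i \<le> n \<Longrightarrow> a i = a' i) \<Longrightarrow> (\<And>i. i \<le> n \<Longrightarrow> b i = b' i) \<Longrightarrow> cauchy_prod a b n = cauchy_prod a' b' n"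
  unfolding cauchy_prod_def by (intro ext sum.cong) auto

text \<open>Coefficient n sees only the coefficients up to n. This allows the truncation in the
  recursion to be removed again.\<close>

lemma rhs_coeff_cong:
  assumes "\<And>i. i \<le> n \<Longrightarrow> a i = b i"
  shows "rhs_coeff \<alpha> a n = rhs_coeff \<alpha> b n"
proof -
  have 2: "cauchy_prod a a m = cauchy_prod b b m" if "m \<le> n" for m
    using that assms by (intro cauchy_prod_cong) auto
  have 3: "cauchy_prod a (cauchy_prod a a) n = cauchy_prod b (cauchy_prod b b) n"
    using assms 2 by (intro cauchy_prod_cong) auto
  have 4: "cauchy_prod a (\<lambda>m. conv \<alpha> (cauchy_prod a a m)) n = cauchy_prod b (\<lambda>m. conv \<alpha> (cauchy_prod b b m)) n"
    using assms 2 by (intro cauchy_prod_cong) auto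
  have 5: "cauchy_prod (cauchy_prod a a) (\<lambda>m. conv \<alpha> (a m)) n = cauchy_prod (cauchy_prod b b) (\<lambda>m. conv \<alpha> (b m)) n"
    using assms 2 by (intro cauchy_prod_cong) auto
  show ?thesis unfolding rhs_coeff_def 3 4 5 ..
qed

text \<open>The truncation of the sequence makes the recursion well-founded syntactically.\<close>

fun series_coeff :: "(real \<Rightarrow> real) \<Rightarrow> (real \<Rightarrow> real) \<Rightarrow> (real \<Rightarrow> real) \<Rightarrow> nat \<Rightarrow> real \<Rightarrow> real" where
  "series_coeff \<alpha> \<phi> \<psi> 0 = \<phi>"
| "series_coeff \<alpha> \<phi> \<psi> (Suc 0) = \<psi>"
| "series_coeff \<alpha> \<phi> \<psi> (Suc (Suc n)) =
     (\<lambda>x. (1 / (real (n + 1) * real (n + 2))) *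
       rhs_coeff \<alpha> (\<lambda>i. if i \<le> n then series_coeff \<alpha> \<phi> \<psi> i else (\<lambda>x. 0)) n x)"

lemma series_coeff_Suc_Suc:
  "series_coeff \<alpha> \<phi> \<psi> (Suc (Suc n)) = (\<lambda>x. (1 / (real (n + 1) * real (n + 2))) * rhs_coeff \<alpha> (series_coeff \<alpha> \<phi> \<psi>) n x)"
  unfolding series_coeff.simps(3) by (subst rhs_coeff_cong[where b="series_coeff \<alpha> \<phi> \<psi>"]) auto

declare series_coeff.simps(3) [simp del]

text \<open>Counts the triples with sum n. The linear weight sits on n - i or, in the companion
  statement, on i, according to which factor of the Cauchy product is the square.\<close>

lemma sum_Suc_eq: "(\<Sum>i\<le>n. real (n - i + 1)) = real (n + 1) * real (n + 2) / 2"
proof -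
  have "(\<Sum>i\<le>n. real (n - i + 1)) = (\<Sum>i\<le>n. real (i + 1))"
    using sum.nat_diff_reindex[of "\<lambda>i. real (i + 1)" "Suc n"] by (simp add: lessThan_Suc_atMost)
  also have "\<dots> = real (n + 1) * real (n + 2) / 2"
    by (induction n) (auto simp: field_simps)
  finally show ?thesis .
qed

lemma sum_Suc_eq': "(\<Sum>i\<le>n. real (i + 1)) = real (n + 1) * real (n + 2) / 2"
  by (induction n) (auto simp: field_simps)

section \<open>Geometric bounds for the coefficients\<close>

context
  fixes s :: real and \<alpha> :: "real \<Rightarrow> real"
  assumes s: "s > 0" and \<alpha>: "integrable lborel \<alpha>"
begin

definition mass :: real where "mass = (LINT x|lborel. \<bar>\<alpha> x\<bar>)"

lemma mass_nonneg: "mass \<ge> 0"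
  by (simp add: mass_def)

lemma integral_le_mass: "\<bar>LINT y|lborel. \<alpha> y\<bar> \<le> mass"
  unfolding mass_def using integral_norm_bound[of lborel \<alpha>] by simp

lemma X_conv: "in_X s u \<Longrightarrow> in_X s (conv \<alpha> u)" "in_X s u \<Longrightarrow> X_norm s (conv \<alpha> u) \<le> mass * X_norm s u"
  using in_X_conv[OF \<alpha>] by (auto simp: mass_def)

lemma X_conv_bound: "in_X s u \<Longrightarrow> X_norm s u \<le> B \<Longrightarrow> X_norm s (conv \<alpha> u) \<le> mass * B"
  using X_conv(2)[of u] mult_left_mono[OF _ mass_nonneg, of "X_norm s u" B] by linarith

lemma X_mult_bound:
  assumes "in_X s u" "in_X s v" "X_norm s u \<le> A" "X_norm s v \<le> B"
  shows "X_norm s (\<lambda>x. u x * v x) \<le> alg_const s * (A * B)"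
proof -
  have "X_norm s u * X_norm s v \<le> A * B"
    using assms X_norm_nonneg[OF assms(1)] X_norm_nonneg[OF assms(2)] by (intro mult_mono) auto
  then have "alg_const s * (X_norm s u * X_norm s v) \<le> alg_const s * (A * B)"
    using alg_const_ge_1[of s] by (intro mult_left_mono) auto
  with in_X_mult(2)[OF s assms(1,2)] show ?thesis by linarith
qed

text \<open>The weights p and q are left free because the lemma is used with constant, linear and
  polynomial weights; the common rate R factors out as i and n - i add up to n.\<close>

lemma cauchy_prod_bound:
  assumes a: "\<And>i. i \<le> n \<Longrightarrow> in_X s (a i) \<and> X_norm s (a i) \<le> A * p i * R ^ i"
    and b: "\<And>i. i \<le> n \<Longrightarrow> in_X s (b i) \<and> X_norm s (b i) \<le> B * q i * R ^ i"
  shows "in_X s (cauchy_prod a b n)"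
    and "X_norm s (cauchy_prod a b n) \<le> alg_const s * A * B * (\<Sum>i\<le>n. p i * q (n - i)) * R ^ n"
proof -
  have m: "in_X s (\<lambda>x. a i x * b (n - i) x)" if "i \<le> n" for i
    using a[OF that] b[of "n - i"] by (intro in_X_mult(1)[OF s]) auto
  have e: "(\<lambda>x. \<Sum>i\<le>n. a i x * b (n - i) x) = cauchy_prod a b n" by (simp add: cauchy_prod_def fun_eq_iff)
  show "in_X s (cauchy_prod a b n)" using in_X_sum[of "{..n}" s "\<lambda>i x. a i x * b (n - i) x"] m e by auto
  have "X_norm s (cauchy_prod a b n) \<le> (\<Sum>i\<le>n. X_norm s (\<lambda>x. a i x * b (n - i) x))"
    using in_X_sum[of "{..n}" s "\<lambda>i x. a i x * b (n - i) x"] m e by auto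
  also have "\<dots> \<le> (\<Sum>i\<le>n. alg_const s * ((A * p i * R ^ i) * (B * q (n - i) * R ^ (n - i))))"
    using a b by (intro sum_mono X_mult_bound) auto
  also have "\<dots> = (\<Sum>i\<le>n. alg_const s * A * B * (p i * q (n - i)) * R ^ n)"
  proof (rule sum.cong[OF refl])
    fix i assume "i \<in> {..n}"
    then have "R ^ n = R ^ i * R ^ (n - i)" by (simp flip: power_add)
    then show "alg_const s * ((A * p i * R ^ i) * (B * q (n - i) * R ^ (n - i))) = alg_const s * A * B * (p i * q (n - i)) * R ^ n"
      by (simp add: mult_ac)
  qed
  also have "\<dots> = alg_const s * A * B * (\<Sum>i\<le>n. p i * q (n - i)) * R ^ n"
    by (simp add: sum_distrib_left sum_distrib_right)
  finally show "X_norm s (cauchy_prod a b n) \<le> alg_const s * A * B * (\<Sum>i\<le>n. p i * q (n - i)) * R ^ n" .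
qed

text \<open>8 = 1 + 3 + 3 + 1 sums the moduli of the coefficients of the four cubic terms. Each term
  costs two products and one factor \<open>mass\<close>, either from the convolution or from the
  integral of \<alpha>.\<close>

definition growth_const :: real where "growth_const = 8 * mass * (alg_const s)\<^sup>2"

lemma growth_const_nonneg: "growth_const \<ge> 0"
  using mass_nonneg by (simp add: growth_const_def)

text \<open>The number $(n+1)(n+2)/2$ of triples with sum $n$ cancels against the factor $(n+1)(n+2)$ that
  comes from differentiating twice, so a geometric bound is reproduced by the recursion.\<close>

lemma rhs_coeff_bound:
  assumes a: "\<And>i. i \<le> n \<Longrightarrow> in_X s (a i) \<and> X_norm s (a i) \<le> M * R ^ i"
  shows "in_X s (rhs_coeff \<alpha> a n)"
    and "X_norm s (rhs_coeff \<alpha> a n) \<le> growth_const * M ^ 3 * (real (n + 1) * real (n + 2) / 2) * R ^ n"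
proof -
  define C where "C = alg_const s"
  define w where "w = real (n + 1) * real (n + 2) / 2"
  have a1: "i \<le> n \<Longrightarrow> in_X s (a i) \<and> X_norm s (a i) \<le> M * 1 * R ^ i" for i using a by simp
  have sq: "in_X s (cauchy_prod a a m) \<and> X_norm s (cauchy_prod a a m) \<le> (C * M * M) * real (m + 1) * R ^ m" if "m \<le> n" for m
    using cauchy_prod_bound[where n=m and a=a and b=a and p="\<lambda>_. 1" and q="\<lambda>_. 1" and A=M and B=M and R=R] a1 that
    by (simp add: C_def algebra_simps)
  have csq: "in_X s (conv \<alpha> (cauchy_prod a a m)) \<and> X_norm s (conv \<alpha> (cauchy_prod a a m)) \<le> (mass * (C * M * M)) * real (m + 1) * R ^ m" if "m \<le> n" for m
    using sq[OF that] X_conv(1) X_conv_bound[of "cauchy_prod a a m" "(C * M * M) * real (m + 1) * R ^ m"] by (simp add: mult.assoc)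
  have ca: "in_X s (conv \<alpha> (a m)) \<and> X_norm s (conv \<alpha> (a m)) \<le> (mass * M) * 1 * R ^ m" if "m \<le> n" for m
    using a[OF that] X_conv(1) X_conv_bound[of "a m" "M * R ^ m"] by (simp add: mult.assoc)
  have cube: "in_X s (cauchy_prod a (cauchy_prod a a) n)" "X_norm s (cauchy_prod a (cauchy_prod a a) n) \<le> (C\<^sup>2 * M ^ 3) * w * R ^ n"
    using cauchy_prod_bound[where n=n and a=a and p="\<lambda>_. 1" and A=M and R=R, OF a1 sq, unfolded mult_1_left sum_Suc_eq]
    by (simp_all add: w_def C_def power2_eq_square power3_eq_cube mult_ac)
  have t1: "in_X s (conv \<alpha> (cauchy_prod a (cauchy_prod a a) n))" "X_norm s (conv \<alpha> (cauchy_prod a (cauchy_prod a a) n)) \<le> mass * ((C\<^sup>2 * M ^ 3) * w * R ^ n)"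
    using X_conv(1)[OF cube(1)] X_conv_bound[OF cube] by auto
  have t2: "in_X s (cauchy_prod a (\<lambda>m. conv \<alpha> (cauchy_prod a a m)) n)" "X_norm s (cauchy_prod a (\<lambda>m. conv \<alpha> (cauchy_prod a a m)) n) \<le> mass * ((C\<^sup>2 * M ^ 3) * w * R ^ n)"
    using cauchy_prod_bound[where n=n and a=a and p="\<lambda>_. 1" and A=M and R=R, OF a1 csq, unfolded mult_1_left sum_Suc_eq]
    by (simp_all add: w_def C_def power2_eq_square power3_eq_cube mult_ac)
  have t3: "in_X s (cauchy_prod (cauchy_prod a a) (\<lambda>m. conv \<alpha> (a m)) n)" "X_norm s (cauchy_prod (cauchy_prod a a) (\<lambda>m. conv \<alpha> (a m)) n) \<le> mass * ((C\<^sup>2 * M ^ 3) * w * R ^ n)"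
    using cauchy_prod_bound[where n=n and R=R, OF sq ca, unfolded mult_1_right sum_Suc_eq']
    by (simp_all add: w_def C_def power2_eq_square power3_eq_cube mult_ac)
  define Q where "Q = (C\<^sup>2 * M ^ 3) * w * R ^ n"
  note m2 = in_X_cmult_le[OF t2(1), of 3] and m3 = in_X_cmult_le[OF t3(1), of 3] and m4 = in_X_cmult_le[OF cube(1), of "LINT y|lborel. \<alpha> y"]
  note d1 = in_X_diff[OF t1(1) m2(1)]
  note d2 = in_X_add[OF d1(1) m3(1)]
  note d3 = in_X_diff[OF d2(1) m4(1)]
  have e: "rhs_coeff \<alpha> a n = (\<lambda>x. conv \<alpha> (cauchy_prod a (cauchy_prod a a) n) x
     - 3 * cauchy_prod a (\<lambda>m. conv \<alpha> (cauchy_prod a a m)) n x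
     + 3 * cauchy_prod (cauchy_prod a a) (\<lambda>m. conv \<alpha> (a m)) n x
     - (LINT y|lborel. \<alpha> y) * cauchy_prod a (cauchy_prod a a) n x)"
    by (simp add: rhs_coeff_def fun_eq_iff)
  show "in_X s (rhs_coeff \<alpha> a n)" unfolding e by (rule d3(1))
  have "\<bar>LINT y|lborel. \<alpha> y\<bar> * X_norm s (cauchy_prod a (cauchy_prod a a) n) \<le> mass * Q"
    using cube(2) integral_le_mass mass_nonneg X_norm_nonneg[OF cube(1)] unfolding Q_def by (intro mult_mono) auto
  then have "X_norm s (rhs_coeff \<alpha> a n) \<le> 8 * (mass * Q)"
    unfolding e using d1(2) d2(2) d3(2) m2(2) m3(2) m4(2) t1(2) t2(2) t3(2) unfolding Q_def by simp
  then show "X_norm s (rhs_coeff \<alpha> a n) \<le> growth_const * M ^ 3 * (real (n + 1) * real (n + 2) / 2) * R ^ n"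
    by (simp add: growth_const_def Q_def w_def C_def mult_ac)
qed

text \<open>The recursion turns the bound with M into one with
  \<open>growth_const * M ^ 3 / 2\<close>, that is, M times at most R, while the index rises by two
  and allows a factor R^2; as R >= 1 there is room. Only M enters the choice of R, not the data
  themselves.\<close>

lemma series_coeff_bound:
  assumes \<phi>: "in_X s \<phi>" "X_norm s \<phi> \<le> M" and \<psi>: "in_X s \<psi>" "X_norm s \<psi> \<le> M"
    and R: "R \<ge> 1" "growth_const * M\<^sup>2 \<le> R" and M: "M \<ge> 0"
  shows "in_X s (series_coeff \<alpha> \<phi> \<psi> n) \<and> X_norm s (series_coeff \<alpha> \<phi> \<psi> n) \<le> M * R ^ n"
proof (induction n rule: less_induct)
  case (less n)
  consider "n = 0" | "n = Suc 0" | m where "n = Suc (Suc m)"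
    by (metis not0_implies_Suc)
  then show ?case
  proof cases
    case 1 then show ?thesis using \<phi> by simp
  next
    case 2 then show ?thesis using \<psi> mult_left_mono[OF R(1) M] by simp
  next
    case 3
    have "in_X s (series_coeff \<alpha> \<phi> \<psi> i) \<and> X_norm s (series_coeff \<alpha> \<phi> \<psi> i) \<le> M * R ^ i" if "i \<le> m" for i
      using less.IH[of i] that 3 by simp
    note b = rhs_coeff_bound[OF this]
    note c = in_X_cmult_le[OF b(1), where c="1 / (real (m + 1) * real (m + 2))"]
    have "X_norm s (series_coeff \<alpha> \<phi> \<psi> n) \<le> \<bar>1 / (real (m + 1) * real (m + 2))\<bar> * X_norm s (rhs_coeff \<alpha> (series_coeff \<alpha> \<phi> \<psi>) m)"
      using c(2) unfolding 3 series_coeff_Suc_Suc .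
    also have "\<dots> \<le> \<bar>1 / (real (m + 1) * real (m + 2))\<bar> * (growth_const * M ^ 3 * (real (m + 1) * real (m + 2) / 2) * R ^ m)"
      by (rule mult_left_mono[OF b(2) abs_ge_zero])
    also have "\<dots> = (growth_const * M\<^sup>2) * (M * R ^ m) / 2"
      by (simp add: power2_eq_square power3_eq_cube)
    also have "\<dots> \<le> (growth_const * M\<^sup>2) * (M * R ^ m)"
      using growth_const_nonneg M R(1) by simp
    also have "\<dots> \<le> R\<^sup>2 * (M * R ^ m)"
    proof (rule mult_right_mono)
      have "R * 1 \<le> R * R" using R(1) by (intro mult_left_mono) auto
      then show "growth_const * M\<^sup>2 \<le> R\<^sup>2" using R(2) by (simp add: power2_eq_square)
    qed (use M R(1) in simp)
    also have "\<dots> = M * R ^ n" by (simp add: 3 power2_eq_square)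
    finally show ?thesis using c(1) unfolding 3 series_coeff_Suc_Suc by simp
  qed
qed

text \<open>The polynomial factor makes the class closed under Cauchy products and termwise
  differentiation at the same rate R, so one interval [0, T] serves all series involved.\<close>

definition growth :: "real \<Rightarrow> (nat \<Rightarrow> real \<Rightarrow> real) \<Rightarrow> bool" where
  "growth R a \<longleftrightarrow> (\<exists>B k. B \<ge> 0 \<and> (\<forall>n. in_X s (a n) \<and> X_norm s (a n) \<le> B * real (n + 1) ^ k * R ^ n))"

lemma growth_in_X: "growth R a \<Longrightarrow> in_X s (a n)"
  by (auto simp: growth_def)

lemma in_X_cmult_right:
  assumes "in_X s u"
  shows "in_X s (\<lambda>x. u x * c)" "X_norm s (\<lambda>x. u x * c) \<le> X_norm s u * \<bar>c\<bar>"
  using in_X_cmult_le[OF assms, of c] by (simp_all add: mult.commute)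

lemma growth_conv: "growth R a \<Longrightarrow> growth R (\<lambda>n. conv \<alpha> (a n))"
proof -
  assume "growth R a"
  then obtain B k where B: "B \<ge> 0" and a: "\<And>n. in_X s (a n)" "\<And>n. X_norm s (a n) \<le> B * real (n + 1) ^ k * R ^ n"
    unfolding growth_def by blast
  have "X_norm s (conv \<alpha> (a n)) \<le> (mass * B) * real (n + 1) ^ k * R ^ n" for n
    using X_conv_bound[OF a(1) a(2)[of n]] by (simp add: mult.assoc)
  then show ?thesis unfolding growth_def using X_conv(1)[OF a(1)] B mass_nonneg
    by (intro exI[of _ "mass * B"] exI[of _ k]) auto
qed

section \<open>Series in time on a fixed interval\<close>

context
  fixes R T :: real
  assumes R: "R > 0" and T: "T > 0" and RT: "R * T \<le> 1 / 2"
begin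

lemma growth_cauchy_prod:
  assumes "growth R a" "growth R b"
  shows "growth R (cauchy_prod a b)"
proof -
  obtain A k where A: "A \<ge> 0" and a: "\<And>n. in_X s (a n) \<and> X_norm s (a n) \<le> A * real (n + 1) ^ k * R ^ n"
    using assms(1) unfolding growth_def by blast
  obtain B l where B: "B \<ge> 0" and b: "\<And>n. in_X s (b n) \<and> X_norm s (b n) \<le> B * real (n + 1) ^ l * R ^ n"
    using assms(2) unfolding growth_def by blast
  note P = cauchy_prod_bound[where p="\<lambda>i. real (i + 1) ^ k" and q="\<lambda>i. real (i + 1) ^ l", OF a b]
  have "X_norm s (cauchy_prod a b n) \<le> (alg_const s * A * B) * real (n + 1) ^ (k + l + 1) * R ^ n" for n
  proof -
    have "(\<Sum>i\<le>n. real (i + 1) ^ k * real (n - i + 1) ^ l) \<le> (\<Sum>i\<le>n. real (n + 1) ^ k * real (n + 1) ^ l)"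
      by (intro sum_mono mult_mono power_mono) auto
    also have "\<dots> = real (n + 1) ^ (k + l + 1)" by (simp add: power_add algebra_simps)
    finally have "(alg_const s * A * B) * (\<Sum>i\<le>n. real (i + 1) ^ k * real (n - i + 1) ^ l) * R ^ n
        \<le> (alg_const s * A * B) * real (n + 1) ^ (k + l + 1) * R ^ n"
      using A B alg_const_ge_1[of s] R by (intro mult_right_mono mult_left_mono) auto
    with P(2)[of n] show ?thesis by linarith
  qed
  then show ?thesis
    unfolding growth_def using P(1) A B alg_const_ge_1[of s]
    by (intro exI[of _ "alg_const s * A * B"] exI[of _ "k + l + 1"]) auto
qed

lemma growth_shift:
  assumes "growth R a"
  shows "growth R (\<lambda>n x. real (n + 1) * a (n + 1) x)"
proof -
  obtain A k where A: "A \<ge> 0" and a: "\<And>n. in_X s (a n)" "\<And>n. X_norm s (a n) \<le> A * real (n + 1) ^ k * R ^ n"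
    using assms(1) unfolding growth_def by blast
  have "X_norm s (\<lambda>x. real (n + 1) * a (n + 1) x) \<le> (A * 2 ^ k * R) * real (n + 1) ^ (k + 1) * R ^ n" for n
  proof -
    have "X_norm s (\<lambda>x. real (n + 1) * a (n + 1) x) \<le> real (n + 1) * X_norm s (a (n + 1))"
      using in_X_cmult_le(2)[OF a(1)[of "n + 1"], of "real (n + 1)"] by simp
    also have "\<dots> \<le> real (n + 1) * (A * real (n + 1 + 1) ^ k * R ^ (n + 1))"
      by (intro mult_left_mono a(2)) simp
    also have "\<dots> \<le> real (n + 1) * (A * (2 * real (n + 1)) ^ k * R ^ (n + 1))"
      using A R by (intro mult_left_mono mult_right_mono power_mono) auto
    also have "\<dots> = (A * 2 ^ k * R) * real (n + 1) ^ (k + 1) * R ^ n"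
      by (simp only: power_mult_distrib power_add power_one_right mult_ac)
    finally show ?thesis .
  qed
  then show ?thesis
    unfolding growth_def using in_X_cmult_le(1)[OF a(1)] A R
    by (intro exI[of _ "A * 2 ^ k * R"] exI[of _ "k + 1"]) auto
qed

text \<open>The first series dominates the values. The second is the coefficient of the first order
  error of the difference quotient, with the weight supplied by
  \<open>lemma_termdiff3\<close>.\<close>

lemma growth_summable:
  assumes "growth R a"
  shows "0 \<le> t \<Longrightarrow> t \<le> T \<Longrightarrow> summable (\<lambda>n. X_norm s (a n) * t ^ n)"
    and "summable (\<lambda>n. X_norm s (a n) * (real n * real (n - Suc 0) * T ^ (n - 2)))"
proof -
  obtain A k where A: "A \<ge> 0" and a: "\<And>n. in_X s (a n)" "\<And>n. X_norm s (a n) \<le> A * real (n + 1) ^ k * R ^ n"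
    using assms(1) unfolding growth_def by blast
  have le: "X_norm s (a n) * t ^ n \<le> A * (real (n + 1) ^ k * (1 / 2) ^ n)" if t: "0 \<le> t" "t \<le> T" for t n
  proof -
    have "X_norm s (a n) * t ^ n \<le> A * real (n + 1) ^ k * R ^ n * t ^ n"
      using t by (intro mult_right_mono a) auto
    also have "\<dots> = A * real (n + 1) ^ k * (R * t) ^ n" by (simp add: power_mult_distrib)
    also have "\<dots> \<le> A * real (n + 1) ^ k * (1 / 2) ^ n"
    proof (intro mult_left_mono power_mono)
      show "R * t \<le> 1 / 2" using t R RT mult_left_mono[of t T R] by linarith
    qed (use A R t in auto)
    finally show ?thesis by (simp add: mult.assoc)
  qed
  show "summable (\<lambda>n. X_norm s (a n) * t ^ n)" if t: "0 \<le> t" "t \<le> T"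
    by (rule summable_comparison_test'[OF summable_mult[OF summable_poly_half[of k], of A]])
      (use le[OF t] X_norm_nonneg[OF a(1)] t in \<open>auto simp: abs_mult\<close>)
  have le2: "X_norm s (a n) * (real n * real (n - Suc 0) * T ^ (n - 2)) \<le> (A / T\<^sup>2) * (real (n + 1) ^ (k + 2) * (1 / 2) ^ n)" for n
  proof (cases "n < 2")
    \<comment> \<open>Here n - 2 is truncated to 0, but the factor n (n - 1) vanishes.\<close>
    case True
    then have e: "real n * real (n - Suc 0) = 0" by (cases n) auto
    show ?thesis unfolding e using A by simp
  next
    case False
    then have p: "T ^ (n - 2) = T ^ n / T\<^sup>2" using T by (simp add: power_diff)
    have "real n * real (n - Suc 0) \<le> real (n + 1) * real (n + 1)" by (intro mult_mono) auto
    then have "(real n * real (n - Suc 0)) * (X_norm s (a n) * T ^ n / T\<^sup>2) \<le> (real (n + 1))\<^sup>2 * (A * (real (n + 1) ^ k * (1 / 2) ^ n) / T\<^sup>2)"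
      using T X_norm_nonneg[OF a(1)[of n]] by (intro mult_mono divide_right_mono le) (auto simp: power2_eq_square)
    then show ?thesis by (simp add: p power_add power2_eq_square mult_ac)
  qed
  show "summable (\<lambda>n. X_norm s (a n) * (real n * real (n - Suc 0) * T ^ (n - 2)))"
    by (rule summable_comparison_test'[OF summable_mult[OF summable_poly_half[of "k + 2"], of "A / T\<^sup>2"]])
      (use le2 X_norm_nonneg[OF a(1)] T in \<open>auto simp: abs_mult\<close>)
qed

lemma time_series_in_X:
  assumes a: "growth R a" and t: "0 \<le> t" "t \<le> T"
  shows "AE x in lborel. summable (\<lambda>n. \<bar>a n x * t ^ n\<bar>)"
    and "in_X s (time_series a t)"
    and "X_norm s (time_series a t) \<le> (\<Sum>n. X_norm s (a n) * t ^ n)"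
proof -
  note m = in_X_cmult_right[OF growth_in_X[OF a]]
  have n: "X_norm s (\<lambda>x. a n x * t ^ n) \<le> X_norm s (a n) * t ^ n" for n
    using in_X_cmult_right(2)[OF growth_in_X[OF a, of n], of "t ^ n"] t by simp
  note S = growth_summable(1)[OF a t]
  have S': "summable (\<lambda>n. X_norm s (\<lambda>x. a n x * t ^ n))"
    by (rule summable_comparison_test'[OF S]) (use n X_norm_nonneg[OF m(1)] in auto)
  note P = in_X_suminf[OF s m(1) S']
  show "AE x in lborel. summable (\<lambda>n. \<bar>a n x * t ^ n\<bar>)" by (rule P(1))
  show "in_X s (time_series a t)" using P(2) by (simp add: time_series_def[abs_def])
  show "X_norm s (time_series a t) \<le> (\<Sum>n. X_norm s (a n) * t ^ n)"
    using P(3) suminf_le[OF n S' S] by (simp add: time_series_def[abs_def])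
qed

lemma time_series_cauchy_prod:
  assumes a: "growth R a" and b: "growth R b" and t: "0 \<le> t" "t \<le> T"
  shows "AE x in lborel. time_series (cauchy_prod a b) t x = time_series a t x * time_series b t x"
  using time_series_in_X(1)[OF a t] time_series_in_X(1)[OF b t]
proof eventually_elim
  case (elim x)
  have "(\<lambda>n. \<Sum>i\<le>n. (a i x * t ^ i) * (b (n - i) x * t ^ (n - i))) sums ((\<Sum>n. a n x * t ^ n) * (\<Sum>n. b n x * t ^ n))"
    by (rule Cauchy_product_sums) (use elim in auto)
  moreover have "(\<Sum>i\<le>n. (a i x * t ^ i) * (b (n - i) x * t ^ (n - i))) = cauchy_prod a b n x * t ^ n" for n
    unfolding cauchy_prod_def sum_distrib_right
  proof (rule sum.cong[OF refl])
    fix i assume "i \<in> {..n}"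
    then have "t ^ n = t ^ i * t ^ (n - i)" by (simp flip: power_add)
    then show "(a i x * t ^ i) * (b (n - i) x * t ^ (n - i)) = a i x * b (n - i) x * t ^ n" by (simp add: mult_ac)
  qed
  ultimately show ?case by (simp add: time_series_def sums_iff)
qed

text \<open>Holds at every x, since the integral ignores the null set on which the series diverges.
  Sum and integral are exchanged because the integrals of the norms are at most \<open>mass\<close>
  times a summable sequence.\<close>

lemma time_series_conv:
  assumes a: "growth R a" and t: "0 \<le> t" "t \<le> T"
  shows "time_series (\<lambda>n. conv \<alpha> (a n)) t x = conv \<alpha> (time_series a t) x"
proof -
  note aX = growth_in_X[OF a]
  note [measurable] = in_XD(3)[OF aX]
  have [measurable]: "\<alpha> \<in> borel_measurable borel" using \<alpha> by auto
  have bd: "AE y in lborel. norm (a n y) \<le> X_norm s (a n)" for n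
    using Linf_norm_props(1)[OF in_XD(2)[OF aX]] by eventually_elim (use X_norm_parts[OF aX] in \<open>auto intro: order_trans\<close>)
  have i: "integrable lborel (\<lambda>y. \<alpha> (y - x) * a n y)" for n
    by (rule integrable_conv(1)[OF \<alpha> _ bd]) simp
  have i': "integrable lborel (\<lambda>y. \<alpha> (y - x) * a n y * t ^ n)" for n
    using i by simp
  have "norm (LINT y|lborel. \<bar>\<alpha> (y - x)\<bar> * \<bar>a n y\<bar>) \<le> mass * X_norm s (a n)" for n
    using integrable_conv(2)[where V="\<lambda>y. \<bar>\<alpha> y\<bar>" and v="\<lambda>y. \<bar>a n y\<bar>" and C="X_norm s (a n)" and x=x] \<alpha> bd by (simp add: mass_def)
  then have le: "(LINT y|lborel. \<bar>\<alpha> (y - x)\<bar> * \<bar>a n y\<bar>) \<le> mass * X_norm s (a n)" for n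
    unfolding real_norm_def by (rule abs_le_D1)
  have "(LINT y|lborel. (\<Sum>n. \<alpha> (y - x) * a n y * t ^ n)) = (\<Sum>n. LINT y|lborel. \<alpha> (y - x) * a n y * t ^ n)"
  proof (rule integral_suminf[OF i'])
    show "AE y in lborel. summable (\<lambda>n. norm (\<alpha> (y - x) * a n y * t ^ n))"
      using time_series_in_X(1)[OF a t]
    proof eventually_elim
      case (elim y)
      then have "summable (\<lambda>n. \<bar>\<alpha> (y - x)\<bar> * \<bar>a n y * t ^ n\<bar>)" by (rule summable_mult)
      then show ?case by (simp add: abs_mult mult.assoc)
    qed
    show "summable (\<lambda>n. LINT y|lborel. norm (\<alpha> (y - x) * a n y * t ^ n))"
    proof (rule summable_comparison_test'[OF summable_mult[OF growth_summable(1)[OF a t], of mass]])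
      fix n
      have "(LINT y|lborel. norm (\<alpha> (y - x) * a n y * t ^ n)) = (LINT y|lborel. \<bar>\<alpha> (y - x)\<bar> * \<bar>a n y\<bar>) * t ^ n"
        using t by (simp add: abs_mult)
      then show "norm (LINT y|lborel. norm (\<alpha> (y - x) * a n y * t ^ n)) \<le> mass * (X_norm s (a n) * t ^ n)"
        using mult_right_mono[OF le[of n], of "t ^ n"] t by (simp add: mult.assoc abs_mult)
    qed
  qed
  also have "(LINT y|lborel. (\<Sum>n. \<alpha> (y - x) * a n y * t ^ n)) = conv \<alpha> (time_series a t) x"
    unfolding conv_def
  proof (rule integral_cong_AE)
    show "AE y in lborel. (\<Sum>n. \<alpha> (y - x) * a n y * t ^ n) = \<alpha> (y - x) * time_series a t y"
      using time_series_in_X(1)[OF a t]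
      by eventually_elim (simp add: time_series_def mult.assoc suminf_mult summable_rabs_cancel)
    show "(\<lambda>y. \<alpha> (y - x) * time_series a t y) \<in> borel_measurable lborel"
      using in_XD(3)[OF time_series_in_X(2)[OF a t]] by measurable
  qed measurable
  finally show ?thesis by (simp add: time_series_def conv_def)
qed

lemma conv_cong_AE:
  assumes [measurable]: "u \<in> borel_measurable borel" "v \<in> borel_measurable borel" and e: "AE x in lborel. u x = v x"
  shows "conv \<alpha> u = conv \<alpha> v"
proof
  fix x
  have [measurable]: "\<alpha> \<in> borel_measurable borel" using \<alpha> by auto
  show "conv \<alpha> u x = conv \<alpha> v x"
    unfolding conv_def using e by (intro integral_cong_AE) auto
qed

lemma time_series_rhs:
  assumes a: "growth R a" and t: "0 \<le> t" "t \<le> T"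
  shows "AE x in lborel. time_series (rhs_coeff \<alpha> a) t x = rhs \<alpha> (time_series a t) x"
proof -
  define u where "u = time_series a t"
  have uX: "in_X s u" unfolding u_def by (rule time_series_in_X(2)[OF a t])
  note [measurable] = in_XD(3)[OF uX]
  note g2 = growth_cauchy_prod[OF a a]
  note g3 = growth_cauchy_prod[OF a g2]
  note gc3 = growth_conv[OF g3] and gc2 = growth_conv[OF g2] and gc1 = growth_conv[OF a]
  note gB = growth_cauchy_prod[OF a gc2] and gC = growth_cauchy_prod[OF g2 gc1]
  note m2 = in_XD(3)[OF time_series_in_X(2)[OF g2 t]] and m3 = in_XD(3)[OF time_series_in_X(2)[OF g3 t]]
  have e2: "AE x in lborel. time_series (cauchy_prod a a) t x = (u x)\<^sup>2"
    using time_series_cauchy_prod[OF a a t] by eventually_elim (simp add: u_def power2_eq_square)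
  have e3: "AE x in lborel. time_series (cauchy_prod a (cauchy_prod a a)) t x = (u x) ^ 3"
    using time_series_cauchy_prod[OF a g2 t] e2 by eventually_elim (simp add: u_def power2_eq_square power3_eq_cube)
  have c2: "conv \<alpha> (time_series (cauchy_prod a a) t) = conv \<alpha> (\<lambda>y. (u y)\<^sup>2)"
    by (rule conv_cong_AE[OF m2 _ e2]) measurable
  have c3: "conv \<alpha> (time_series (cauchy_prod a (cauchy_prod a a)) t) = conv \<alpha> (\<lambda>y. (u y) ^ 3)"
    by (rule conv_cong_AE[OF m3 _ e3]) measurable
  show ?thesis
    \<comment> \<open>All exceptional null sets are collected here; outside their union only the
      algebra of convergent numerical series remains.\<close>
    using time_series_in_X(1)[OF g3 t] time_series_in_X(1)[OF gc3 t] time_series_in_X(1)[OF gB t] time_series_in_X(1)[OF gC t]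
      e2 e3 time_series_cauchy_prod[OF a gc2 t] time_series_cauchy_prod[OF g2 gc1 t]
  proof eventually_elim
    case (elim x)
    note S = elim(1-4)[THEN summable_rabs_cancel]
    have "time_series (rhs_coeff \<alpha> a) t x = (\<Sum>n. (conv \<alpha> (cauchy_prod a (cauchy_prod a a) n) x * t ^ n
     - 3 * (cauchy_prod a (\<lambda>m. conv \<alpha> (cauchy_prod a a m)) n x * t ^ n))
     + 3 * (cauchy_prod (cauchy_prod a a) (\<lambda>m. conv \<alpha> (a m)) n x * t ^ n)
     - (LINT y|lborel. \<alpha> y) * (cauchy_prod a (cauchy_prod a a) n x * t ^ n))"
      unfolding time_series_def rhs_coeff_def by (simp add: algebra_simps)
    also have "\<dots> = time_series (\<lambda>n. conv \<alpha> (cauchy_prod a (cauchy_prod a a) n)) t x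
       - 3 * time_series (cauchy_prod a (\<lambda>m. conv \<alpha> (cauchy_prod a a m))) t x
       + 3 * time_series (cauchy_prod (cauchy_prod a a) (\<lambda>m. conv \<alpha> (a m))) t x
       - (LINT y|lborel. \<alpha> y) * time_series (cauchy_prod a (cauchy_prod a a)) t x"
      unfolding time_series_def using S
      by (simp add: suminf_mult summable_mult summable_diff summable_add flip: suminf_diff suminf_add)
    also have "\<dots> = rhs \<alpha> u x"
      unfolding rhs_def elim(5-8) time_series_conv[OF g3 t] time_series_conv[OF g2 t] time_series_conv[OF a t] c2 c3
      by (simp add: u_def)
    finally show ?case by (simp add: u_def)
  qed
qed

text \<open>For each power of t the difference quotient deviates from the derivative by at most n (n
  - 1) T^(n-2) |h|. Summing against the norms of the coefficients gives an error D |h| in X.\<close>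

lemma X_deriv_time_series:
  assumes a: "growth R a"
  shows "X_deriv s T (time_series a) (time_series (\<lambda>n x. real (n + 1) * a (n + 1) x))"
  unfolding X_deriv_def
proof (intro ballI allI impI)
  fix t \<epsilon> :: real assume t: "t \<in> {0..T}" and \<epsilon>: "\<epsilon> > 0"
  note aX = growth_in_X[OF a]
  define b where "b n x = real (n + 1) * a (n + 1) x" for n x
  have gb: "growth R b" unfolding b_def by (rule growth_shift[OF a])
  define D where "D = (\<Sum>n. X_norm s (a n) * (real n * real (n - Suc 0) * T ^ (n - 2)))"
  have D: "D \<ge> 0" unfolding D_def by (intro suminf_nonneg growth_summable(2)[OF a]) (use X_norm_nonneg[OF aX] T in auto)
  show "\<exists>\<delta>>0. \<forall>t'\<in>{0..T}. t' \<noteq> t \<and> \<bar>t' - t\<bar> < \<delta> \<longrightarrow> X_norm s (\<lambda>x. (time_series a t' x - time_series a t x) / (t' - t) - time_series (\<lambda>n x. real (n + 1) * a (n + 1) x) t x) < \<epsilon>"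
  \<comment> \<open>D may be 0, hence the denominator D + 1.\<close>
  proof (intro exI[of _ "\<epsilon> / (D + 1)"] conjI ballI impI)
    show "0 < \<epsilon> / (D + 1)" using \<epsilon> D by simp
    fix t' assume t': "t' \<in> {0..T}" and h': "t' \<noteq> t \<and> \<bar>t' - t\<bar> < \<epsilon> / (D + 1)"
    have tt: "0 \<le> t" "t \<le> T" "0 \<le> t'" "t' \<le> T" using t t' by auto
    define h where "h = t' - t"
    have h: "h \<noteq> 0" "\<bar>h\<bar> < \<epsilon> / (D + 1)" using h' by (auto simp: h_def)
    define q where "q n = (t' ^ n - t ^ n) / h - real n * t ^ (n - Suc 0)" for n
    have q: "\<bar>q n\<bar> \<le> real n * real (n - Suc 0) * T ^ (n - 2) * \<bar>h\<bar>" for n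
      using lemma_termdiff3[of h t T n] h(1) t t' unfolding q_def by (simp add: h_def)
    note m = in_X_cmult_right[OF aX]
    have nq: "X_norm s (\<lambda>x. a n x * q n) \<le> (X_norm s (a n) * (real n * real (n - Suc 0) * T ^ (n - 2))) * \<bar>h\<bar>" for n
      using order_trans[OF m(2) mult_left_mono[OF q X_norm_nonneg[OF aX]], of n] by (simp add: mult.assoc)
    note S = summable_mult2[OF growth_summable(2)[OF a], of "\<bar>h\<bar>"]
    have S': "summable (\<lambda>n. X_norm s (\<lambda>x. a n x * q n))"
      by (rule summable_comparison_test'[OF S]) (use nq X_norm_nonneg[OF m(1)] in auto)
    note P = in_X_suminf[OF s m(1) S']
    have "X_norm s (\<lambda>x. \<Sum>n. a n x * q n) \<le> (\<Sum>n. (X_norm s (a n) * (real n * real (n - Suc 0) * T ^ (n - 2))) * \<bar>h\<bar>)"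
      using P(3) suminf_le[OF nq S' S] by simp
    also have "\<dots> = D * \<bar>h\<bar>"
      unfolding D_def by (rule suminf_mult2[symmetric, OF growth_summable(2)[OF a]])
    finally have le: "X_norm s (\<lambda>x. \<Sum>n. a n x * q n) \<le> D * \<bar>h\<bar>" .
    have eq: "AE x in lborel. (\<Sum>n. a n x * q n) = (time_series a t' x - time_series a t x) / (t' - t) - time_series b t x"
      using time_series_in_X(1)[OF a tt(1,2)] time_series_in_X(1)[OF a tt(3,4)] time_series_in_X(1)[OF gb tt(1,2)]
    proof eventually_elim
      case (elim x)
      have s1: "summable (\<lambda>n. a n x * t ^ n)" "summable (\<lambda>n. a n x * t' ^ n)" "summable (\<lambda>n. b n x * t ^ n)"
        using elim[THEN summable_rabs_cancel] t t' by auto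
      \<comment> \<open>The term with n = 0 vanishes, so shifting the index by one turns the series
        of b into the termwise derivative.\<close>
      have s2: "(\<lambda>n. a n x * (real n * t ^ (n - Suc 0))) sums (\<Sum>n. b n x * t ^ n)"
      proof -
        have "(\<lambda>n. a (Suc n) x * (real (Suc n) * t ^ (Suc n - Suc 0))) sums (\<Sum>n. b n x * t ^ n)"
          using summable_sums[OF s1(3)] by (simp add: b_def mult_ac)
        then show ?thesis using sums_Suc_iff[of "\<lambda>n. a n x * (real n * t ^ (n - Suc 0))"] by simp
      qed
      have "(\<lambda>n. (a n x * t' ^ n - a n x * t ^ n) / h - a n x * (real n * t ^ (n - Suc 0))) sums
          ((time_series a t' x - time_series a t x) / h - time_series b t x)"
        unfolding time_series_def
        by (intro sums_diff sums_divide summable_sums s1 s2)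
      moreover have "(a n x * t' ^ n - a n x * t ^ n) / h - a n x * (real n * t ^ (n - Suc 0)) = a n x * q n" for n
        by (simp add: q_def algebra_simps diff_divide_distrib)
      ultimately show ?case by (simp add: sums_iff h_def)
    qed
    have "X_norm s (\<lambda>x. (time_series a t' x - time_series a t x) / (t' - t) - time_series b t x) = X_norm s (\<lambda>x. \<Sum>n. a n x * q n)"
    proof (rule in_X_cong_AE(2)[OF P(2) _ eq])
      show "(\<lambda>x. (time_series a t' x - time_series a t x) / (t' - t) - time_series b t x) \<in> borel_measurable borel"
        by (intro borel_measurable_diff borel_measurable_divide borel_measurable_const
            in_XD(3)[OF time_series_in_X(2)[OF a tt(1,2)]] in_XD(3)[OF time_series_in_X(2)[OF a tt(3,4)]]
            in_XD(3)[OF time_series_in_X(2)[OF gb tt(1,2)]])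
    qed
    also have "\<dots> \<le> D * \<bar>h\<bar>" by (rule le)
    also have "\<dots> \<le> (D + 1) * \<bar>h\<bar>" by (simp add: mult_right_mono)
    also have "\<dots> < \<epsilon>" using h(2) D by (simp add: field_simps)
    finally show "X_norm s (\<lambda>x. (time_series a t' x - time_series a t x) / (t' - t) - time_series (\<lambda>n x. real (n + 1) * a (n + 1) x) t x) < \<epsilon>"
      by (simp add: b_def[abs_def])
  qed
qed

end

subsection \<open>Stability and well-posedness\<close>

lemma conv_diff:
  assumes u: "in_X s u" and v: "in_X s v"
  shows "conv \<alpha> (\<lambda>y. u y - v y) x = conv \<alpha> u x - conv \<alpha> v x"
proof -
  have "integrable lborel (\<lambda>y. \<alpha> (y - x) * u y)" "integrable lborel (\<lambda>y. \<alpha> (y - x) * v y)"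
    using Linf_norm_props(1)[OF in_XD(2)[OF u]] Linf_norm_props(1)[OF in_XD(2)[OF v]]
    by (auto intro!: integrable_conv(1)[OF \<alpha>] in_XD(3)[OF u] in_XD(3)[OF v])
  then show ?thesis by (simp add: conv_def right_diff_distrib)
qed

text \<open>The difference telescopes by replacing one argument at a time, giving three terms with w
  = u - v in the first, second and third slot.\<close>

lemma trilinear_diff:
  assumes N: "\<And>a b c. in_X s a \<Longrightarrow> in_X s b \<Longrightarrow> in_X s c \<Longrightarrow> in_X s (N a b c)"
    and Nb: "\<And>a b c. in_X s a \<Longrightarrow> in_X s b \<Longrightarrow> in_X s c \<Longrightarrow> X_norm s (N a b c) \<le> K * (X_norm s a * X_norm s b * X_norm s c)"
    and l1: "\<And>a a' b c. in_X s a \<Longrightarrow> in_X s a' \<Longrightarrow> in_X s b \<Longrightarrow> in_X s c \<Longrightarrow> N (\<lambda>x. a x - a' x) b c = (\<lambda>x. N a b c x - N a' b c x)"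
    and l2: "\<And>a a' b c. in_X s a \<Longrightarrow> in_X s a' \<Longrightarrow> in_X s b \<Longrightarrow> in_X s c \<Longrightarrow> N b (\<lambda>x. a x - a' x) c = (\<lambda>x. N b a c x - N b a' c x)"
    and l3: "\<And>a a' b c. in_X s a \<Longrightarrow> in_X s a' \<Longrightarrow> in_X s b \<Longrightarrow> in_X s c \<Longrightarrow> N b c (\<lambda>x. a x - a' x) = (\<lambda>x. N b c a x - N b c a' x)"
    and u: "in_X s u" "X_norm s u \<le> M" and v: "in_X s v" "X_norm s v \<le> M" and K: "K \<ge> 0"
  shows "X_norm s (\<lambda>x. N u u u x - N v v v x) \<le> 3 * K * M\<^sup>2 * X_norm s (\<lambda>x. u x - v x)"
proof -
  define w where "w x = u x - v x" for x
  have w: "in_X s w" unfolding w_def by (rule in_X_diff[OF u(1) v(1)])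
  have e: "(\<lambda>x. N u u u x - N v v v x) = (\<lambda>x. (N w u u x + N v w u x) + N v v w x)"
    unfolding w_def l1[OF u(1) v(1) u(1) u(1)] l2[OF u(1) v(1) v(1) u(1)] l3[OF u(1) v(1) v(1) v(1)] by simp
  have M: "M \<ge> 0" using u X_norm_nonneg[OF u(1)] by linarith
  have n: "0 \<le> X_norm s u" "0 \<le> X_norm s v" "0 \<le> X_norm s w" using X_norm_nonneg u v w by auto
  have uu: "X_norm s u * X_norm s u \<le> M\<^sup>2" "X_norm s v * X_norm s u \<le> M\<^sup>2" "X_norm s v * X_norm s v \<le> M\<^sup>2"
    unfolding power2_eq_square using u v n M by (auto intro!: mult_mono)
  have b: "K * (p * X_norm s w) \<le> K * M\<^sup>2 * X_norm s w" if "p \<le> M\<^sup>2" for p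
    using that n(3) K by (simp add: mult.assoc mult_left_mono mult_right_mono)
  have b1: "X_norm s (N w u u) \<le> K * M\<^sup>2 * X_norm s w"
    using Nb[OF w u(1) u(1)] b[OF uu(1)] by (simp add: mult_ac)
  have b2: "X_norm s (N v w u) \<le> K * M\<^sup>2 * X_norm s w"
    using Nb[OF v(1) w u(1)] b[OF uu(2)] by (simp add: mult_ac)
  have b3: "X_norm s (N v v w) \<le> K * M\<^sup>2 * X_norm s w"
    using Nb[OF v(1) v(1) w] b[OF uu(3)] by (simp add: mult_ac)
  note N1 = N[OF w u(1) u(1)] and N2 = N[OF v(1) w u(1)] and N3 = N[OF v(1) v(1) w]
  have "X_norm s (\<lambda>x. N u u u x - N v v v x) \<le> 3 * (K * M\<^sup>2 * X_norm s w)"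
    unfolding e using in_X_add(2)[OF in_X_add(1)[OF N1 N2] N3] in_X_add(2)[OF N1 N2] b1 b2 b3 by linarith
  then show ?thesis by (simp add: w_def[abs_def] mult.assoc)
qed

text \<open>24 is 8, the sum of the moduli of the coefficients in \<open>rhs\<close>, times the
  three terms of \<open>trilinear_diff\<close>.\<close>

definition lip :: "real \<Rightarrow> real" where
  "lip M = 24 * (mass * (alg_const s)\<^sup>2) * M\<^sup>2"

lemma lip_nonneg: "lip M \<ge> 0"
  using mass_nonneg by (simp add: lip_def)

lemma rhs_X:
  shows "in_X s u \<Longrightarrow> in_X s (rhs \<alpha> u)"
    and "in_X s u \<Longrightarrow> in_X s v \<Longrightarrow> X_norm s u \<le> M \<Longrightarrow> X_norm s v \<le> M \<Longrightarrow>
      X_norm s (\<lambda>x. rhs \<alpha> u x - rhs \<alpha> v x) \<le> lip M * X_norm s (\<lambda>x. u x - v x)"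
proof -
  define C where "C = alg_const s"
  have C: "C \<ge> 1" unfolding C_def by (rule alg_const_ge_1)
  define N1 where "N1 a b c = conv \<alpha> (\<lambda>y. a y * b y * c y)" for a b c
  define N2 where "N2 a b c x = a x * conv \<alpha> (\<lambda>y. b y * c y) x" for a b c x
  define N3 where "N3 a b c x = (a x * b x) * conv \<alpha> c x" for a b c x
  define N4 :: "(real \<Rightarrow> real) \<Rightarrow> (real \<Rightarrow> real) \<Rightarrow> (real \<Rightarrow> real) \<Rightarrow> real \<Rightarrow> real"
    where "N4 a b c x = (a x * b x) * c x" for a b c x
  define A where "A = (LINT y|lborel. \<alpha> y)"
  define K where "K = mass * C\<^sup>2"
  have K: "K \<ge> 0" using mass_nonneg by (simp add: K_def)
  have p2: "in_X s (\<lambda>x. a x * b x)" "X_norm s (\<lambda>x. a x * b x) \<le> C * (X_norm s a * X_norm s b)"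
    if "in_X s a" "in_X s b" for a b
    using in_X_mult[OF s that] by (auto simp: C_def)
  have p3: "in_X s (N4 a b c)" "X_norm s (N4 a b c) \<le> C\<^sup>2 * (X_norm s a * X_norm s b * X_norm s c)"
    if "in_X s a" "in_X s b" "in_X s c" for a b c
    using p2(1)[OF p2(1)[OF that(1,2)] that(3)] X_mult_bound[OF p2(1)[OF that(1,2)] that(3) p2(2)[OF that(1,2)] order_refl]
    by (simp_all add: N4_def[abs_def] C_def power2_eq_square mult_ac)
  have n1: "in_X s (N1 a b c)" "X_norm s (N1 a b c) \<le> K * (X_norm s a * X_norm s b * X_norm s c)"
    if "in_X s a" "in_X s b" "in_X s c" for a b c
    using X_conv(1)[OF p3(1)[OF that]] X_conv_bound[OF p3[OF that]]
    by (simp_all add: N1_def N4_def[abs_def] K_def mult_ac)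
  have n2: "in_X s (N2 a b c)" "X_norm s (N2 a b c) \<le> K * (X_norm s a * X_norm s b * X_norm s c)"
    if "in_X s a" "in_X s b" "in_X s c" for a b c
  proof -
    note q = p2[OF that(2,3)]
    show "in_X s (N2 a b c)" unfolding N2_def by (rule p2(1)[OF that(1) X_conv(1)[OF q(1)]])
    have "X_norm s (N2 a b c) \<le> alg_const s * (X_norm s a * (mass * (C * (X_norm s b * X_norm s c))))"
      unfolding N2_def by (rule X_mult_bound[OF that(1) X_conv(1)[OF q(1)] order_refl X_conv_bound[OF q]])
    then show "X_norm s (N2 a b c) \<le> K * (X_norm s a * X_norm s b * X_norm s c)"
      by (simp add: K_def C_def power2_eq_square mult_ac)
  qed
  have n3: "in_X s (N3 a b c)" "X_norm s (N3 a b c) \<le> K * (X_norm s a * X_norm s b * X_norm s c)"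
    if "in_X s a" "in_X s b" "in_X s c" for a b c
  proof -
    note q = p2[OF that(1,2)]
    show "in_X s (N3 a b c)" unfolding N3_def by (rule p2(1)[OF q(1) X_conv(1)[OF that(3)]])
    have "X_norm s (N3 a b c) \<le> alg_const s * (C * (X_norm s a * X_norm s b) * (mass * X_norm s c))"
      unfolding N3_def by (rule X_mult_bound[OF q(1) X_conv(1)[OF that(3)] q(2) X_conv(2)[OF that(3)]])
    then show "X_norm s (N3 a b c) \<le> K * (X_norm s a * X_norm s b * X_norm s c)"
      by (simp add: K_def C_def power2_eq_square mult_ac)
  qed
  have e: "rhs \<alpha> w = (\<lambda>x. N1 w w w x - 3 * N2 w w w x + 3 * N3 w w w x - A * N4 w w w x)" for w
    by (simp add: rhs_def N1_def N2_def N3_def N4_def A_def power2_eq_square power3_eq_cube mult_ac fun_eq_iff)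
  show rX: "in_X s (rhs \<alpha> u)" if "in_X s u" for u
    unfolding e by (intro in_X_diff(1) in_X_add(1) in_X_cmult_le(1) n1 n2 n3 p3 that)
  show "X_norm s (\<lambda>x. rhs \<alpha> u x - rhs \<alpha> v x) \<le> lip M * X_norm s (\<lambda>x. u x - v x)"
    if u: "in_X s u" "X_norm s u \<le> M" and v: "in_X s v" "X_norm s v \<le> M"
  proof -
    define W where "W = X_norm s (\<lambda>x. u x - v x)"
    have W: "W \<ge> 0" unfolding W_def by (rule X_norm_nonneg[OF in_X_diff(1)[OF u(1) v(1)]])
    have d1: "X_norm s (\<lambda>x. N1 u u u x - N1 v v v x) \<le> 3 * K * M\<^sup>2 * W"
      unfolding W_def
    proof (rule trilinear_diff[OF n1 _ _ _ u v K])
      fix a a' b c assume h: "in_X s a" "in_X s a'" "in_X s b" "in_X s c"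
      show "N1 (\<lambda>x. a x - a' x) b c = (\<lambda>x. N1 a b c x - N1 a' b c x)"
        using conv_diff[OF p3(1)[OF h(1,3,4)] p3(1)[OF h(2,3,4)]] by (simp add: N1_def N4_def[abs_def] fun_eq_iff algebra_simps)
      show "N1 b (\<lambda>x. a x - a' x) c = (\<lambda>x. N1 b a c x - N1 b a' c x)"
        using conv_diff[OF p3(1)[OF h(3,1,4)] p3(1)[OF h(3,2,4)]] by (simp add: N1_def N4_def[abs_def] fun_eq_iff algebra_simps)
      show "N1 b c (\<lambda>x. a x - a' x) = (\<lambda>x. N1 b c a x - N1 b c a' x)"
        using conv_diff[OF p3(1)[OF h(3,4,1)] p3(1)[OF h(3,4,2)]] by (simp add: N1_def N4_def[abs_def] fun_eq_iff algebra_simps)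
    qed
    have d2: "X_norm s (\<lambda>x. N2 u u u x - N2 v v v x) \<le> 3 * K * M\<^sup>2 * W"
      unfolding W_def
    proof (rule trilinear_diff[OF n2 _ _ _ u v K])
      fix a a' b c assume h: "in_X s a" "in_X s a'" "in_X s b" "in_X s c"
      show "N2 (\<lambda>x. a x - a' x) b c = (\<lambda>x. N2 a b c x - N2 a' b c x)"
        by (simp add: N2_def fun_eq_iff algebra_simps)
      show "N2 b (\<lambda>x. a x - a' x) c = (\<lambda>x. N2 b a c x - N2 b a' c x)"
        using conv_diff[OF p2(1)[OF h(1,4)] p2(1)[OF h(2,4)]] by (simp add: N2_def fun_eq_iff left_diff_distrib right_diff_distrib)
      show "N2 b c (\<lambda>x. a x - a' x) = (\<lambda>x. N2 b c a x - N2 b c a' x)"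
        using conv_diff[OF p2(1)[OF h(4,1)] p2(1)[OF h(4,2)]] by (simp add: N2_def fun_eq_iff left_diff_distrib right_diff_distrib)
    qed
    have d3: "X_norm s (\<lambda>x. N3 u u u x - N3 v v v x) \<le> 3 * K * M\<^sup>2 * W"
      unfolding W_def
    proof (rule trilinear_diff[OF n3 _ _ _ u v K])
      fix a a' b c assume h: "in_X s a" "in_X s a'" "in_X s b" "in_X s c"
      show "N3 (\<lambda>x. a x - a' x) b c = (\<lambda>x. N3 a b c x - N3 a' b c x)"
        by (simp add: N3_def fun_eq_iff algebra_simps)
      show "N3 b (\<lambda>x. a x - a' x) c = (\<lambda>x. N3 b a c x - N3 b a' c x)"
        by (simp add: N3_def fun_eq_iff algebra_simps)
      show "N3 b c (\<lambda>x. a x - a' x) = (\<lambda>x. N3 b c a x - N3 b c a' x)"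
        using conv_diff[OF h(1,2)] by (simp add: N3_def fun_eq_iff right_diff_distrib)
    qed
    have d4: "X_norm s (\<lambda>x. N4 u u u x - N4 v v v x) \<le> 3 * C\<^sup>2 * M\<^sup>2 * W"
      unfolding W_def
      by (rule trilinear_diff[OF p3 _ _ _ u v]) (auto simp: N4_def fun_eq_iff algebra_simps)
    define D1 where "D1 x = N1 u u u x - N1 v v v x" for x
    define D2 where "D2 x = N2 u u u x - N2 v v v x" for x
    define D3 where "D3 x = N3 u u u x - N3 v v v x" for x
    define D4 where "D4 x = N4 u u u x - N4 v v v x" for x
    have DX: "in_X s D1" "in_X s D2" "in_X s D3" "in_X s D4"
      unfolding D1_def D2_def D3_def D4_def by (intro in_X_diff(1) n1 n2 n3 p3 u v)+
    have eq: "(\<lambda>x. rhs \<alpha> u x - rhs \<alpha> v x) = (\<lambda>x. D1 x - 3 * D2 x + 3 * D3 x - A * D4 x)"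
      unfolding e D1_def D2_def D3_def D4_def by (simp add: algebra_simps)
    note m2 = in_X_cmult_le[OF DX(2), of 3] and m3 = in_X_cmult_le[OF DX(3), of 3] and m4 = in_X_cmult_le[OF DX(4), of A]
    note s1 = in_X_diff[OF DX(1) m2(1)]
    note s2 = in_X_add[OF s1(1) m3(1)]
    note s3 = in_X_diff[OF s2(1) m4(1)]
    \<comment> \<open>The plain cube contains no convolution; its factor \<open>mass\<close> comes
      from the bound on A, after which all four terms share the constant K.\<close>
    have "\<bar>A\<bar> * X_norm s D4 \<le> mass * (3 * C\<^sup>2 * M\<^sup>2 * W)"
      using integral_le_mass d4 mass_nonneg X_norm_nonneg[OF DX(4)] unfolding A_def D4_def by (intro mult_mono) auto
    then have "\<bar>A\<bar> * X_norm s D4 \<le> 3 * K * M\<^sup>2 * W" by (simp add: K_def mult_ac)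
    then have "X_norm s (\<lambda>x. rhs \<alpha> u x - rhs \<alpha> v x) \<le> 8 * (3 * K * M\<^sup>2 * W)"
      unfolding eq using s1(2) s2(2) s3(2) m2(2) m3(2) m4(2) d1 d2 d3
      unfolding D1_def[symmetric] D2_def[symmetric] D3_def[symmetric] by simp
    then show ?thesis by (simp add: lip_def W_def K_def C_def)
  qed
qed

text \<open>A local substitute for the mean value inequality: the increment is h times the
  derivative plus a remainder r of norm below \<epsilon>. It feeds both the continuity of curves and
  the Gronwall step.\<close>

lemma X_deriv_step:
  assumes d: "X_deriv s T u u1" and X: "\<And>t. t \<in> {0..T} \<Longrightarrow> in_X s (u t)" "\<And>t. t \<in> {0..T} \<Longrightarrow> in_X s (u1 t)"
    and t: "t \<in> {0..T}" and \<epsilon>: "\<epsilon> > 0"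
  shows "\<exists>\<delta>>0. \<forall>t'\<in>{0..T}. \<bar>t' - t\<bar> < \<delta> \<longrightarrow> X_norm s (\<lambda>x. u t' x - u t x) \<le> \<bar>t' - t\<bar> * (X_norm s (u1 t) + \<epsilon>)"
proof -
  obtain \<delta> where \<delta>: "\<delta> > 0" "\<And>t'. t' \<in> {0..T} \<Longrightarrow> t' \<noteq> t \<Longrightarrow> \<bar>t' - t\<bar> < \<delta> \<Longrightarrow>
      X_norm s (\<lambda>x. (u t' x - u t x) / (t' - t) - u1 t x) < \<epsilon>"
    using d t \<epsilon> unfolding X_deriv_def by metis
  have "X_norm s (\<lambda>x. u t' x - u t x) \<le> \<bar>t' - t\<bar> * (X_norm s (u1 t) + \<epsilon>)" if t': "t' \<in> {0..T}" "\<bar>t' - t\<bar> < \<delta>" for t'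
  proof (cases "t' = t")
    case True
    then show ?thesis by (simp add: X_norm_zero)
  next
    case False
    define h where "h = t' - t"
    have h: "h \<noteq> 0" using False by (simp add: h_def)
    define r where "r x = (u t' x - u t x) / h - u1 t x" for x
    have rX: "in_X s r"
      unfolding r_def
      using in_X_diff(1)[OF in_X_cmult_le(1)[OF in_X_diff(1)[OF X(1)[OF t'(1)] X(1)[OF t]], of "1 / h"] X(2)[OF t]] by simp
    have rn: "X_norm s r < \<epsilon>" using \<delta>(2)[OF t'(1) False t'(2)] by (simp add: r_def[abs_def] h_def)
    note a = in_X_add[OF X(2)[OF t] rX]
    have "(\<lambda>x. u t' x - u t x) = (\<lambda>x. h * (u1 t x + r x))"
      using h by (simp add: r_def fun_eq_iff)
    then have "X_norm s (\<lambda>x. u t' x - u t x) \<le> \<bar>h\<bar> * X_norm s (\<lambda>x. u1 t x + r x)"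
      using in_X_cmult_le(2)[OF a(1), of h] by simp
    also have "\<dots> \<le> \<bar>h\<bar> * (X_norm s (u1 t) + \<epsilon>)"
      using a(2) rn by (intro mult_left_mono) auto
    finally show ?thesis by (simp add: h_def)
  qed
  with \<delta>(1) show ?thesis by blast
qed

lemma X_norm_diff_le:
  assumes "in_X s u" "in_X s v"
  shows "X_norm s u \<le> X_norm s v + X_norm s (\<lambda>x. u x - v x)"
  using in_X_add(2)[OF assms(2) in_X_diff(1)[OF assms]] by simp

lemma X_deriv_imp_X_cont:
  assumes d: "X_deriv s T u u1" and X: "\<And>t. t \<in> {0..T} \<Longrightarrow> in_X s (u t)" "\<And>t. t \<in> {0..T} \<Longrightarrow> in_X s (u1 t)"
  shows "X_cont s T u"
  unfolding X_cont_def
proof (intro ballI allI impI)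
  fix t \<epsilon> :: real assume t: "t \<in> {0..T}" and \<epsilon>: "\<epsilon> > 0"
  obtain \<delta> where \<delta>: "\<delta> > 0" "\<And>t'. t' \<in> {0..T} \<Longrightarrow> \<bar>t' - t\<bar> < \<delta> \<Longrightarrow> X_norm s (\<lambda>x. u t' x - u t x) \<le> \<bar>t' - t\<bar> * (X_norm s (u1 t) + 1)"
    using X_deriv_step[OF d X t zero_less_one] by blast
  define L where "L = X_norm s (u1 t) + 1"
  have L: "L > 0" using X_norm_nonneg[OF X(2)[OF t]] by (simp add: L_def)
  show "\<exists>\<delta>>0. \<forall>t'\<in>{0..T}. \<bar>t' - t\<bar> < \<delta> \<longrightarrow> X_norm s (\<lambda>x. u t' x - u t x) < \<epsilon>"
  proof (intro exI[of _ "min \<delta> (\<epsilon> / L)"] conjI ballI impI)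
    show "0 < min \<delta> (\<epsilon> / L)" using \<delta>(1) \<epsilon> L by simp
    fix t' assume t': "t' \<in> {0..T}" "\<bar>t' - t\<bar> < min \<delta> (\<epsilon> / L)"
    have "X_norm s (\<lambda>x. u t' x - u t x) \<le> \<bar>t' - t\<bar> * L" unfolding L_def using t' by (intro \<delta>(2)) auto
    also have "\<dots> < \<epsilon>" using t'(2) L by (simp add: field_simps)
    finally show "X_norm s (\<lambda>x. u t' x - u t x) < \<epsilon>" .
  qed
qed

lemma X_cont_norm:
  assumes c: "X_cont s T u" and X: "\<And>t. t \<in> {0..T} \<Longrightarrow> in_X s (u t)"
  shows "continuous_on {0..T} (\<lambda>t. X_norm s (u t))"
  unfolding continuous_on_iff
proof (intro ballI allI impI)
  fix t e :: real assume t: "t \<in> {0..T}" and e: "e > 0"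
  obtain \<delta> where \<delta>: "\<delta> > 0" "\<And>t'. t' \<in> {0..T} \<Longrightarrow> \<bar>t' - t\<bar> < \<delta> \<Longrightarrow> X_norm s (\<lambda>x. u t' x - u t x) < e"
    using c t e unfolding X_cont_def by metis
  have "dist (X_norm s (u t')) (X_norm s (u t)) < e" if t': "t' \<in> {0..T}" "dist t' t < \<delta>" for t'
    using X_norm_diff_le[OF X[OF t'(1)] X[OF t]] X_norm_diff_le[OF X[OF t] X[OF t'(1)]]
      X_norm_minus_commute[OF X[OF t'(1)] X[OF t]] \<delta>(2)[OF t'(1)] t'(2) by (simp add: dist_real_def)
  with \<delta>(1) show "\<exists>d>0. \<forall>t'\<in>{0..T}. dist t' t < d \<longrightarrow> dist (X_norm s (u t')) (X_norm s (u t)) < e" by blast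
qed

lemma X_deriv_diff:
  assumes d: "X_deriv s T u u1" and X: "\<And>t. t \<in> {0..T} \<Longrightarrow> in_X s (u t)" "\<And>t. t \<in> {0..T} \<Longrightarrow> in_X s (u1 t)"
    and d': "X_deriv s T v v1" and X': "\<And>t. t \<in> {0..T} \<Longrightarrow> in_X s (v t)" "\<And>t. t \<in> {0..T} \<Longrightarrow> in_X s (v1 t)"
  shows "X_deriv s T (\<lambda>t x. u t x - v t x) (\<lambda>t x. u1 t x - v1 t x)"
  unfolding X_deriv_def
proof (intro ballI allI impI)
  fix t \<epsilon> :: real assume t: "t \<in> {0..T}" and \<epsilon>: "\<epsilon> > 0"
  have \<epsilon>2: "\<epsilon> / 2 > 0" using \<epsilon> by simp
  obtain \<delta> where \<delta>: "\<delta> > 0" "\<And>t'. t' \<in> {0..T} \<Longrightarrow> t' \<noteq> t \<Longrightarrow> \<bar>t' - t\<bar> < \<delta> \<Longrightarrow>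
      X_norm s (\<lambda>x. (u t' x - u t x) / (t' - t) - u1 t x) < \<epsilon> / 2"
    using d t \<epsilon>2 unfolding X_deriv_def by metis
  obtain \<delta>' where \<delta>': "\<delta>' > 0" "\<And>t'. t' \<in> {0..T} \<Longrightarrow> t' \<noteq> t \<Longrightarrow> \<bar>t' - t\<bar> < \<delta>' \<Longrightarrow>
      X_norm s (\<lambda>x. (v t' x - v t x) / (t' - t) - v1 t x) < \<epsilon> / 2"
    using d' t \<epsilon>2 unfolding X_deriv_def by metis
  show "\<exists>\<delta>>0. \<forall>t'\<in>{0..T}. t' \<noteq> t \<and> \<bar>t' - t\<bar> < \<delta> \<longrightarrow>
      X_norm s (\<lambda>x. (u t' x - v t' x - (u t x - v t x)) / (t' - t) - (u1 t x - v1 t x)) < \<epsilon>"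
  proof (intro exI[of _ "min \<delta> \<delta>'"] conjI ballI impI)
    show "0 < min \<delta> \<delta>'" using \<delta> \<delta>' by simp
    fix t' assume t': "t' \<in> {0..T}" "t' \<noteq> t \<and> \<bar>t' - t\<bar> < min \<delta> \<delta>'"
    define h where "h = t' - t"
    define p where "p x = (u t' x - u t x) / h - u1 t x" for x
    define q where "q x = (v t' x - v t x) / h - v1 t x" for x
    have pX: "in_X s p" and qX: "in_X s q"
      unfolding p_def q_def
      using in_X_diff(1)[OF in_X_cmult_le(1)[OF in_X_diff(1)[OF X(1)[OF t'(1)] X(1)[OF t]], of "1 / h"] X(2)[OF t]]
        in_X_diff(1)[OF in_X_cmult_le(1)[OF in_X_diff(1)[OF X'(1)[OF t'(1)] X'(1)[OF t]], of "1 / h"] X'(2)[OF t]] by simp_all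
    have "X_norm s p < \<epsilon> / 2" "X_norm s q < \<epsilon> / 2"
      using \<delta>(2)[OF t'(1)] \<delta>'(2)[OF t'(1)] t'(2) by (auto simp: p_def[abs_def] q_def[abs_def] h_def)
    moreover have "(\<lambda>x. (u t' x - v t' x - (u t x - v t x)) / (t' - t) - (u1 t x - v1 t x)) = (\<lambda>x. p x - q x)"
      by (simp add: p_def q_def h_def fun_eq_iff diff_divide_distrib)
    ultimately show "X_norm s (\<lambda>x. (u t' x - v t' x - (u t x - v t x)) / (t' - t) - (u1 t x - v1 t x)) < \<epsilon>"
      using in_X_diff(2)[OF pX qX] by simp
  qed
qed

text \<open>The difference w of the solutions is treated as a first order system. For f, the sum of
  the norms of w and of its derivative, the growth rate is at most |w1| + |w2|, and |w2| <= lip M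
  |w|, hence at most (1 + lip M) f.\<close>

lemma solution_stability:
  assumes u: "is_C2_solution s \<alpha> T \<phi> \<psi> u" and v: "is_C2_solution s \<alpha> T \<phi>' \<psi>' v"
    and \<phi>: "in_X s \<phi>" "in_X s \<psi>" "in_X s \<phi>'" "in_X s \<psi>'"
    and T: "T > 0" and M: "\<And>t. t \<in> {0..T} \<Longrightarrow> X_norm s (u t) \<le> M" "\<And>t. t \<in> {0..T} \<Longrightarrow> X_norm s (v t) \<le> M"
    and t: "t \<in> {0..T}"
  shows "X_norm s (\<lambda>x. u t x - v t x) \<le> (X_norm s (\<lambda>x. \<phi> x - \<phi>' x) + X_norm s (\<lambda>x. \<psi> x - \<psi>' x)) * exp ((1 + lip M) * t)"
proof -
  obtain u1 u2 where u: "\<And>t. t \<in> {0..T} \<Longrightarrow> in_X s (u t)" "\<And>t. t \<in> {0..T} \<Longrightarrow> in_X s (u1 t)" "\<And>t. t \<in> {0..T} \<Longrightarrow> in_X s (u2 t)"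
     "X_deriv s T u u1" "X_deriv s T u1 u2" "\<And>t. t \<in> {0..T} \<Longrightarrow> AE x in lborel. u2 t x = rhs \<alpha> (u t) x"
     "AE x in lborel. u 0 x = \<phi> x" "AE x in lborel. u1 0 x = \<psi> x"
    using u unfolding is_C2_solution_def by blast
  obtain v1 v2 where v: "\<And>t. t \<in> {0..T} \<Longrightarrow> in_X s (v t)" "\<And>t. t \<in> {0..T} \<Longrightarrow> in_X s (v1 t)" "\<And>t. t \<in> {0..T} \<Longrightarrow> in_X s (v2 t)"
     "X_deriv s T v v1" "X_deriv s T v1 v2" "\<And>t. t \<in> {0..T} \<Longrightarrow> AE x in lborel. v2 t x = rhs \<alpha> (v t) x"
     "AE x in lborel. v 0 x = \<phi>' x" "AE x in lborel. v1 0 x = \<psi>' x"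
    using v unfolding is_C2_solution_def by blast
  define w where "w t x = u t x - v t x" for t x
  define w1 where "w1 t x = u1 t x - v1 t x" for t x
  define w2 where "w2 t x = u2 t x - v2 t x" for t x
  have wX: "\<And>t. t \<in> {0..T} \<Longrightarrow> in_X s (w t)" "\<And>t. t \<in> {0..T} \<Longrightarrow> in_X s (w1 t)" "\<And>t. t \<in> {0..T} \<Longrightarrow> in_X s (w2 t)"
    unfolding w_def w1_def w2_def using u(1-3) v(1-3) by (auto intro: in_X_diff(1))
  have dw: "X_deriv s T w w1" "X_deriv s T w1 w2"
    unfolding w_def[abs_def] w1_def[abs_def] w2_def[abs_def]
    by (rule X_deriv_diff[OF u(4) u(1,2) v(4) v(1,2)], assumption+) (rule X_deriv_diff[OF u(5) u(2,3) v(5) v(2,3)], assumption+)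
  have w2le: "X_norm s (w2 t) \<le> lip M * X_norm s (w t)" if t: "t \<in> {0..T}" for t
  proof -
    note r = rhs_X(1)[OF u(1)[OF t]] rhs_X(1)[OF v(1)[OF t]]
    have "AE x in lborel. rhs \<alpha> (u t) x - rhs \<alpha> (v t) x = w2 t x"
      using u(6)[OF t] v(6)[OF t] by eventually_elim (simp add: w2_def)
    then have "X_norm s (w2 t) = X_norm s (\<lambda>x. rhs \<alpha> (u t) x - rhs \<alpha> (v t) x)"
      by (rule in_X_cong_AE(2)[OF in_X_diff(1)[OF r] in_XD(3)[OF wX(3)[OF t]]])
    also have "\<dots> \<le> lip M * X_norm s (w t)"
      unfolding w_def by (rule rhs_X(2)[OF u(1)[OF t] v(1)[OF t] M(1)[OF t] M(2)[OF t]])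
    finally show ?thesis .
  qed
  define f where "f t = X_norm s (w t) + X_norm s (w1 t)" for t
  define K where "K = 1 + lip M"
  have cont: "continuous_on {0..T} f"
    unfolding f_def by (intro continuous_on_add X_cont_norm X_deriv_imp_X_cont[OF dw(1)] X_deriv_imp_X_cont[OF dw(2)] wX)
  have T0: "0 \<in> {0..T}" using T by simp
  have f0: "f 0 \<ge> 0" unfolding f_def using X_norm_nonneg wX T0 by (intro add_nonneg_nonneg) auto
  have "f t \<le> f 0 * exp (K * t)"
  proof (rule gronwall_right[OF _ f0 cont])
    show "K \<ge> 0" using lip_nonneg by (simp add: K_def add_nonneg_nonneg)
    show "0 \<le> t" "t \<le> T" using t by auto
    fix t \<epsilon> :: real assume t: "0 \<le> t" "t < T" and \<epsilon>: "\<epsilon> > 0"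
    have tT: "t \<in> {0..T}" using t by simp
    have \<epsilon>2: "\<epsilon> / 2 > 0" using \<epsilon> by simp
    \<comment> \<open>Each of the two components of f may use half of the error.\<close>
    obtain d1 where d1: "d1 > 0" "\<And>t'. t' \<in> {0..T} \<Longrightarrow> \<bar>t' - t\<bar> < d1 \<Longrightarrow> X_norm s (\<lambda>x. w t' x - w t x) \<le> \<bar>t' - t\<bar> * (X_norm s (w1 t) + \<epsilon> / 2)"
      using X_deriv_step[OF dw(1) wX(1,2) tT \<epsilon>2] by blast
    obtain d2 where d2: "d2 > 0" "\<And>t'. t' \<in> {0..T} \<Longrightarrow> \<bar>t' - t\<bar> < d2 \<Longrightarrow> X_norm s (\<lambda>x. w1 t' x - w1 t x) \<le> \<bar>t' - t\<bar> * (X_norm s (w2 t) + \<epsilon> / 2)"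
      using X_deriv_step[OF dw(2) wX(2,3) tT \<epsilon>2] by blast
    show "\<exists>\<delta>>0. \<forall>t'. t < t' \<and> t' \<le> T \<and> t' - t < \<delta> \<longrightarrow> f t' \<le> f t + (t' - t) * (K * f t + \<epsilon>)"
    proof (intro exI[of _ "min d1 d2"] conjI allI impI)
      show "0 < min d1 d2" using d1 d2 by simp
      fix t' assume t': "t < t' \<and> t' \<le> T \<and> t' - t < min d1 d2"
      have tT': "t' \<in> {0..T}" using t t' by simp
      have a1: "X_norm s (w t') \<le> X_norm s (w t) + (t' - t) * (X_norm s (w1 t) + \<epsilon> / 2)"
        using X_norm_diff_le[OF wX(1)[OF tT'] wX(1)[OF tT]] d1(2)[OF tT'] t' by simp
      have a2: "X_norm s (w1 t') \<le> X_norm s (w1 t) + (t' - t) * (X_norm s (w2 t) + \<epsilon> / 2)"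
        using X_norm_diff_le[OF wX(2)[OF tT'] wX(2)[OF tT]] d2(2)[OF tT'] t' by simp
      have nn: "X_norm s (w t) \<ge> 0" "X_norm s (w1 t) \<ge> 0" using X_norm_nonneg wX tT by auto
      have "lip M * X_norm s (w1 t) \<ge> 0" using lip_nonneg nn by simp
      then have "X_norm s (w1 t) + X_norm s (w2 t) \<le> K * f t"
        using w2le[OF tT] nn by (simp add: K_def f_def algebra_simps)
      then have le: "(t' - t) * ((X_norm s (w1 t) + X_norm s (w2 t)) + \<epsilon>) \<le> (t' - t) * (K * f t + \<epsilon>)"
        using t' by (intro mult_left_mono) auto
      have "f t' \<le> f t + ((t' - t) * (X_norm s (w1 t) + \<epsilon> / 2) + (t' - t) * (X_norm s (w2 t) + \<epsilon> / 2))"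
        unfolding f_def using a1 a2 by linarith
      also have "\<dots> = f t + (t' - t) * ((X_norm s (w1 t) + X_norm s (w2 t)) + \<epsilon>)"
        by (simp add: distrib_left)
      also have "\<dots> \<le> f t + (t' - t) * (K * f t + \<epsilon>)"
        using le by (rule add_left_mono)
      finally show "f t' \<le> f t + (t' - t) * (K * f t + \<epsilon>)" .
    qed
  qed
  moreover have "X_norm s (\<lambda>x. u t x - v t x) \<le> f t"
    using X_norm_nonneg[OF wX(2)[OF t]] by (simp add: f_def w_def[abs_def])
  moreover have "f 0 = X_norm s (\<lambda>x. \<phi> x - \<phi>' x) + X_norm s (\<lambda>x. \<psi> x - \<psi>' x)"
  proof -
    have "AE x in lborel. \<phi> x - \<phi>' x = w 0 x" using u(7) v(7) by eventually_elim (simp add: w_def)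
    then have "X_norm s (w 0) = X_norm s (\<lambda>x. \<phi> x - \<phi>' x)"
      by (rule in_X_cong_AE(2)[OF in_X_diff(1)[OF \<phi>(1,3)] in_XD(3)[OF wX(1)[OF T0]]])
    moreover have "AE x in lborel. \<psi> x - \<psi>' x = w1 0 x" using u(8) v(8) by eventually_elim (simp add: w1_def)
    then have "X_norm s (w1 0) = X_norm s (\<lambda>x. \<psi> x - \<psi>' x)"
      by (rule in_X_cong_AE(2)[OF in_X_diff(1)[OF \<phi>(2,4)] in_XD(3)[OF wX(2)[OF T0]]])
    ultimately show ?thesis by (simp add: f_def)
  qed
  ultimately show ?thesis by (simp add: K_def)
qed

section \<open>Existence, uniqueness and dependence on the data\<close>

lemma solution_in_X: "is_C2_solution s \<alpha> T \<phi> \<psi> u \<Longrightarrow> t \<in> {0..T} \<Longrightarrow> in_X s (u t)"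
  unfolding is_C2_solution_def by blast

text \<open>Continuity on a compact interval provides the bound M under which the Lipschitz estimate
  can be applied to arbitrary solutions.\<close>

lemma solution_bounded:
  assumes u: "is_C2_solution s \<alpha> T \<phi> \<psi> u"
  shows "\<exists>M. \<forall>t\<in>{0..T}. X_norm s (u t) \<le> M"
proof -
  obtain u1 where u1: "X_deriv s T u u1" "\<And>t. t \<in> {0..T} \<Longrightarrow> in_X s (u1 t)"
    using u unfolding is_C2_solution_def by blast
  have "continuous_on {0..T} (\<lambda>t. X_norm s (u t))"
    by (intro X_cont_norm X_deriv_imp_X_cont[OF u1(1)] u1(2) solution_in_X[OF u])
  then have "bounded ((\<lambda>t. X_norm s (u t)) ` {0..T})"
    by (intro compact_imp_bounded compact_continuous_image) auto
  then obtain B where "\<forall>t\<in>{0..T}. \<bar>X_norm s (u t)\<bar> \<le> B"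
    unfolding bounded_iff by auto
  then show ?thesis by (meson abs_le_D1)
qed

lemma solution_unique:
  assumes u: "is_C2_solution s \<alpha> T \<phi> \<psi> u" and v: "is_C2_solution s \<alpha> T \<phi> \<psi> v"
    and \<phi>: "in_X s \<phi>" "in_X s \<psi>" and T: "T > 0" and t: "t \<in> {0..T}"
  shows "AE x in lborel. u t x = v t x"
proof -
  obtain M1 M2 where M: "\<And>t. t \<in> {0..T} \<Longrightarrow> X_norm s (u t) \<le> M1" "\<And>t. t \<in> {0..T} \<Longrightarrow> X_norm s (v t) \<le> M2"
    using solution_bounded[OF u] solution_bounded[OF v] by blast
  have "X_norm s (\<lambda>x. u t x - v t x) \<le> (X_norm s (\<lambda>x. \<phi> x - \<phi> x) + X_norm s (\<lambda>x. \<psi> x - \<psi> x)) * exp ((1 + lip (max M1 M2)) * t)"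
    by (rule solution_stability[OF u v \<phi> \<phi> T _ _ t]) (use M in \<open>fastforce simp: le_max_iff_disj\<close>)+
  then have "AE x in lborel. u t x - v t x = 0"
    by (intro X_norm_zero_AE[OF in_X_diff(1)[OF solution_in_X[OF u t] solution_in_X[OF v t]]]) (simp add: X_norm_zero)
  then show ?thesis by eventually_elim simp
qed

text \<open>With T = 1 / (2 R) the ratio R t is at most 1/2, so the geometric series gives the bound
  2 M. Lifetime and bound depend only on M and R, which is what continuous dependence needs.\<close>

lemma solution_exists:
  assumes \<phi>: "in_X s \<phi>" "X_norm s \<phi> \<le> M" and \<psi>: "in_X s \<psi>" "X_norm s \<psi> \<le> M"
    and R: "R \<ge> 1" "growth_const * M\<^sup>2 \<le> R" and M: "M \<ge> 0" and T: "T = 1 / (2 * R)"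
  shows "\<exists>u. is_C2_solution s \<alpha> T \<phi> \<psi> u \<and> (\<forall>t\<in>{0..T}. X_norm s (u t) \<le> 2 * M)"
proof -
  have R0: "R > 0" and T0: "T > 0" and RT: "R * T \<le> 1 / 2" using R by (auto simp: T)
  define c where "c = series_coeff \<alpha> \<phi> \<psi>"
  have c: "in_X s (c n)" "X_norm s (c n) \<le> M * R ^ n" for n
    using series_coeff_bound[OF \<phi> \<psi> R M, of n] by (auto simp: c_def)
  have g: "growth R c"
    unfolding growth_def using M c by (intro exI[of _ M] exI[of _ 0]) auto
  define c1 where "c1 n x = real (n + 1) * c (n + 1) x" for n x
  define c2 where "c2 n x = real (n + 1) * c1 (n + 1) x" for n x
  have g1: "growth R c1" unfolding c1_def by (rule growth_shift[OF R0 T0 RT g])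
  have g2: "growth R c2" unfolding c2_def by (rule growth_shift[OF R0 T0 RT g1])
  \<comment> \<open>One derivative more than the equation involves: the second time derivative is
    continuous because it is differentiable.\<close>
  have g3: "growth R (\<lambda>n x. real (n + 1) * c2 (n + 1) x)" by (rule growth_shift[OF R0 T0 RT g2])
  have cancel: "p \<noteq> 0 \<Longrightarrow> q \<noteq> 0 \<Longrightarrow> p * (q * (1 / (p * q) * r)) = r" for p q r :: real
    by simp
  have c2': "c2 = rhs_coeff \<alpha> c"
  proof (intro ext)
    fix n x
    have "c2 n x = real (n + 1) * (real (n + 2) * (1 / (real (n + 1) * real (n + 2)) * rhs_coeff \<alpha> c n x))"
      unfolding c2_def c1_def c_def by (simp add: series_coeff_Suc_Suc)
    then show "c2 n x = rhs_coeff \<alpha> c n x" by (subst (asm) cancel) auto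
  qed
  note X = time_series_in_X(2)[OF R0 T0 RT]
  note dX = X_deriv_time_series[OF R0 T0 RT]
  have d2: "X_deriv s T (time_series c2) (time_series (\<lambda>n x. real (n + 1) * c2 (n + 1) x))" by (rule dX[OF g2])
  have "is_C2_solution s \<alpha> T \<phi> \<psi> (time_series c)"
    unfolding is_C2_solution_def
  proof (rule exI[of _ "time_series c1"], rule exI[of _ "time_series c2"], intro conjI ballI)
    show "X_deriv s T (time_series c) (time_series c1)" using dX[OF g] by (simp add: c1_def[abs_def])
    show "X_deriv s T (time_series c1) (time_series c2)" using dX[OF g1] by (simp add: c2_def[abs_def])
    show "X_cont s T (time_series c2)"
      by (rule X_deriv_imp_X_cont[OF d2]) (use X[OF g2] X[OF g3] in auto)
    show "AE x in lborel. time_series c 0 x = \<phi> x" "AE x in lborel. time_series c1 0 x = \<psi> x"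
      by (auto simp: time_series_def powser_zero c_def c1_def)
    fix t assume t: "t \<in> {0..T}"
    show "in_X s (time_series c t)" "in_X s (time_series c1 t)" "in_X s (time_series c2 t)"
      using t by (auto intro: X g g1 g2)
    show "AE x in lborel. time_series c2 t x = rhs \<alpha> (time_series c t) x"
      unfolding c2' using t by (intro time_series_rhs[OF R0 T0 RT g]) auto
  qed
  moreover have "X_norm s (time_series c t) \<le> 2 * M" if t: "t \<in> {0..T}" for t
  proof -
    have le: "X_norm s (c n) * t ^ n \<le> M * (1 / 2) ^ n" for n
    proof -
      have "R * t \<le> R * T" using t R0 by simp
      with RT have "R * t \<le> 1 / 2" by linarith
      then have "M * (R * t) ^ n \<le> M * (1 / 2) ^ n" using M R0 t by (intro mult_left_mono power_mono) auto
      moreover have "X_norm s (c n) * t ^ n \<le> M * R ^ n * t ^ n" using t by (intro mult_right_mono c) auto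
      ultimately show ?thesis by (simp add: power_mult_distrib mult.assoc)
    qed
    have "X_norm s (time_series c t) \<le> (\<Sum>n. X_norm s (c n) * t ^ n)"
      using t by (intro time_series_in_X(3)[OF R0 T0 RT g]) auto
    also have "\<dots> \<le> (\<Sum>n. M * (1 / 2) ^ n)"
      using t by (intro suminf_le le growth_summable(1)[OF R0 T0 RT g] summable_mult summable_geometric) auto
    also have "\<dots> = 2 * M"
      by (subst suminf_mult) (auto simp: suminf_geometric)
    finally show ?thesis .
  qed
  ultimately show ?thesis by blast
qed

lemma locally_well_posed:
  assumes \<phi>: "in_X s \<phi>" and \<psi>: "in_X s \<psi>"
  shows "\<exists>T>0. well_posed s \<alpha> T \<phi> \<psi>"
proof -
  \<comment> \<open>The added 1 leaves room for all data at distance less than 1, so they have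
    solutions on the same interval.\<close>
  define M where "M = X_norm s \<phi> + X_norm s \<psi> + 1"
  have n: "X_norm s \<phi> \<ge> 0" "X_norm s \<psi> \<ge> 0" using X_norm_nonneg \<phi> \<psi> by auto
  have M: "M \<ge> 0" using n by (simp add: M_def)
  define R where "R = 1 + growth_const * M\<^sup>2"
  have R: "R \<ge> 1" "growth_const * M\<^sup>2 \<le> R" using growth_const_nonneg by (auto simp: R_def)
  define T where "T = 1 / (2 * R)"
  have T: "T > 0" using R by (simp add: T_def)
  have "well_posed s \<alpha> T \<phi> \<psi>"
    unfolding well_posed_def
  proof (intro conjI allI impI)
    show "\<exists>u. is_C2_solution s \<alpha> T \<phi> \<psi> u"
      using solution_exists[OF \<phi> _ \<psi> _ R M T_def] n by (auto simp: M_def)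
    show "\<forall>t\<in>{0..T}. AE x in lborel. u t x = v t x"
      if "is_C2_solution s \<alpha> T \<phi> \<psi> u \<and> is_C2_solution s \<alpha> T \<phi> \<psi> v" for u v
      using solution_unique[OF conjunct1[OF that] conjunct2[OF that] \<phi> \<psi> T] by blast
    fix u \<epsilon> assume u: "is_C2_solution s \<alpha> T \<phi> \<psi> u" and \<epsilon>: "(\<epsilon>::real) > 0"
    obtain Mu where Mu: "\<And>t. t \<in> {0..T} \<Longrightarrow> X_norm s (u t) \<le> Mu" using solution_bounded[OF u] by blast
    \<comment> \<open>One bound for the given solution and for every perturbed one, fixed before
      \<delta> is chosen.\<close>
    define L where "L = max Mu (2 * M)"
    define E where "E = exp ((1 + lip L) * T)"
    have E: "E > 0" by (simp add: E_def)
    show "\<exists>\<delta>>0. \<forall>\<phi>' \<psi>'. in_X s \<phi>' \<and> in_X s \<psi>' \<and>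
           X_norm s (\<lambda>x. \<phi>' x - \<phi> x) + X_norm s (\<lambda>x. \<psi>' x - \<psi> x) < \<delta> \<longrightarrow>
           (\<exists>v. is_C2_solution s \<alpha> T \<phi>' \<psi>' v) \<and>
           (\<forall>v. is_C2_solution s \<alpha> T \<phi>' \<psi>' v \<longrightarrow>
              (\<forall>t\<in>{0..T}. X_norm s (\<lambda>x. v t x - u t x) < \<epsilon>))"
    proof (rule exI[of _ "min 1 (\<epsilon> / E)"], rule conjI, use \<epsilon> E in simp, intro allI impI)
      fix \<phi>' \<psi>'
      assume A: "in_X s \<phi>' \<and> in_X s \<psi>' \<and> X_norm s (\<lambda>x. \<phi>' x - \<phi> x) + X_norm s (\<lambda>x. \<psi>' x - \<psi> x) < min 1 (\<epsilon> / E)"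
      then have \<phi>': "in_X s \<phi>'" and \<psi>': "in_X s \<psi>'" by auto
      have d0: "X_norm s (\<lambda>x. \<phi>' x - \<phi> x) \<ge> 0" "X_norm s (\<lambda>x. \<psi>' x - \<psi> x) \<ge> 0"
        using X_norm_nonneg in_X_diff(1) \<phi> \<psi> \<phi>' \<psi>' by blast+
      have b: "X_norm s \<phi>' \<le> M" "X_norm s \<psi>' \<le> M"
        using X_norm_diff_le[OF \<phi>' \<phi>] X_norm_diff_le[OF \<psi>' \<psi>] A d0 n by (auto simp: M_def)
      obtain v0 where v0: "is_C2_solution s \<alpha> T \<phi>' \<psi>' v0" "\<And>t. t \<in> {0..T} \<Longrightarrow> X_norm s (v0 t) \<le> 2 * M"
        using solution_exists[OF \<phi>' b(1) \<psi>' b(2) R M T_def] by blast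
      have "X_norm s (\<lambda>x. v t x - u t x) < \<epsilon>" if v: "is_C2_solution s \<alpha> T \<phi>' \<psi>' v" and t: "t \<in> {0..T}" for v t
      proof -
        \<comment> \<open>An arbitrary solution v has no uniform bound by itself; by uniqueness it
          agrees almost everywhere with the constructed \<open>v0\<close>, which is bounded by 2
          M.\<close>
        have vb: "X_norm s (v t) \<le> L" if t: "t \<in> {0..T}" for t
        proof -
          have "X_norm s (v t) = X_norm s (v0 t)"
            by (rule in_X_cong_AE(2)[OF solution_in_X[OF v0(1) t] in_XD(3)[OF solution_in_X[OF v t]] solution_unique[OF v0(1) v \<phi>' \<psi>' T t]])
          with v0(2)[OF t] show ?thesis by (simp add: L_def)
        qed
        have ub: "X_norm s (u t) \<le> L" if t: "t \<in> {0..T}" for t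
          using Mu[OF t] by (simp add: L_def)
        have "X_norm s (\<lambda>x. v t x - u t x) \<le> (X_norm s (\<lambda>x. \<phi>' x - \<phi> x) + X_norm s (\<lambda>x. \<psi>' x - \<psi> x)) * exp ((1 + lip L) * t)"
          by (rule solution_stability[OF v u \<phi>' \<psi>' \<phi> \<psi> T vb ub t])
        also have "\<dots> \<le> (X_norm s (\<lambda>x. \<phi>' x - \<phi> x) + X_norm s (\<lambda>x. \<psi>' x - \<psi> x)) * E"
          unfolding E_def using d0 t lip_nonneg[of L] by (intro mult_left_mono) (auto intro!: mult_left_mono)
        also have "\<dots> < (\<epsilon> / E) * E" using A E by (intro mult_strict_right_mono) auto
        also have "\<dots> = \<epsilon>" using E by simp
        finally show ?thesis .
      qed
      with v0(1) show "(\<exists>v. is_C2_solution s \<alpha> T \<phi>' \<psi>' v) \<and>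
           (\<forall>v. is_C2_solution s \<alpha> T \<phi>' \<psi>' v \<longrightarrow> (\<forall>t\<in>{0..T}. X_norm s (\<lambda>x. v t x - u t x) < \<epsilon>))"
        by blast
    qed
  qed
  with T show ?thesis by blast
qed

end

theorem theorem3p1:
  fixes s :: real and \<alpha> \<phi> \<psi> :: "real \<Rightarrow> real"
  assumes "s > 0"
    and "integrable lborel \<alpha>"
    and "in_X s \<phi>" and "in_X s \<psi>"
  shows "\<exists>T>0. well_posed s \<alpha> T \<phi> \<psi>"
  using assms by (rule locally_well_posed)

end
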